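(* Let $n\in\{2,3\}$. Then there exist infinitely many, pairwise non-isometric, minimal immersions of $S^{n-1}\times S^{n-1}\times S^1$ in the round sphere $\mathbb{S}^{2n}$.
   Context: $\mathbb{S}^{2n}$ denotes the standard round unit sphere in $\mathbb{R}^{2n+1}$. $S^k$ denotes the $k$-dimensional sphere as a smooth manifold, and $S^{n-1}\times S^{n-1}\times S^1$ is the product smooth manifold. A minimal immersion is a smooth immersion (here of codimension one) with vanishing mean curvature. Two (possibly immersed) hypersurfaces of $\mathbb{S}^{2n}$ are called isometric if they are related by an ambient isometry, i.e. if some isometry of $\mathbb{S}^{2n}$ (an element of $\mathrm{O}(2n+1)$) carries one hypersurface onto the other. *)

theory Defs
  imports "HOL-Analysis.Analysis"
begin

section \<open>Smooth maps\<close>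

text \<open>
  \<open>Ck_on k f U\<close>: all directional derivatives of \<open>f\<close> of order at most \<open>k\<close> exist and are
  continuous; meant for open \<open>U\<close>.
\<close>

primrec Ck_on :: "nat \<Rightarrow> ('a::real_normed_vector \<Rightarrow> 'b::real_normed_vector) \<Rightarrow> 'a set \<Rightarrow> bool"
where
  "Ck_on 0 f U \<longleftrightarrow> continuous_on U f"
| "Ck_on (Suc k) f U \<longleftrightarrow>
     (\<forall>x\<in>U. f differentiable (at x)) \<and>
     (\<forall>v. Ck_on k (\<lambda>x. frechet_derivative f (at x) v) U)"

definition smooth_on :: "('a::real_normed_vector \<Rightarrow> 'b::real_normed_vector) \<Rightarrow> 'a set \<Rightarrow> bool"
  where "smooth_on f U \<longleftrightarrow> (\<forall>k. Ck_on k f U)"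

text \<open>
  Smoothness on an arbitrary subset \<open>M\<close> of a Euclidean space: locally the restriction of a smooth
  map defined on an open set. If \<open>M\<close> is an embedded submanifold, this is smoothness of \<open>f\<close>
  as a map on the manifold \<open>M\<close>.
\<close>

definition smooth_map_on :: "'a::euclidean_space set \<Rightarrow> ('a \<Rightarrow> 'b::euclidean_space) \<Rightarrow> bool"
  where "smooth_map_on M f \<longleftrightarrow>
    (\<forall>p\<in>M. \<exists>U g. open U \<and> p \<in> U \<and> smooth_on g U \<and> (\<forall>x\<in>M \<inter> U. g x = f x))"

section \<open>Immersed hypersurfaces of the unit sphere\<close>

text \<open>In this section \<open>M\<close> is an embedded submanifold of a Euclidean space.\<close>

definition tangent_space :: "'a::euclidean_space set \<Rightarrow> 'a \<Rightarrow> 'a set"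
  where "tangent_space M p =
    {v. \<exists>c \<epsilon>. 0 < \<epsilon> \<and> smooth_on c {-\<epsilon><..<\<epsilon>} \<and> c ` {-\<epsilon><..<\<epsilon>} \<subseteq> M \<and> c 0 = p \<and>
          (c has_vector_derivative v) (at (0::real))}"

text \<open>
  The derivative of \<open>f\<close> within \<open>M\<close> is unique only on the tangent space of \<open>M\<close>, where it
  agrees with the differential of the manifold map. The definitions below apply
  \<open>differential M f p\<close> to tangent vectors only.
\<close>

definition differential ::
    "'a::euclidean_space set \<Rightarrow> ('a \<Rightarrow> 'b::euclidean_space) \<Rightarrow> 'a \<Rightarrow> 'a \<Rightarrow> 'b"
  where "differential M f p = frechet_derivative f (at p within M)"

definition smooth_immersion :: "'a::euclidean_space set \<Rightarrow> ('a \<Rightarrow> 'b::euclidean_space) \<Rightarrow> bool"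
  where "smooth_immersion M f \<longleftrightarrow>
    smooth_map_on M f \<and> (\<forall>p\<in>M. inj_on (differential M f p) (tangent_space M p))"

text \<open>
  A smooth unit normal field along \<open>f : M \<rightarrow> sphere 0 1\<close>, tangent to the sphere (hence
  orthogonal to the position vector \<open>f p\<close>). If \<open>f\<close> has codimension one in the sphere, such a
  field exists locally and is unique up to sign.
\<close>

definition unit_normal_field ::
    "'a::euclidean_space set \<Rightarrow> ('a \<Rightarrow> 'b::euclidean_space) \<Rightarrow> ('a \<Rightarrow> 'b) \<Rightarrow> bool"
  where "unit_normal_field M f \<nu> \<longleftrightarrow>
    smooth_map_on M \<nu> \<and>
    (\<forall>p\<in>M. norm (\<nu> p) = 1 \<and> \<nu> p \<bullet> f p = 0 \<and>
       (\<forall>v\<in>tangent_space M p. \<nu> p \<bullet> differential M f p v = 0))"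

text \<open>Bases of the tangent space that are orthonormal for the metric induced by \<open>f\<close>.\<close>

definition induced_orthonormal_basis ::
    "'a::euclidean_space set \<Rightarrow> ('a \<Rightarrow> 'b::euclidean_space) \<Rightarrow> 'a \<Rightarrow> 'a set \<Rightarrow> bool"
  where "induced_orthonormal_basis M f p B \<longleftrightarrow>
    B \<subseteq> tangent_space M p \<and> span B = tangent_space M p \<and>
    (\<forall>u\<in>B. \<forall>v\<in>B. differential M f p u \<bullet> differential M f p v = (if u = v then 1 else 0))"

text \<open>
  By the Weingarten equation, the (scalar) second fundamental form in the sphere is
  \<open>h(u, v) = - d\<nu>(u) \<bullet> df(v)\<close>: the component of \<open>d\<nu>(u)\<close> normal to the sphere is orthogonal
  to \<open>df(v)\<close>, so the flat derivative of the ambient space may be used.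
\<close>

definition second_fundamental_form ::
    "'a::euclidean_space set \<Rightarrow> ('a \<Rightarrow> 'b::euclidean_space) \<Rightarrow> ('a \<Rightarrow> 'b) \<Rightarrow> 'a \<Rightarrow> 'a \<Rightarrow> 'a \<Rightarrow> real"
  where "second_fundamental_form M f \<nu> p u v =
    - (differential M \<nu> p u \<bullet> differential M f p v)"

text \<open>
  The trace of the second fundamental form with respect to the induced metric; it does not
  depend on the chosen orthonormal basis.
\<close>

definition mean_curvature ::
    "'a::euclidean_space set \<Rightarrow> ('a \<Rightarrow> 'b::euclidean_space) \<Rightarrow> ('a \<Rightarrow> 'b) \<Rightarrow> 'a \<Rightarrow> real"
  where "mean_curvature M f \<nu> p =
    (\<Sum>e\<in>(SOME B. induced_orthonormal_basis M f p B). second_fundamental_form M f \<nu> p e e)"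

text \<open>
  Minimal immersions of \<open>M\<close> in the unit sphere, meant for codimension one, i.e.
  \<open>dim M + 2\<close> is the dimension of the Euclidean space containing the sphere. Vanishing of the
  mean curvature does not depend on the sign of the local unit normal field \<open>\<nu>\<close>.
\<close>

definition minimal_immersion_in_sphere ::
    "'a::euclidean_space set \<Rightarrow> ('a \<Rightarrow> 'b::euclidean_space) \<Rightarrow> bool"
  where "minimal_immersion_in_sphere M f \<longleftrightarrow>
    smooth_immersion M f \<and> f ` M \<subseteq> sphere 0 1 \<and>
    (\<forall>p\<in>M. \<exists>U \<nu>. open U \<and> p \<in> U \<and> unit_normal_field (M \<inter> U) f \<nu> \<and>
       (\<forall>q\<in>M \<inter> U. mean_curvature (M \<inter> U) f \<nu> q = 0))"

text \<open>
  Ambient isometry of (immersed) hypersurfaces: an element of the orthogonal group carries one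
  image onto the other. In particular reparametrisations and coverings of the same hypersurface
  are isometric in this sense.
\<close>

definition isometric_hypersurfaces :: "'b::euclidean_space set \<Rightarrow> 'b set \<Rightarrow> bool"
  where "isometric_hypersurfaces X Y \<longleftrightarrow> (\<exists>A. orthogonal_transformation A \<and> A ` X = Y)"

section \<open>The product of spheres\<close>

text \<open>
  \<open>S\<^sup>n\<^sup>-\<^sup>1 \<times> S\<^sup>n\<^sup>-\<^sup>1 \<times> S\<^sup>1\<close>, where \<open>n = CARD('n)\<close>, with its standard embedding.
\<close>

definition sphere_product :: "((real^'n) \<times> (real^'n) \<times> (real^2)) set"
  where "sphere_product = sphere 0 1 \<times> sphere 0 1 \<times> sphere 0 1"

end

theory Submission
  imports Defs
begin

text \<open>
  Hypersurfaces invariant under \<open>O(n) \<times> O(n)\<close> correspond to curves in the quotient of the sphere, a lune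
  of angle \<open>\<pi>/2\<close>, and minimality becomes a geodesic equation there. In the conformal coordinates
  \<open>(u, b)\<close>, with \<open>(|x|, |y|, z) = (sech u cos (b + \<pi>/4), sech u sin (b + \<pi>/4), tanh u)\<close>, and with
  tangent angle \<open>h\<close>, a suitable choice of the time parameter turns it into an autonomous system with
  a bounded, globally Lipschitz right hand side. The cone \<open>|x| = |y|\<close> is the solution \<open>b = h = 0\<close>.

  Shoot orthogonally from the cone at \<open>u = - L\<close>. The quantity \<open>cos h * cos (2 b) ^ m\<close> with \<open>m = n - 1\<close> is
  monotone for \<open>u \<le> 0\<close>, so the curve reaches the equator \<open>u = 0\<close> in finite time. For \<open>m \<in> {1, 2}\<close> the
  quadratic form \<open>2 m X\<^sup>2 - (2 m + 1) t X Y + 2 Y\<^sup>2\<close>, \<open>|t| \<le> 1\<close>, is positive definite, because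
  \<open>16 m - (2 m + 1)\<^sup>2 = 7\<close>; hence \<open>(sin (2 b), sin h)\<close> rotates at a definite speed and its total angle
  up to the equator tends to \<open>- \<infinity>\<close> as \<open>L \<rightarrow> \<infinity>\<close>. By continuity the equator is hit orthogonally for an
  unbounded set of \<open>L\<close>, and reflecting closes up the curve.

  For \<open>L \<rightarrow> \<infinity>\<close> these hypersurfaces converge to the cone \<open>|x|\<^sup>2 - |y|\<^sup>2 = 0\<close>, whereas no orthogonal image of
  a single one of them lies in the cone, with a quantitative bound. So every isometry class contains only
  finitely many members of a suitable sequence.
\<close>

section \<open>Calculus of smooth maps\<close>

text \<open>In arclength of the \<open>(u, b)\<close> plane the geodesic equation contains
  \<open>tan (2 * b)\<close>, because the orbit volume vanishes on the boundary of the lune.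
  Multiplying the speed by \<open>cos (2 * b)\<close> removes this pole and makes the boundary
  invariant: no solution reaches it, both sphere radii stay positive, and a closed curve yields an
  immersion of the full product.

  The restriction on \<open>m\<close> is the condition that curves spiral around the cone. With
  \<open>tanh u = -1\<close> the linearisation at \<open>b = h = 0\<close> is b'' + (2m+1) b' + 4m b
  = 0. Its discriminant (2m+1)^2 - 16m is -7 for m = 1 and m = 2, but +1 for m = 3.

  Different values of \<open>L\<close> do not by themselves give non-congruent images, so one
  function is compared on all of them: |x|^2 - |y|^2, which along the curve equals - sech^2 u sin
  (2b). It is small only if \<open>b\<close> decays or \<open>u\<close> is large in absolute value,
  whereas the slope of the monotone quantity controls \<open>sin h\<close> alone. Subtracting a
  small multiple of \<open>sin h * sin (2 * b)\<close> recovers the missing direction.\<close>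

lemma Ck_on_cong:
  assumes "open U" and "\<And>x. x \<in> U \<Longrightarrow> f x = g x" and "Ck_on k f U"
  shows "Ck_on k g U"
  using assms(2,3)
proof (induction k arbitrary: f g)
  case 0
  then show ?case by (simp cong: continuous_on_cong)
next
  case (Suc k)
  have *: "(g has_derivative frechet_derivative f (at x)) (at x)" if "x \<in> U" for x
  proof (rule has_derivative_transform_within_open[OF _ \<open>open U\<close> that Suc.prems(1)])
    show "(f has_derivative frechet_derivative f (at x)) (at x)"
      using Suc.prems(2) that by (simp add: frechet_derivative_works[symmetric])
  qed
  have "Ck_on k (\<lambda>x. frechet_derivative g (at x) v) U" for v
  proof (rule Suc.IH[of "\<lambda>x. frechet_derivative f (at x) v"])
    show "frechet_derivative f (at x) v = frechet_derivative g (at x) v" if "x \<in> U" for x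
      using frechet_derivative_at[OF *[OF that]] by simp
    show "Ck_on k (\<lambda>x. frechet_derivative f (at x) v) U"
      using Suc.prems(2) by simp
  qed
  then show ?case using * by (auto simp: differentiable_def)
qed

lemma Ck_on_SucD: "Ck_on (Suc k) f U \<Longrightarrow> Ck_on k f U"
proof (induction k arbitrary: f)
  case 0
  then show ?case
    by (auto intro!: continuous_at_imp_continuous_on differentiable_imp_continuous_within)
qed auto

lemma Ck_on_SucI:
  assumes "open U" and "\<And>x. x \<in> U \<Longrightarrow> (f has_derivative D x) (at x)"
    and "\<And>v. Ck_on k (\<lambda>x. D x v) U"
  shows "Ck_on (Suc k) f U"
proof -
  have "Ck_on k (\<lambda>x. frechet_derivative f (at x) v) U" for v
  proof (rule Ck_on_cong[OF assms(1) _ assms(3)[of v]])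
    show "D x v = frechet_derivative f (at x) v" if "x \<in> U" for x
      using frechet_derivative_at[OF assms(2)[OF that]] by simp
  qed
  then show ?thesis using assms(2) by (auto simp: differentiable_def)
qed

lemma Ck_on_deriv:
  assumes "Ck_on (Suc k) f U" "x \<in> U"
  shows "(f has_derivative frechet_derivative f (at x)) (at x)"
  using assms by (simp add: frechet_derivative_works[symmetric])

lemma Ck_on_const: "open U \<Longrightarrow> Ck_on k (\<lambda>_. c) U"
proof (induction k arbitrary: c)
  case (Suc k)
  then show ?case by (intro Ck_on_SucI[where D = "\<lambda>_ _. 0"]) auto
qed auto

lemma Ck_on_add:
  assumes "open U" "Ck_on k f U" "Ck_on k g U"
  shows "Ck_on k (\<lambda>x. f x + g x) U"
  using assms(2,3)
proof (induction k arbitrary: f g)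
  case (Suc k)
  show ?case
    by (rule Ck_on_SucI[OF \<open>open U\<close> has_derivative_add[OF Ck_on_deriv[OF Suc.prems(1)] Ck_on_deriv[OF Suc.prems(2)]]])
       (use Suc in auto)
qed (auto intro: continuous_on_add)

lemma (in bounded_linear) Ck_on_compose:
  assumes "open U" "Ck_on k g U"
  shows "Ck_on k (\<lambda>x. f (g x)) U"
  using assms(2)
proof (induction k arbitrary: g)
  case 0
  then show ?case by (simp add: continuous_on)
next
  case (Suc k)
  show ?case
    by (rule Ck_on_SucI[OF \<open>open U\<close> has_derivative[OF Ck_on_deriv[OF Suc.prems(1)]]])
       (use Suc in auto)
qed

lemma Ck_on_ident: "open U \<Longrightarrow> Ck_on k (\<lambda>x. x) U"
proof (cases k)
  case (Suc j)
  assume "open U"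
  then show ?thesis unfolding Suc by (intro Ck_on_SucI[where D = "\<lambda>_ v. v"] Ck_on_const) auto
qed auto

lemma (in bounded_bilinear) Ck_on_prod:
  assumes "open U" "Ck_on k f U" "Ck_on k g U"
  shows "Ck_on k (\<lambda>x. prod (f x) (g x)) U"
  using assms(2,3)
proof (induction k arbitrary: f g)
  case 0
  then show ?case by (simp add: continuous_on)
next
  case (Suc k)
  show ?case
    by (rule Ck_on_SucI[OF \<open>open U\<close> FDERIV[OF Ck_on_deriv[OF Suc.prems(1)] Ck_on_deriv[OF Suc.prems(2)]]])
       (use Suc.prems in \<open>auto intro!: Ck_on_add[OF \<open>open U\<close>] Suc.IH Ck_on_SucD[OF Suc.prems(1)] Ck_on_SucD[OF Suc.prems(2)]\<close>)
qed

text \<open>For a real inner map the chain rule is a scalar multiple of the composed derivative of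
  \<open>h\<close>. The induction hypothesis applies to that derivative with the same inner map, and
  the product rule closes the step; no higher-order chain rule enters.\<close>

lemma Ck_on_compose_real:
  fixes \<phi> :: "'a::real_normed_vector \<Rightarrow> real" and h :: "real \<Rightarrow> 'b::real_normed_vector"
  assumes "open U" "Ck_on k h I" "Ck_on k \<phi> U" "\<phi> ` U \<subseteq> I"
  shows "Ck_on k (\<lambda>x. h (\<phi> x)) U"
  using assms(2,3,4)
proof (induction k arbitrary: h)
  case 0
  then show ?case by (auto intro: continuous_on_compose2)
next
  case (Suc k)
  let ?h = "\<lambda>t. frechet_derivative h (at t) 1"
  show ?case
  proof (rule Ck_on_SucI[OF \<open>open U\<close>])
    fix x assume x: "x \<in> U"
    have h: "(h has_derivative frechet_derivative h (at (\<phi> x))) (at (\<phi> x))"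
      using Suc.prems x by (intro Ck_on_deriv) auto
    have "((\<lambda>x. h (\<phi> x)) has_derivative
        (\<lambda>v. frechet_derivative h (at (\<phi> x)) (frechet_derivative \<phi> (at x) v))) (at x)"
      by (rule has_derivative_compose[OF Ck_on_deriv[OF Suc.prems(2) x] h])
    moreover have "(\<lambda>v. frechet_derivative h (at (\<phi> x)) (frechet_derivative \<phi> (at x) v))
        = (\<lambda>v. frechet_derivative \<phi> (at x) v *\<^sub>R ?h (\<phi> x))"
    proof
      fix v
      let ?r = "frechet_derivative \<phi> (at x) v"
      have "frechet_derivative h (at (\<phi> x)) (?r *\<^sub>R 1) = ?r *\<^sub>R ?h (\<phi> x)"
        by (rule linear_scale[OF has_derivative_linear[OF h]])
      then show "frechet_derivative h (at (\<phi> x)) ?r = ?r *\<^sub>R ?h (\<phi> x)"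
        by (simp only: real_scaleR_def mult_1_right)
    qed
    ultimately show "((\<lambda>x. h (\<phi> x)) has_derivative
        (\<lambda>v. frechet_derivative \<phi> (at x) v *\<^sub>R ?h (\<phi> x))) (at x)"
      by (rule back_subst)
  next
    fix v
    have "Ck_on k (\<lambda>x. ?h (\<phi> x)) U"
      using Suc.prems(1,3) by (intro Suc.IH Ck_on_SucD[OF Suc.prems(2)]) auto
    then show "Ck_on k (\<lambda>x. frechet_derivative \<phi> (at x) v *\<^sub>R ?h (\<phi> x)) U"
      using Suc.prems by (intro bounded_bilinear.Ck_on_prod[OF bounded_bilinear_scaleR \<open>open U\<close>]) auto
  qed
qed

lemma Ck_on_Suc_real:
  assumes "open I" "\<And>t. t \<in> I \<Longrightarrow> (h has_vector_derivative h' t) (at t)" "Ck_on k h' I"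
  shows "Ck_on (Suc k) h I"
proof (rule Ck_on_SucI[OF assms(1)])
  show "(h has_derivative (\<lambda>r. r *\<^sub>R h' t)) (at t)" if "t \<in> I" for t
    using assms(2)[OF that] by (simp add: has_vector_derivative_def)
  show "Ck_on k (\<lambda>t. r *\<^sub>R h' t) I" for r
    by (intro bounded_linear.Ck_on_compose[OF bounded_linear_scaleR_right assms(1,3)])
qed

lemma smooth_onD: "smooth_on f U \<Longrightarrow> Ck_on k f U"
  by (simp add: smooth_on_def)

lemma smooth_on_const: "open U \<Longrightarrow> smooth_on (\<lambda>_. c) U"
  by (simp add: smooth_on_def Ck_on_const)

lemma smooth_on_add:
  "open U \<Longrightarrow> smooth_on f U \<Longrightarrow> smooth_on g U \<Longrightarrow> smooth_on (\<lambda>x. f x + g x) U"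
  by (simp add: smooth_on_def Ck_on_add)

lemma smooth_on_linear:
  "bounded_linear f \<Longrightarrow> open U \<Longrightarrow> smooth_on g U \<Longrightarrow> smooth_on (\<lambda>x. f (g x)) U"
  by (simp add: smooth_on_def bounded_linear.Ck_on_compose)

lemma smooth_on_ident: "open U \<Longrightarrow> smooth_on (\<lambda>x. x) U"
  by (simp add: smooth_on_def Ck_on_ident)

lemma smooth_on_bilinear:
  "bounded_bilinear h \<Longrightarrow> open U \<Longrightarrow> smooth_on f U \<Longrightarrow> smooth_on g U \<Longrightarrow> smooth_on (\<lambda>x. h (f x) (g x)) U"
  by (simp add: smooth_on_def bounded_bilinear.Ck_on_prod)

lemmas smooth_on_scaleR = smooth_on_bilinear[OF bounded_bilinear_scaleR]
lemmas smooth_on_mult = smooth_on_bilinear[OF bounded_bilinear_mult]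

lemma smooth_on_minus:
  "open U \<Longrightarrow> smooth_on f U \<Longrightarrow> smooth_on (\<lambda>x. - f x) U"
  by (rule smooth_on_linear[OF bounded_linear_minus[OF bounded_linear_ident]])

lemma smooth_on_diff:
  "open U \<Longrightarrow> smooth_on f U \<Longrightarrow> smooth_on g U \<Longrightarrow> smooth_on (\<lambda>x. f x - g x) U"
  using smooth_on_add[of U f "\<lambda>x. - g x"] smooth_on_minus[of U g] by simp

lemma smooth_on_compose_real:
  fixes \<phi> :: "'a::real_normed_vector \<Rightarrow> real" and h :: "real \<Rightarrow> 'b::real_normed_vector"
  shows "open U \<Longrightarrow> smooth_on h I \<Longrightarrow> smooth_on \<phi> U \<Longrightarrow> \<phi> ` U \<subseteq> I \<Longrightarrow> smooth_on (\<lambda>x. h (\<phi> x)) U"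
  by (auto simp: smooth_on_def intro: Ck_on_compose_real)

text \<open>One induction serves both functions, since each is the derivative of the other up to
  sign.\<close>

lemma smooth_on_sin_cos:
  assumes "open (U :: real set)"
  shows "smooth_on (sin::real\<Rightarrow>real) U" "smooth_on (cos::real\<Rightarrow>real) U"
proof -
  have "Ck_on k (sin::real\<Rightarrow>real) U \<and> Ck_on k (cos::real\<Rightarrow>real) U" for k
  proof (induction k)
    case (Suc k)
    then have "Ck_on k (\<lambda>x. - sin x) U"
      by (intro bounded_linear.Ck_on_compose[OF bounded_linear_minus[OF bounded_linear_ident] assms]) auto
    with Suc show ?case
      by (auto intro!: Ck_on_Suc_real[OF assms, of sin cos] Ck_on_Suc_real[OF assms, of cos "\<lambda>x. - sin x"]
          derivative_eq_intros simp: has_real_derivative_iff_has_vector_derivative[symmetric] simp del: Ck_on.simps)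
  qed (auto intro: continuous_intros)
  then show "smooth_on (sin::real\<Rightarrow>real) U" "smooth_on (cos::real\<Rightarrow>real) U"
    by (auto simp: smooth_on_def)
qed

lemma smooth_on_inverse:
  fixes U :: "real set"
  assumes "open U" "0 \<notin> U"
  shows "smooth_on (inverse::real\<Rightarrow>real) U"
proof -
  have "Ck_on k (inverse::real\<Rightarrow>real) U" for k
  proof (induction k)
    case (Suc k)
    then have "Ck_on k (\<lambda>x. - (inverse x * inverse x)) U"
      by (intro bounded_linear.Ck_on_compose[OF bounded_linear_minus[OF bounded_linear_ident] assms(1)]
          bounded_bilinear.Ck_on_prod[OF bounded_bilinear_mult assms(1)])
    then show ?case
      using assms(2)
      by (auto intro!: Ck_on_Suc_real[OF assms(1), of _ "\<lambda>x. - (inverse x * inverse x)"]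
          derivative_eq_intros simp: has_real_derivative_iff_has_vector_derivative[symmetric] simp del: Ck_on.simps)
  qed (use assms in \<open>auto intro!: continuous_intros\<close>)
  then show ?thesis by (simp add: smooth_on_def)
qed

lemma smooth_on_divide:
  fixes f g :: "'a::real_normed_vector \<Rightarrow> real"
  assumes "open U" "smooth_on f U" "smooth_on g U" "\<And>x. x \<in> U \<Longrightarrow> g x \<noteq> 0"
  shows "smooth_on (\<lambda>x. f x / g x) U"
  unfolding divide_inverse
  using assms
  by (intro smooth_on_mult smooth_on_compose_real[of U inverse "-{0}" g] smooth_on_inverse) auto

lemma smooth_on_Suc_real:
  fixes h :: "real \<Rightarrow> 'a::real_normed_vector"
  assumes "open I" "\<And>t. t \<in> I \<Longrightarrow> (h has_vector_derivative h' t) (at t)" "smooth_on h' I"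
  shows "smooth_on h I"
  unfolding smooth_on_def
proof
  fix k
  show "Ck_on k h I"
    using Ck_on_Suc_real[OF assms(1,2)] smooth_onD[OF assms(3), of k] by (blast intro: Ck_on_SucD)
qed

lemma smooth_on_arctan:
  assumes "open (U :: real set)"
  shows "smooth_on arctan U"
proof (rule smooth_on_Suc_real[OF assms])
  show "(arctan has_vector_derivative 1 / (1 + x * x)) (at x)" for x :: real
    using DERIV_arctan[of x]
    by (simp add: has_real_derivative_iff_has_vector_derivative divide_inverse power2_eq_square)
  have "1 + x * x \<noteq> 0" for x :: real
    using zero_le_square[of x] by linarith
  then show "smooth_on (\<lambda>x::real. 1 / (1 + x * x)) U"
    by (intro smooth_on_divide smooth_on_add smooth_on_mult smooth_on_const smooth_on_ident assms)
qed

text \<open>The derivatives 1 - tanh^2 and - sech tanh are polynomials in the two functions, hence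
  the joint induction.\<close>

lemma smooth_on_tanh_sech:
  assumes "open (U :: real set)"
  shows "smooth_on (tanh::real\<Rightarrow>real) U" "smooth_on (\<lambda>x::real. 1 / cosh x) U"
proof -
  have "Ck_on k (tanh::real\<Rightarrow>real) U \<and> Ck_on k (\<lambda>x::real. 1 / cosh x) U" for k
  proof (induction k)
    case (Suc k)
    let ?s = "\<lambda>x::real. 1 / cosh x"
    have neg: "Ck_on k (\<lambda>x. - g x) U" if "Ck_on k g U" for g :: "real \<Rightarrow> real"
      using that by (rule bounded_linear.Ck_on_compose[OF bounded_linear_minus[OF bounded_linear_ident] assms])
    have mult: "Ck_on k (\<lambda>x. tanh x * tanh x) U" "Ck_on k (\<lambda>x. ?s x * tanh x) U"
      using Suc bounded_bilinear.Ck_on_prod[OF bounded_bilinear_mult assms, of k tanh tanh]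
        bounded_bilinear.Ck_on_prod[OF bounded_bilinear_mult assms, of k ?s tanh] by simp_all
    have 1: "Ck_on k (\<lambda>x. 1 - tanh x * tanh x) U" "Ck_on k (\<lambda>x. - (?s x * tanh x)) U"
      using Ck_on_add[OF assms Ck_on_const[OF assms, of k "1::real"] neg[OF mult(1)]] neg[OF mult(2)]
      by simp_all
    have d1: "(tanh has_vector_derivative 1 - tanh x * tanh x) (at x)" for x :: real
      unfolding has_real_derivative_iff_has_vector_derivative[symmetric]
      by (auto intro!: derivative_eq_intros simp: power2_eq_square)
    have d2: "(?s has_vector_derivative - (?s x * tanh x)) (at x)" for x :: real
      unfolding has_real_derivative_iff_has_vector_derivative[symmetric]
      by (auto intro!: derivative_eq_intros simp: tanh_def)
    show ?case
      by (rule conjI[OF Ck_on_Suc_real[OF assms d1 1(1)] Ck_on_Suc_real[OF assms d2 1(2)]])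
  qed (auto intro!: continuous_intros)
  then show "smooth_on (tanh::real\<Rightarrow>real) U" "smooth_on (\<lambda>x::real. 1 / cosh x) U"
    by (auto simp: smooth_on_def)
qed

section \<open>Autonomous differential equations\<close>

text \<open>Gronwall in differential form: by Cauchy-Schwarz and the Lipschitz bound the squared
  distance damped by \<open>exp (- 2 * K * t)\<close> does not increase. The square keeps the
  quantity differentiable.\<close>

lemma ode_dependence:
  fixes x y :: "real \<Rightarrow> 'a::euclidean_space"
  assumes Lip: "\<And>a b. norm (V a - V b) \<le> K * norm (a - b)"
    and x: "\<And>t. (x has_vector_derivative V (x t)) (at t)"
    and y: "\<And>t. (y has_vector_derivative V (y t)) (at t)"
    and "0 \<le> t"
  shows "norm (x t - y t) \<le> exp (K * t) * norm (x 0 - y 0)"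
proof -
  define g where "g t = exp (- 2 * K * t) * ((x t - y t) \<bullet> (x t - y t))" for t
  have "g t \<le> g 0"
  proof (rule DERIV_nonpos_imp_nonincreasing[OF \<open>0 \<le> t\<close>])
    fix s
    have "((\<lambda>t. x t - y t) has_vector_derivative V (x s) - V (y s)) (at s)"
      by (intro has_vector_derivative_diff x y)
    from bounded_bilinear.has_vector_derivative[OF bounded_bilinear_inner this this]
    have "((\<lambda>t. (x t - y t) \<bullet> (x t - y t)) has_real_derivative
        2 * ((x s - y s) \<bullet> (V (x s) - V (y s)))) (at s)"
      by (simp add: has_real_derivative_iff_has_vector_derivative inner_commute)
    then have "(g has_real_derivative exp (- 2 * K * s) * (2 * ((x s - y s) \<bullet> (V (x s) - V (y s))))
        + - 2 * K * exp (- 2 * K * s) * ((x s - y s) \<bullet> (x s - y s))) (at s)"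
      unfolding g_def by (auto intro!: derivative_eq_intros)
    moreover have "(x s - y s) \<bullet> (V (x s) - V (y s)) \<le> K * ((x s - y s) \<bullet> (x s - y s))"
    proof -
      have "(x s - y s) \<bullet> (V (x s) - V (y s)) \<le> norm (x s - y s) * norm (V (x s) - V (y s))"
        by (rule norm_cauchy_schwarz)
      also have "\<dots> \<le> norm (x s - y s) * (K * norm (x s - y s))"
        by (intro mult_left_mono Lip) simp
      finally show ?thesis by (simp add: power2_norm_eq_inner[symmetric] power2_eq_square mult_ac)
    qed
    then have "exp (- 2 * K * s) * (2 * ((x s - y s) \<bullet> (V (x s) - V (y s))))
        \<le> exp (- 2 * K * s) * (2 * (K * ((x s - y s) \<bullet> (x s - y s))))"
      by (intro mult_left_mono) auto
    ultimately show "\<exists>d. (g has_real_derivative d) (at s) \<and> d \<le> 0"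
      by (intro exI conjI) (assumption, simp add: algebra_simps)
  qed
  then have "exp (2 * K * t) * g t \<le> exp (2 * K * t) * g 0"
    by simp
  then have "(norm (x t - y t))\<^sup>2 \<le> (exp (K * t) * norm (x 0 - y 0))\<^sup>2"
    by (simp add: g_def power_mult_distrib power2_norm_eq_inner mult.assoc[symmetric]
        exp_add[symmetric] exp_double[symmetric])
  then show ?thesis by (rule power2_le_imp_le) simp
qed

text \<open>A shift of time moves the common point to 0. Negative times follow by reversing time,
  which replaces \<open>V\<close> by \<open>- V\<close> with the same Lipschitz constant.\<close>

lemma ode_unique:
  fixes x y :: "real \<Rightarrow> 'a::euclidean_space"
  assumes Lip: "\<And>a b. norm (V a - V b) \<le> K * norm (a - b)"
    and x: "\<And>t. (x has_vector_derivative V (x t)) (at t)"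
    and y: "\<And>t. (y has_vector_derivative V (y t)) (at t)"
    and eq: "x t0 = y t0"
  shows "x t = y t"
proof -
  have shift: "((\<lambda>s. z (t0 + s)) has_vector_derivative V (z (t0 + t))) (at t)"
    if "\<And>t. (z has_vector_derivative V (z t)) (at t)" for z :: "real \<Rightarrow> 'a" and t
  proof -
    have "((\<lambda>s. t0 + s) has_vector_derivative 1) (at t)"
      by (auto intro!: derivative_eq_intros)
    from vector_diff_chain_at[OF this that] show ?thesis by (simp add: o_def)
  qed
  have reflect: "((\<lambda>s. z (- s)) has_vector_derivative - V (z (- t))) (at t)"
    if "\<And>t. (z has_vector_derivative V (z t)) (at t)" for z :: "real \<Rightarrow> 'a" and V t
  proof -
    have "((\<lambda>s. - s) has_vector_derivative - 1) (at t)"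
      by (auto intro!: derivative_eq_intros)
    from vector_diff_chain_at[OF this that] show ?thesis by (simp add: o_def)
  qed
  define s where "s = t - t0"
  have "x (t0 + s) = y (t0 + s)"
  proof (cases "s \<ge> 0")
    case True
    from ode_dependence[OF Lip shift[OF x] shift[OF y] True] eq show ?thesis by simp
  next
    case False
    have "norm (- V a - - V b) \<le> K * norm (a - b)" for a b
      using Lip[of a b] by (simp add: norm_minus_commute)
    from ode_dependence[OF this reflect[OF shift[OF x]] reflect[OF shift[OF y]], of "- s"] False eq
    show ?thesis by simp
  qed
  then show ?thesis by (simp add: s_def)
qed

text \<open>One of the two intervals is always empty or a point and its integral is 0, so the
  difference is the oriented integral from 0 to \<open>t\<close> for either sign of
  \<open>t\<close>.\<close>

lemma antiderivative_exists:
  fixes g :: "real \<Rightarrow> 'a::banach"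
  assumes "continuous_on UNIV g"
  shows "((\<lambda>t. integral {0..t} g - integral {t..0} g) has_vector_derivative g t) (at t)"
proof -
  define N where "N = \<bar>t\<bar> + 1"
  have c: "continuous_on {a..b} g" for a b
    using assms continuous_on_subset by blast
  have i: "g integrable_on {a..b}" for a b
    using integrable_continuous_real[OF c] .
  have eq: "integral {-N..s} g - integral {-N..0} g = integral {0..s} g - integral {s..0} g"
    if "s \<in> {-N<..<N}" for s
  proof (cases "s \<ge> 0")
    case True
    then have "integral {s..0} g = 0"
      by (cases "s = 0") auto
    then show ?thesis
      using Henstock_Kurzweil_Integration.integral_combine[OF _ True i, of "-N"] by (simp add: N_def algebra_simps)
  next
    case False
    then show ?thesis
      using Henstock_Kurzweil_Integration.integral_combine[OF _ _ i, of "-N" s 0] that by (simp add: algebra_simps)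
  qed
  have "((\<lambda>u. integral {-N..u} g) has_vector_derivative g t) (at t within {-N..N})"
    by (rule integral_has_vector_derivative[OF c]) (auto simp: N_def)
  then have "((\<lambda>u. integral {-N..u} g) has_vector_derivative g t) (at t)"
    by (subst (asm) at_within_interior) (auto simp: N_def)
  then have "((\<lambda>u. integral {-N..u} g - integral {-N..0} g) has_vector_derivative g t) (at t)"
    by (auto intro!: derivative_eq_intros)
  then show ?thesis
    by (rule has_vector_derivative_transform_within_open[of _ _ _ "{-N<..<N}"])
       (use eq in \<open>auto simp: N_def\<close>)
qed

text \<open>Integrating an exponential bound gains the factor \<open>1 / M\<close>. For the Picard
  operator this gain turns the Lipschitz constant \<open>K\<close> into the contraction factor
  \<open>K / (K + 1)\<close>.\<close>

lemma exp_bound_of_derivative: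
  fixes f :: "real \<Rightarrow> 'a::real_normed_vector"
  assumes f: "\<And>t. (f has_vector_derivative g t) (at t)" and "f 0 = 0"
    and g: "\<And>t. norm (g t) \<le> D * exp (M * \<bar>t\<bar>)" and "M > 0"
  shows "norm (f t) \<le> D / M * exp (M * \<bar>t\<bar>)"
proof -
  have D: "0 \<le> D"
    using order_trans[OF norm_ge_zero g[of 0]] by simp
  have pos: "norm (f t) \<le> D / M * exp (M * t)"
    if "t > 0" and f: "\<And>t. (f has_vector_derivative g t) (at t)" and "f 0 = 0"
      and g: "\<And>t. norm (g t) \<le> D * exp (M * \<bar>t\<bar>)"
    for f g :: "real \<Rightarrow> 'a" and t
  proof -
    have "norm (f t - f 0) \<le> D / M * exp (M * t) - D / M * exp (M * 0)"
    proof (rule differentiable_bound_general[OF \<open>t > 0\<close> _ _ f])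
      show "continuous_on {0..t} f"
        using f by (meson continuous_at_imp_continuous_on has_vector_derivative_continuous)
      show "((\<lambda>t. D / M * exp (M * t)) has_vector_derivative D * exp (M * s)) (at s)" for s
        unfolding has_real_derivative_iff_has_vector_derivative[symmetric]
        using \<open>M > 0\<close> by (auto intro!: derivative_eq_intros)
      show "norm (g s) \<le> D * exp (M * s)" if "0 < s" for s
        using g[of s] that by simp
    qed (use \<open>M > 0\<close> in \<open>auto intro!: continuous_intros\<close>)
    moreover have "0 \<le> D / M" using D \<open>M > 0\<close> by simp
    ultimately show ?thesis using \<open>f 0 = 0\<close> by simp
  qed
  consider "t > 0" | "t = 0" | "t < 0" by linarith
  then show ?thesis
  proof cases
    case 1
    then show ?thesis using pos[OF 1 f \<open>f 0 = 0\<close> g] by simp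
  next
    case 2
    then show ?thesis using \<open>f 0 = 0\<close> D \<open>M > 0\<close> by simp
  next
    case 3
    have "((\<lambda>s. f (- s)) has_vector_derivative - g (- s)) (at s)" for s
    proof -
      have "((\<lambda>s. - s) has_vector_derivative - 1) (at s)"
        by (auto intro!: derivative_eq_intros)
      from vector_diff_chain_at[OF this f] show ?thesis by (simp add: o_def)
    qed
    moreover have "norm (- g (- s)) \<le> D * exp (M * \<bar>s\<bar>)" for s
      using g[of "- s"] by simp
    ultimately show ?thesis
      using pos[of "- t" "\<lambda>s. f (- s)" "\<lambda>s. - g (- s)"] 3 \<open>f 0 = 0\<close> by simp
  qed
qed

text \<open>The Picard operator is a contraction for the supremum norm weighted by
  \<open>exp (- (K + 1) \<bar>t\<bar>)\<close>, so no continuation argument is needed.\<close>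

lemma ode_exists:
  fixes V :: "'a::euclidean_space \<Rightarrow> 'a"
  assumes Lip: "\<And>a b. norm (V a - V b) \<le> K * norm (a - b)" and bnd: "\<And>a. norm (V a) \<le> C"
  shows "\<exists>x. x 0 = x0 \<and> (\<forall>t. (x has_vector_derivative V (x t)) (at t))"
proof -
  obtain a :: 'a where "norm (a - 0) = 1"
    using vector_choose_size[of 1, where 'a = 'a] by auto
  then have "0 \<le> K"
    using order_trans[OF norm_ge_zero Lip[of a 0]] by simp
  have "0 \<le> C" using order_trans[OF norm_ge_zero bnd] .
  define M where "M = K + 1"
  have M: "M \<ge> 1" using \<open>0 \<le> K\<close> by (simp add: M_def)
  define w where "w t = exp (M * \<bar>t\<bar>)" for t :: real
  have w_pos: "w t > 0" for t by (simp add: w_def)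
  have w_ge1: "w t \<ge> 1" for t using M by (simp add: w_def)
  have contw: "continuous_on UNIV w" unfolding w_def by (intro continuous_intros)
  have contV: "continuous_on UNIV V"
    by (rule lipschitz_on_continuous_on[of K])
       (use Lip \<open>0 \<le> K\<close> in \<open>auto simp: lipschitz_on_def dist_norm\<close>)
  have scale: "norm (v /\<^sub>R w t) \<le> c" if "norm v \<le> c * w t" for v :: 'a and c t
    using that w_pos[of t] by (simp add: divide_inverse[symmetric] mult.commute pos_divide_le_eq)
  define I where "I g t = integral {0..t} g - integral {t..0} g" for g :: "real \<Rightarrow> 'a" and t
  \<comment> \<open>The unknown \<open>y\<close> is the solution divided by the weight
    \<open>w\<close>. A solution of exponential growth thus becomes a bounded continuous function,
    and the fixed point is taken in that complete space.\<close>
  define F where "F (y :: real \<Rightarrow>\<^sub>C 'a) r = V (w r *\<^sub>R y r)" for y r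
  have contF: "continuous_on UNIV (F y)" for y
    unfolding F_def
    by (intro continuous_on_compose2[OF contV] continuous_on_scaleR contw) auto
  have I: "(I (F y) has_vector_derivative F y t) (at t)" for y t
    unfolding I_def by (rule antiderivative_exists[OF contF])
  have I0: "I g 0 = 0" for g by (simp add: I_def)
  have contI: "continuous_on UNIV (I (F y))" for y
    using I by (meson continuous_at_imp_continuous_on has_vector_derivative_continuous)
  define T where "T y t = (x0 + I (F y) t) /\<^sub>R w t" for y t
  have T: "T y \<in> bcontfun" for y
  proof (rule bcontfun_normI)
    show "continuous_on UNIV (T y)"
      unfolding T_def using w_pos
      by (intro continuous_intros contw contI) (metis less_irrefl)
    show "norm (T y t) \<le> norm x0 + C / M" for t
    proof -
      have "norm (F y r) \<le> C * exp (M * \<bar>r\<bar>)" for r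
      proof -
        have "norm (F y r) \<le> C * 1" using bnd by (simp add: F_def)
        also have "\<dots> \<le> C * w r" using w_ge1 \<open>0 \<le> C\<close> by (rule mult_left_mono)
        finally show ?thesis by (simp add: w_def)
      qed
      from exp_bound_of_derivative[OF I I0 this, of t] M
      have "norm (I (F y) t) \<le> C / M * w t" by (simp add: w_def)
      moreover have "norm x0 * 1 \<le> norm x0 * w t" by (intro mult_left_mono w_ge1) simp
      ultimately have "norm (x0 + I (F y) t) \<le> (norm x0 + C / M) * w t"
        using norm_triangle_ineq[of x0 "I (F y) t"] by (simp add: distrib_right)
      then show ?thesis unfolding T_def by (rule scale)
    qed
  qed
  have contr: "dist (Bcontfun (T y)) (Bcontfun (T z)) \<le> K / M * dist y z" for y z
  proof (rule dist_bound)
    fix t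
    have "norm (F y r - F z r) \<le> (K * dist y z) * exp (M * \<bar>r\<bar>)" for r
    proof -
      have "norm (F y r - F z r) \<le> K * norm (w r *\<^sub>R y r - w r *\<^sub>R z r)"
        unfolding F_def by (rule Lip)
      also have "\<dots> = K * (w r * dist (y r) (z r))"
        using w_pos[of r] by (simp add: dist_norm scaleR_diff_right[symmetric])
      also have "\<dots> \<le> K * (w r * dist y z)"
        using w_pos[of r] \<open>0 \<le> K\<close> by (intro mult_left_mono dist_bounded) auto
      finally show ?thesis by (simp add: w_def mult_ac)
    qed
    from exp_bound_of_derivative[OF has_vector_derivative_diff[OF I I] _ this, of t] M
    have "norm (I (F y) t - I (F z) t) \<le> K / M * dist y z * w t" by (simp add: I0 w_def)
    from scale[OF this] have "norm (T y t - T z t) \<le> K / M * dist y z"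
      by (simp add: T_def scaleR_diff_right[symmetric])
    then show "dist (Bcontfun (T y) t) (Bcontfun (T z) t) \<le> K / M * dist y z"
      by (simp add: T Bcontfun_inverse dist_norm)
  qed
  have "\<exists>!y. Bcontfun (T y) = y"
    by (rule banach_fix_type[of "K / M"]) (use contr M \<open>0 \<le> K\<close> in \<open>auto simp: M_def\<close>)
  then obtain y where y: "Bcontfun (T y) = y" by blast
  define x where "x t = x0 + I (F y) t" for t
  have "F y t = V (x t)" for t
  proof -
    have "apply_bcontfun y t = T y t" by (subst y[symmetric]) (simp add: T Bcontfun_inverse)
    then have "w t *\<^sub>R y t = x t" using w_pos[of t] by (simp add: T_def x_def)
    then show ?thesis by (simp add: F_def)
  qed
  then have "(x has_vector_derivative V (x t)) (at t)" for t
    using I[of y t] unfolding x_def by (auto intro!: derivative_eq_intros)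
  moreover have "x 0 = x0" by (simp add: x_def I0)
  ultimately show ?thesis by blast
qed

section \<open>The profile equation\<close>

lemma abs_diff_le_of_deriv:
  fixes f :: "real \<Rightarrow> real"
  assumes "\<And>x. (f has_real_derivative f' x) (at x)" "\<And>x. \<bar>f' x\<bar> \<le> B"
  shows "\<bar>f x - f y\<bar> \<le> B * \<bar>x - y\<bar>"
  using field_differentiable_bound[of UNIV f f' B x y] assms by simp

lemma abs_mult_diff_le:
  fixes a b c d :: real
  assumes "\<bar>b\<bar> \<le> 1" "\<bar>c\<bar> \<le> 1"
  shows "\<bar>a * b - c * d\<bar> \<le> \<bar>a - c\<bar> + \<bar>b - d\<bar>"
proof -
  have "a * b - c * d = (a - c) * b + c * (b - d)" by (simp add: algebra_simps)
  moreover have "\<bar>(a - c) * b\<bar> \<le> \<bar>a - c\<bar> * 1" "\<bar>c * (b - d)\<bar> \<le> 1 * \<bar>b - d\<bar>"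
    unfolding abs_mult using assms by (intro mult_left_mono mult_right_mono; simp)+
  moreover have "\<bar>(a - c) * b + c * (b - d)\<bar> \<le> \<bar>(a - c) * b\<bar> + \<bar>c * (b - d)\<bar>"
    by (rule abs_triangle_ineq)
  ultimately show ?thesis by simp
qed

text \<open>To the right of \<open>t0\<close> the function f^2 exp(-2 M t) decreases, to the left
  f^2 exp(2 M t) increases, and both vanish at \<open>t0\<close>. The lemma is applied to f' = c f
  with bounded c, which shows that the invariant sets of the flow are never entered.\<close>

lemma zero_of_deriv_bound:
  fixes f :: "real \<Rightarrow> real"
  assumes f: "\<And>t. (f has_real_derivative f' t) (at t)" "\<And>t. \<bar>f' t\<bar> \<le> M * \<bar>f t\<bar>"
    and "f t0 = 0"
  shows "f t = 0"
proof -
  have ff: "f t * f' t \<le> M * (f t)\<^sup>2" "- (f t * f' t) \<le> M * (f t)\<^sup>2" for t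
  proof -
    have "\<bar>f t * f' t\<bar> \<le> \<bar>f t\<bar> * (M * \<bar>f t\<bar>)"
      unfolding abs_mult by (intro mult_left_mono f) simp
    then have "\<bar>f t * f' t\<bar> \<le> M * (f t)\<^sup>2" by (simp add: power2_eq_square mult_ac)
    then show "f t * f' t \<le> M * (f t)\<^sup>2" "- (f t * f' t) \<le> M * (f t)\<^sup>2" by linarith+
  qed
  have d: "((\<lambda>t. exp (c * t) * (f t)\<^sup>2) has_real_derivative exp (c * t) * (2 * (f t * f' t) + c * (f t)\<^sup>2)) (at t)" for c t
    by (auto intro!: derivative_eq_intros f simp: algebra_simps power2_eq_square)
  have "exp (c * t) * (f t)\<^sup>2 \<le> 0" if c: "c = (if t \<ge> t0 then - 2 * M else 2 * M)" for c
  proof (cases "t \<ge> t0")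
    case True
    have "exp (c * t) * (f t)\<^sup>2 \<le> exp (c * t0) * (f t0)\<^sup>2"
    proof (rule DERIV_nonpos_imp_nonincreasing[OF True])
      fix s
      have "exp (c * s) * (2 * (f s * f' s) + c * (f s)\<^sup>2) \<le> 0"
        using ff(1)[of s] c True by (intro mult_nonneg_nonpos) auto
      then show "\<exists>y. ((\<lambda>t. exp (c * t) * (f t)\<^sup>2) has_real_derivative y) (at s) \<and> y \<le> 0"
        using d by blast
    qed
    then show ?thesis using \<open>f t0 = 0\<close> by simp
  next
    case False
    then have "t \<le> t0" by simp
    have "exp (c * t) * (f t)\<^sup>2 \<le> exp (c * t0) * (f t0)\<^sup>2"
    proof (rule DERIV_nonneg_imp_nondecreasing[OF \<open>t \<le> t0\<close>])
      fix s
      have "0 \<le> exp (c * s) * (2 * (f s * f' s) + c * (f s)\<^sup>2)"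
        using ff(2)[of s] c False by (intro mult_nonneg_nonneg) auto
      then show "\<exists>y. ((\<lambda>t. exp (c * t) * (f t)\<^sup>2) has_real_derivative y) (at s) \<and> 0 \<le> y"
        using d by blast
    qed
    then show ?thesis using \<open>f t0 = 0\<close> by simp
  qed
  from this[OF refl] have "(f t)\<^sup>2 \<le> 0" by (simp add: mult_le_0_iff)
  then show ?thesis by simp
qed

lemma pos_of_never_zero:
  fixes f :: "real \<Rightarrow> real"
  assumes "is_interval I" "continuous_on I f" "\<And>t. t \<in> I \<Longrightarrow> f t \<noteq> 0" "t0 \<in> I" "f t0 > 0" "t \<in> I"
  shows "f t > 0"
proof (rule ccontr)
  assume "\<not> f t > 0"
  have "connected (f ` I)"
    using assms(1,2) connected_continuous_image is_interval_connected_1 by blast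
  then have "0 \<in> f ` I"
    by (rule connectedD_interval[of _ "f t" "f t0"]) (use assms \<open>\<not> f t > 0\<close> in auto)
  then show False using assms(3) by auto
qed

lemma pos_of_deriv_bound:
  fixes f :: "real \<Rightarrow> real"
  assumes f: "\<And>t. (f has_real_derivative f' t) (at t)" "\<And>t. \<bar>f' t\<bar> \<le> M * \<bar>f t\<bar>"
    and "f t0 > 0"
  shows "f t > 0"
proof (rule pos_of_never_zero[of UNIV f t0])
  show "f s \<noteq> 0" for s
    using zero_of_deriv_bound[OF f, of s t0] \<open>f t0 > 0\<close> by auto
  show "continuous_on UNIV f"
    using f(1) by (meson DERIV_isCont continuous_at_imp_continuous_on)
qed (use assms in auto)

lemma cos_ge_quadratic: "1 - x\<^sup>2 / 2 \<le> cos (x::real)"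
proof -
  have "(sin (x / 2))\<^sup>2 \<le> (x / 2)\<^sup>2"
    using abs_sin_x_le_abs_x[of "x / 2"] by (metis abs_le_square_iff)
  then show ?thesis
    using cos_double_sin[of "x / 2"] by (simp add: power2_eq_square)
qed

lemma tanh_ge_half:
  assumes "1 \<le> (x::real)" shows "1 / 2 \<le> tanh x"
proof -
  have "3 \<le> exp (2 * x)"
    using exp_ge_add_one_self[of "2 * x"] assms by linarith
  define y where "y = exp (- (2 * x))"
  have "y \<le> 1 / 3" "0 < y"
    using le_imp_inverse_le[OF \<open>3 \<le> exp (2 * x)\<close>] by (simp_all add: y_def exp_minus)
  then have "1 / 2 \<le> (1 - y) / (1 + y)"
    by (simp add: field_simps)
  then show ?thesis
    by (simp only: tanh_real_altdef y_def mult_minus_left)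
qed

lemma abs_tanh_le_1: "\<bar>tanh (x::real)\<bar> \<le> 1"
  using tanh_real_bounds[of x] by auto

text \<open>Geodesics of exp(2 phi) (du^2 + db^2) with phi = m ln cos(2b) - (2m+1) ln cosh u: the
  orbit volume supplies cos(2b)^m and 2m factors sech u, the round metric one more sech u. In
  arclength h' = (2m+1) tanh u sin h - 2m tan(2b) cos h; all components are then multiplied by
  cos(2b).\<close>

definition profile_field :: "nat \<Rightarrow> real \<times> real \<times> real \<Rightarrow> real \<times> real \<times> real"
  where "profile_field m = (\<lambda>(u, b, h).
    (cos h * cos (2 * b), sin h * cos (2 * b),
     (2 * m + 1) * tanh u * sin h * cos (2 * b) - 2 * m * sin (2 * b) * cos h))"

lemma profile_field_bounded: "norm (profile_field m p) \<le> 4 * real m + 3"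
proof -
  obtain u b h where p: "p = (u, b, h)" by (cases p)
  have 1: "\<bar>x * y\<bar> \<le> 1" if "\<bar>x\<bar> \<le> 1" "\<bar>y\<bar> \<le> 1" for x y :: real
    using that mult_mono[of "\<bar>x\<bar>" 1 "\<bar>y\<bar>" 1] by (simp add: abs_mult)
  have "\<bar>tanh u * sin h * cos (2 * b)\<bar> \<le> 1" "\<bar>sin (2 * b) * cos h\<bar> \<le> 1"
    by (intro 1 abs_tanh_le_1; simp)+
  then have "\<bar>(2 * real m + 1) * (tanh u * sin h * cos (2 * b))\<bar> \<le> (2 * real m + 1) * 1"
    "\<bar>2 * real m * (sin (2 * b) * cos h)\<bar> \<le> 2 * real m * 1"
    unfolding abs_mult[of "2 * real m + 1"] abs_mult[of "2 * real m"] by (intro mult_mono; simp)+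
  then have "\<bar>(2 * real m + 1) * tanh u * sin h * cos (2 * b) - 2 * real m * sin (2 * b) * cos h\<bar> \<le> 4 * real m + 1"
    by (simp add: mult.assoc)
  note t = this
  have c: "\<bar>cos h * cos (2 * b)\<bar> \<le> 1" "\<bar>sin h * cos (2 * b)\<bar> \<le> 1"
    by (intro 1; simp)+
  have norm3: "norm (x, y, z) \<le> \<bar>x\<bar> + \<bar>y\<bar> + \<bar>z\<bar>" for x y z :: real
    using norm_Pair_le[of x "(y, z)"] norm_Pair_le[of y z] by simp
  note order_trans[OF norm3 add_mono[OF add_mono[OF c] t]]
  then show ?thesis
    unfolding p profile_field_def by (simp add: algebra_simps)
qed

lemma profile_field_lipschitz:
  "norm (profile_field m p - profile_field m q) \<le> (14 * real m + 10) * norm (p - q)"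
proof -
  obtain u b h where p: "p = (u, b, h)" by (cases p)
  obtain u' b' h' where q: "q = (u', b', h')" by (cases q)
  define N where "N = norm (p - q)"
  have N: "\<bar>u - u'\<bar> \<le> N" "\<bar>b - b'\<bar> \<le> N" "\<bar>h - h'\<bar> \<le> N"
    using norm_fst_le[of "u - u'" "(b - b', h - h')"] norm_snd_le[of "(b - b', h - h')" "u - u'"]
      norm_fst_le[of "b - b'" "h - h'"] norm_snd_le[of "h - h'" "b - b'"]
    by (auto simp: N_def p q)
  have sin: "\<bar>sin x - sin y\<bar> \<le> \<bar>x - y\<bar>" and cos: "\<bar>cos x - cos y\<bar> \<le> \<bar>x - y\<bar>" for x y :: real
    using abs_diff_le_of_deriv[of sin cos 1 x y] abs_diff_le_of_deriv[of cos "\<lambda>x. - sin x" 1 x y]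
    by (auto intro: DERIV_sin DERIV_cos)
  have "0 \<le> 1 - (tanh x)\<^sup>2" "1 - (tanh x)\<^sup>2 \<le> 1" for x :: real
    using abs_tanh_le_1[of x] by (auto simp: abs_square_le_1)
  moreover have "(tanh has_real_derivative 1 - (tanh x)\<^sup>2) (at x)" for x :: real
    by (auto intro!: derivative_eq_intros)
  ultimately have tanh: "\<bar>tanh u - tanh u'\<bar> \<le> \<bar>u - u'\<bar>"
    using abs_diff_le_of_deriv[of tanh "\<lambda>x. 1 - (tanh x)\<^sup>2" 1 u u'] by simp
  have s2: "\<bar>sin (2 * b) - sin (2 * b')\<bar> \<le> 2 * N" "\<bar>cos (2 * b) - cos (2 * b')\<bar> \<le> 2 * N"
    using sin[of "2 * b" "2 * b'"] cos[of "2 * b" "2 * b'"] N(2) by auto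
  have h: "\<bar>sin h - sin h'\<bar> \<le> N" "\<bar>cos h - cos h'\<bar> \<le> N"
    using sin[of h h'] cos[of h h'] N(3) by auto
  have 1: "\<bar>cos h * cos (2 * b) - cos h' * cos (2 * b')\<bar> \<le> 3 * N"
    using abs_mult_diff_le[of "cos (2 * b)" "cos h'" "cos h" "cos (2 * b')"] s2 h by simp
  have 2: "\<bar>sin h * cos (2 * b) - sin h' * cos (2 * b')\<bar> \<le> 3 * N"
    using abs_mult_diff_le[of "cos (2 * b)" "sin h'" "sin h" "cos (2 * b')"] s2 h by simp
  have prod1: "\<bar>sin h * cos (2 * b)\<bar> \<le> 1"
    using mult_mono[of "\<bar>sin h\<bar>" 1 "\<bar>cos (2 * b)\<bar>" 1] by (simp add: abs_mult)
  have 3: "\<bar>tanh u * (sin h * cos (2 * b)) - tanh u' * (sin h' * cos (2 * b'))\<bar> \<le> 4 * N"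
    using abs_mult_diff_le[OF prod1 abs_tanh_le_1, of "tanh u" u' "sin h' * cos (2 * b')"] 2 tanh N(1) by simp
  have 4: "\<bar>sin (2 * b) * cos h - sin (2 * b') * cos h'\<bar> \<le> 3 * N"
    using abs_mult_diff_le[of "cos h" "sin (2 * b')" "sin (2 * b)" "cos h'"] s2 h by simp
  let ?k = "2 * real m + 1"
  have "\<bar>?k * (tanh u * (sin h * cos (2 * b)) - tanh u' * (sin h' * cos (2 * b')))\<bar> \<le> ?k * (4 * N)"
    "\<bar>2 * real m * (sin (2 * b) * cos h - sin (2 * b') * cos h')\<bar> \<le> 2 * real m * (3 * N)"
    unfolding abs_mult[of ?k] abs_mult[of "2 * real m"] using 3 4 by (intro mult_mono; simp)+
  then have 5: "\<bar>(?k * tanh u * sin h * cos (2 * b) - 2 * real m * sin (2 * b) * cos h)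
      - (?k * tanh u' * sin h' * cos (2 * b') - 2 * real m * sin (2 * b') * cos h')\<bar>
      \<le> ?k * (4 * N) + 2 * real m * (3 * N)"
    unfolding right_diff_distrib mult.assoc[symmetric] by linarith
  have norm3: "norm (x, y, z) \<le> \<bar>x\<bar> + \<bar>y\<bar> + \<bar>z\<bar>" for x y z :: real
    using norm_Pair_le[of x "(y, z)"] norm_Pair_le[of y z] by simp
  have "norm (profile_field m p - profile_field m q) \<le> 3 * N + 3 * N + (?k * (4 * N) + 2 * real m * (3 * N))"
    unfolding p q profile_field_def using order_trans[OF norm3 add_mono[OF add_mono[OF 1 2] 5]]
    by (simp add: add_ac)
  also have "\<dots> = (14 * real m + 10) * N" by (simp add: algebra_simps)
  finally show ?thesis unfolding N_def .
qed

text \<open>The worst case is |t| = 1. The matrices then have least eigenvalue 1/2 for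
  \<open>m = 1\<close> and 3 - sqrt 7.25 > 0.3 for \<open>m = 2\<close>, so 1/5 serves both.\<close>

lemma rotation_form_bound:
  assumes m: "m = 1 \<or> m = (2::nat)" and t: "\<bar>t\<bar> \<le> 1"
  shows "(x\<^sup>2 + y\<^sup>2) / 5 \<le> 2 * real m * x\<^sup>2 - (2 * real m + 1) * (t * (x * y)) + 2 * y\<^sup>2"
proof -
  have "\<bar>t * (x * y)\<bar> \<le> 1 * \<bar>x * y\<bar>"
    unfolding abs_mult[of t] using t by (intro mult_right_mono) auto
  then have *: "t * (x * y) \<le> \<bar>x\<bar> * \<bar>y\<bar>"
    using abs_ge_self[of "t * (x * y)"] by (simp only: abs_mult mult_1)
  \<comment> \<open>One square for each \<open>m\<close>. After the cross term is absorbed there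
    remain x^2/2 + y^2/2 for \<open>m = 1\<close>, and x^2/4 + y^2/3 for
    \<open>m = 2\<close>.\<close>
  have "0 \<le> (\<bar>x\<bar> - \<bar>y\<bar>)\<^sup>2" "0 \<le> (3 * \<bar>x\<bar> - 2 * \<bar>y\<bar>)\<^sup>2"
    by simp_all
  then have "2 * (\<bar>x\<bar> * \<bar>y\<bar>) \<le> x\<^sup>2 + y\<^sup>2" "12 * (\<bar>x\<bar> * \<bar>y\<bar>) \<le> 9 * x\<^sup>2 + 4 * y\<^sup>2"
    by (simp_all add: power2_diff power_mult_distrib)
  have lin1: "(a + c) / 5 \<le> 2 * a - 3 * p + 2 * c" if "2 * p \<le> a + c" "0 \<le> a" "0 \<le> c" for a c p :: real
    using that by argo
  have lin2: "(a + c) / 5 \<le> 4 * a - 5 * p + 2 * c" if "12 * p \<le> 9 * a + 4 * c" "0 \<le> a" "0 \<le> c" for a c p :: real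
    using that by argo
  show ?thesis
    using m
  proof (elim disjE)
    assume "m = 1"
    have "2 * x\<^sup>2 - 3 * (\<bar>x\<bar> * \<bar>y\<bar>) + 2 * y\<^sup>2 \<le> 2 * real m * x\<^sup>2 - (2 * real m + 1) * (t * (x * y)) + 2 * y\<^sup>2"
      using * by (simp add: \<open>m = 1\<close>)
    moreover have "(x\<^sup>2 + y\<^sup>2) / 5 \<le> 2 * x\<^sup>2 - 3 * (\<bar>x\<bar> * \<bar>y\<bar>) + 2 * y\<^sup>2"
      by (rule lin1[OF \<open>2 * (\<bar>x\<bar> * \<bar>y\<bar>) \<le> x\<^sup>2 + y\<^sup>2\<close>]) auto
    ultimately show ?thesis by (rule order_trans[rotated])
  next
    assume "m = 2"
    have "4 * x\<^sup>2 - 5 * (\<bar>x\<bar> * \<bar>y\<bar>) + 2 * y\<^sup>2 \<le> 2 * real m * x\<^sup>2 - (2 * real m + 1) * (t * (x * y)) + 2 * y\<^sup>2"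
      using * by (simp add: \<open>m = 2\<close>)
    moreover have "(x\<^sup>2 + y\<^sup>2) / 5 \<le> 4 * x\<^sup>2 - 5 * (\<bar>x\<bar> * \<bar>y\<bar>) + 2 * y\<^sup>2"
      by (rule lin2[OF \<open>12 * (\<bar>x\<bar> * \<bar>y\<bar>) \<le> 9 * x\<^sup>2 + 4 * y\<^sup>2\<close>]) auto
    ultimately show ?thesis by (rule order_trans[rotated])
  qed
qed

section \<open>The solutions shot orthogonally from the cone, indexed by \<open>L\<close>\<close>

locale profile_flow =
  fixes m :: nat and u b h :: "real \<Rightarrow> real \<Rightarrow> real"
  assumes m: "m = 1 \<or> m = 2"
    and init: "u L 0 = - L" "b L 0 = 0" "h L 0 = pi / 2"
    and flow: "((\<lambda>t. (u L t, b L t, h L t)) has_vector_derivative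
      profile_field m (u L t, b L t, h L t)) (at t)"
begin

abbreviation "C L t \<equiv> cos (2 * b L t)"
abbreviation "B L t \<equiv> sin (2 * b L t)"
abbreviation "E L t \<equiv> cos (h L t)"
abbreviation "S L t \<equiv> sin (h L t)"
abbreviation "k \<equiv> 2 * real m + 1"

lemma m_bounds: "1 \<le> real m" "real m \<le> 2" "3 \<le> k" "k \<le> 5"
  using m by auto

lemma
  shows du: "(u L has_real_derivative E L t * C L t) (at t)"
    and db: "(b L has_real_derivative S L t * C L t) (at t)"
    and dh: "(h L has_real_derivative k * tanh (u L t) * S L t * C L t - 2 * real m * B L t * E L t) (at t)"
  using bounded_linear.has_vector_derivative[OF bounded_linear_fst flow]
    bounded_linear.has_vector_derivative[OF bounded_linear_fst
      bounded_linear.has_vector_derivative[OF bounded_linear_snd flow]]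
    bounded_linear.has_vector_derivative[OF bounded_linear_snd
      bounded_linear.has_vector_derivative[OF bounded_linear_snd flow]]
  by (simp_all add: profile_field_def has_real_derivative_iff_has_vector_derivative algebra_simps)

lemma cont: "continuous_on A (u L)" "continuous_on A (b L)" "continuous_on A (h L)"
  by (meson DERIV_isCont continuous_at_imp_continuous_on du db dh)+

definition "Lip = 14 * real m + 10"

lemma u_dependence: "0 \<le> t \<Longrightarrow> \<bar>u L t - u L' t\<bar> \<le> exp (Lip * t) * \<bar>L - L'\<bar>"
proof -
  assume "0 \<le> t"
  from ode_dependence[OF profile_field_lipschitz flow flow this, of L L']
  have "norm ((u L t, b L t, h L t) - (u L' t, b L' t, h L' t)) \<le> exp (Lip * t) * \<bar>L - L'\<bar>"
    by (simp add: init Lip_def norm_Pair abs_minus_commute)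
  then show ?thesis
    using norm_fst_le[of "u L t - u L' t" "(b L t - b L' t, h L t - h L' t)"] by simp
qed

lemma joint_cont:
  "continuous_on (UNIV \<times> {0..}) (\<lambda>(L, t). (u L t, b L t, h L t))"
proof (clarsimp simp: continuous_on_def)
  fix L0 t0 :: real
  assume t0: "0 \<le> t0"
  let ?F = "at (L0, t0) within UNIV \<times> {0..}"
  let ?X = "\<lambda>L t. (u L t, b L t, h L t)"
  define g where "g p = exp (Lip * snd p) * \<bar>fst p - L0\<bar> + norm (?X L0 (snd p) - ?X L0 t0)" for p
  have X: "continuous_on UNIV (?X L0)"
    by (intro continuous_on_Pair cont)
  have "continuous_on UNIV g"
    unfolding g_def by (intro continuous_intros continuous_on_compose2[OF X]) auto
  then have "(g \<longlongrightarrow> g (L0, t0)) ?F"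
    unfolding continuous_on_def by (blast intro: tendsto_within_subset)
  then have g: "(g \<longlongrightarrow> 0) ?F" by (simp add: g_def[of "(L0, t0)"])
  have "\<forall>\<^sub>F p in ?F. norm ((case p of (L, t) \<Rightarrow> ?X L t) - ?X L0 t0) \<le> g p"
    unfolding eventually_at_filter
  proof (intro always_eventually allI impI)
    fix p :: "real \<times> real"
    assume p: "p \<in> UNIV \<times> {0..}"
    obtain L t where Lt: "p = (L, t)" "0 \<le> t" using p by (cases p) auto
    have "norm (?X L t - ?X L0 t0) \<le> norm (?X L t - ?X L0 t) + norm (?X L0 t - ?X L0 t0)"
      using norm_triangle_ineq[of "?X L t - ?X L0 t" "?X L0 t - ?X L0 t0"] by simp
    moreover have "norm (?X L t - ?X L0 t) \<le> exp (Lip * t) * \<bar>L - L0\<bar>"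
      using ode_dependence[OF profile_field_lipschitz flow flow Lt(2), of L L0]
      by (simp add: init Lip_def norm_Pair abs_minus_commute)
    ultimately show "norm ((case p of (L, t) \<Rightarrow> ?X L t) - ?X L0 t0) \<le> g p"
      by (simp add: Lt g_def)
  qed
  from Lim_null_comparison[OF this g]
  show "((\<lambda>(L, t). ?X L t) \<longlongrightarrow> ?X L0 t0) ?F"
    by (rule Lim_null[THEN iffD2])
qed

text \<open>The time change leaves a factor \<open>C\<close> in \<open>b'\<close>, so
  \<open>C\<close> solves a homogeneous linear equation with bounded coefficient and keeps its
  initial sign. Geometrically, the curve never meets the boundary of the lune.\<close>

lemma C_pos: "C L t > 0"
proof (rule pos_of_deriv_bound[of "C L" "\<lambda>t. - 2 * B L t * S L t * C L t" 2 0])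
  show "(C L has_real_derivative - 2 * B L t * S L t * C L t) (at t)" for t
    by (auto intro!: derivative_eq_intros db)
  show "\<bar>- 2 * B L t * S L t * C L t\<bar> \<le> 2 * \<bar>C L t\<bar>" for t
  proof -
    have "\<bar>B L t\<bar> * \<bar>S L t\<bar> \<le> 1 * 1" by (intro mult_mono) auto
    then have "\<bar>B L t\<bar> * \<bar>S L t\<bar> * \<bar>C L t\<bar> \<le> 1 * \<bar>C L t\<bar>" by (intro mult_right_mono) auto
    then show ?thesis by (simp add: abs_mult)
  qed
qed (simp add: init)

lemma b_bounds: "- (pi / 4) < b L t" "b L t < pi / 4"
proof -
  have minus: "pi / 4 - b L s \<noteq> 0" for s
  proof
    assume "pi / 4 - b L s = 0"
    then have "2 * b L s = pi / 2" by simp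
    then have "C L s = 0" by (simp only: cos_pi_half)
    then show False using C_pos[of L s] by simp
  qed
  have plus: "pi / 4 + b L s \<noteq> 0" for s
  proof
    assume "pi / 4 + b L s = 0"
    then have "2 * b L s = - (pi / 2)" by simp
    then have "C L s = 0" by (simp only: cos_pi_half cos_minus)
    then show False using C_pos[of L s] by simp
  qed
  have "pi / 4 - b L t > 0"
    by (rule pos_of_never_zero[of UNIV "\<lambda>s. pi / 4 - b L s" 0 t])
      (use minus in \<open>simp_all add: init continuous_on_diff cont\<close>)
  moreover have "pi / 4 + b L t > 0"
    by (rule pos_of_never_zero[of UNIV "\<lambda>s. pi / 4 + b L s" 0 t])
      (use plus in \<open>simp_all add: init continuous_on_add cont\<close>)
  ultimately show "- (pi / 4) < b L t" "b L t < pi / 4" by linarith+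
qed

abbreviation "W L t \<equiv> (B L t)\<^sup>2 + (S L t)\<^sup>2"

lemma dB: "(B L has_real_derivative 2 * (S L t * (C L t)\<^sup>2)) (at t)"
  by (auto intro!: derivative_eq_intros db simp: power2_eq_square)

lemma dS: "(S L has_real_derivative E L t * (k * tanh (u L t) * S L t * C L t - 2 * real m * B L t * E L t)) (at t)"
  by (auto intro!: derivative_eq_intros dh)

text \<open>The left side is half the derivative of \<open>W\<close>. Its three terms contribute at
  most 1, 5 and 2 times \<open>W\<close>.\<close>

lemma radial_bound:
  "\<bar>B L t * (2 * (S L t * (C L t)\<^sup>2)) + S L t * (E L t * (k * tanh (u L t) * S L t * C L t - 2 * real m * B L t * E L t))\<bar>
    \<le> 11 * W L t"
proof -
  have mult1: "\<bar>x * y\<bar> \<le> c" if "\<bar>x\<bar> \<le> 1" "\<bar>y\<bar> \<le> c" for x y c :: real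
    using that mult_mono[of "\<bar>x\<bar>" 1 "\<bar>y\<bar>" c] by (simp add: abs_mult)
  have BS: "\<bar>B L t * S L t\<bar> \<le> W L t / 2"
  proof -
    have "0 \<le> (\<bar>B L t\<bar> - \<bar>S L t\<bar>)\<^sup>2" by simp
    then show ?thesis by (simp add: power2_diff abs_mult)
  qed
  have 1: "\<bar>(C L t)\<^sup>2 * (B L t * S L t)\<bar> \<le> W L t / 2"
    by (rule mult1[OF _ BS]) (simp add: abs_square_le_1)
  have 2: "\<bar>(E L t)\<^sup>2 * (B L t * S L t)\<bar> \<le> W L t / 2"
    by (rule mult1[OF _ BS]) (simp add: abs_square_le_1)
  have 3: "\<bar>E L t * (tanh (u L t) * (C L t * (S L t)\<^sup>2))\<bar> \<le> W L t"
    by (intro mult1 abs_tanh_le_1) auto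
  have "\<bar>2 * ((C L t)\<^sup>2 * (B L t * S L t))\<bar> \<le> 2 * (W L t / 2)"
    "\<bar>k * (E L t * (tanh (u L t) * (C L t * (S L t)\<^sup>2)))\<bar> \<le> 5 * W L t"
    "\<bar>2 * real m * ((E L t)\<^sup>2 * (B L t * S L t))\<bar> \<le> 4 * (W L t / 2)"
    unfolding abs_mult[of 2] abs_mult[of k] abs_mult[of "2 * real m"]
    using 1 2 3 m_bounds by (intro mult_mono; simp)+
  moreover have "B L t * (2 * (S L t * (C L t)\<^sup>2)) + S L t * (E L t * (k * tanh (u L t) * S L t * C L t - 2 * real m * B L t * E L t))
    = 2 * ((C L t)\<^sup>2 * (B L t * S L t)) + k * (E L t * (tanh (u L t) * (C L t * (S L t)\<^sup>2)))
      - 2 * real m * ((E L t)\<^sup>2 * (B L t * S L t))"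
    by (simp add: algebra_simps power2_eq_square)
  moreover have "0 \<le> W L t" by simp
  ultimately show ?thesis by linarith
qed

text \<open>\<open>W = 0\<close> would mean that the curve runs along the cone, which is itself a
  solution. Hence \<open>(B, S)\<close> never vanishes and its winding angle makes sense.\<close>

lemma W_pos: "W L t > 0"
proof -
  let ?R = "\<lambda>t. B L t * (2 * (S L t * (C L t)\<^sup>2)) + S L t * (E L t * (k * tanh (u L t) * S L t * C L t - 2 * real m * B L t * E L t))"
  have d: "(W L has_real_derivative 2 * ?R t) (at t)" for t
    by (rule derivative_eq_intros dB dS refl)+ (simp add: algebra_simps)
  have "\<bar>2 * ?R t\<bar> \<le> 22 * \<bar>W L t\<bar>" for t
    using radial_bound[of L t] by (simp only: abs_mult) simp
  from pos_of_deriv_bound[OF d this, of 0] show ?thesis by (simp add: init)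
qed

text \<open>Clairaut's integral of the metric with its dependence on \<open>u\<close> dropped. The
  true metric adds only a term with the sign of \<open>- tanh u\<close>, so \<open>Q\<close> is
  monotone on each side of the equator.\<close>

definition "Q L t = E L t * (C L t) ^ m"

lemma dQ: "(Q L has_real_derivative - (k * tanh (u L t) * (S L t)\<^sup>2 * (C L t) ^ (m + 1))) (at t)"
  unfolding Q_def
  by (cases "m = 1"; (rule derivative_eq_intros db dh refl)+)
     (use m in \<open>auto simp: algebra_simps power2_eq_square numeral_2_eq_2\<close>)

lemma Q_le: "\<lbrakk>0 \<le> E L t\<rbrakk> \<Longrightarrow> Q L t \<le> E L t" "Q L t \<le> (C L t) ^ m" "(C L t) ^ m \<le> C L t"
  "(C L t)\<^sup>2 \<le> (C L t) ^ m"
proof -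
  have C: "0 \<le> C L t" "C L t \<le> 1" using C_pos[of L t] by auto
  show "Q L t \<le> E L t" if "0 \<le> E L t"
    unfolding Q_def using that C power_le_one[OF C, of m] by (simp add: mult_left_le)
  show "Q L t \<le> (C L t) ^ m"
    unfolding Q_def using C mult_right_mono[of "E L t" 1 "(C L t) ^ m"] by simp
  show "(C L t) ^ m \<le> C L t" "(C L t)\<^sup>2 \<le> (C L t) ^ m"
    using C m power_decreasing[of 1 m "C L t"] power_decreasing[of m 2 "C L t"] by auto
qed

lemma displacement:
  "\<bar>u L t - u L s\<bar> \<le> \<bar>t - s\<bar>" "\<bar>b L t - b L s\<bar> \<le> \<bar>t - s\<bar>" "\<bar>h L t - h L s\<bar> \<le> 9 * \<bar>t - s\<bar>"
proof -
  have 1: "\<bar>x * y\<bar> \<le> 1" if "\<bar>x\<bar> \<le> 1" "\<bar>y\<bar> \<le> 1" for x y :: real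
    using that mult_mono[of "\<bar>x\<bar>" 1 "\<bar>y\<bar>" 1] by (simp add: abs_mult)
  have "\<bar>u L t - u L s\<bar> \<le> 1 * \<bar>t - s\<bar>"
    by (rule abs_diff_le_of_deriv[OF du]) (rule 1; simp)
  then show "\<bar>u L t - u L s\<bar> \<le> \<bar>t - s\<bar>" by simp
  have "\<bar>b L t - b L s\<bar> \<le> 1 * \<bar>t - s\<bar>"
    by (rule abs_diff_le_of_deriv[OF db]) (rule 1; simp)
  then show "\<bar>b L t - b L s\<bar> \<le> \<bar>t - s\<bar>" by simp
  show "\<bar>h L t - h L s\<bar> \<le> 9 * \<bar>t - s\<bar>"
  proof (rule abs_diff_le_of_deriv[OF dh])
    fix t
    have "\<bar>tanh (u L t) * S L t * C L t\<bar> \<le> 1" "\<bar>B L t * E L t\<bar> \<le> 1"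
      by (intro 1 abs_tanh_le_1; simp)+
    then have "\<bar>k * (tanh (u L t) * S L t * C L t)\<bar> \<le> 5 * 1" "\<bar>2 * real m * (B L t * E L t)\<bar> \<le> 4 * 1"
      unfolding abs_mult[of k] abs_mult[of "2 * real m"] using m_bounds by (intro mult_mono; simp)+
    then show "\<bar>k * tanh (u L t) * S L t * C L t - 2 * real m * B L t * E L t\<bar> \<le> 9"
      using abs_triangle_ineq4[of "k * (tanh (u L t) * S L t * C L t)" "2 * real m * (B L t * E L t)"]
      by (simp add: mult.assoc)
  qed
qed


text \<open>\<open>Q\<close> vanishes at time 0 because \<open>h = pi / 2\<close>, so monotonicity
  alone gives no positive bound. Up to time 1/20 one has \<open>tanh u \<le> - 1 / 2\<close>, while
  \<open>h\<close> has moved by at most 9/20 and \<open>2 * b\<close> by at most 1/10; the slope of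
  \<open>Q\<close> is then at least 3 * (1/2) * 0.89^2 * 0.99^3 > 1.\<close>

lemma Q_start:
  assumes L: "2 \<le> L" and t: "0 \<le> t" "t \<le> 1 / 20"
  shows "t \<le> Q L t"
proof -
  have "Q L 0 - 0 \<le> Q L t - t"
  proof (rule DERIV_nonneg_imp_nondecreasing[OF t(1)])
    fix s assume s: "0 \<le> s" "s \<le> t"
    have u: "1 / 2 \<le> - tanh (u L s)"
      using tanh_ge_half[of "- u L s"] displacement(1)[of L s 0] L t s by (simp add: init)
    have hs: "\<bar>h L s - pi / 2\<bar> \<le> 9 / 20"
      using displacement(3)[of L s 0] t s by (simp add: init)
    have bs: "\<bar>2 * b L s\<bar> \<le> 1 / 10"
      using displacement(2)[of L s 0] t s by (simp add: init)
    have "(h L s - pi / 2)\<^sup>2 \<le> (9 / 20)\<^sup>2" "(2 * b L s)\<^sup>2 \<le> (1 / 10)\<^sup>2"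
      using hs bs by (simp_all only: abs_le_square_iff[symmetric])
    moreover have "S L s = cos (h L s - pi / 2)"
      by (simp add: cos_diff)
    ultimately have SC: "89 / 100 \<le> S L s" "99 / 100 \<le> C L s"
      using cos_ge_quadratic[of "h L s - pi / 2"] cos_ge_quadratic[of "2 * b L s"]
      by (simp_all add: power2_eq_square)
    have s2: "(89 / 100)\<^sup>2 \<le> (S L s)\<^sup>2" and "(99 / 100) ^ 3 \<le> (C L s) ^ 3"
      using SC by (intro power_mono; simp)+
    moreover have "(C L s) ^ 3 \<le> (C L s) ^ (m + 1)"
      using m C_pos[of L s] by (intro power_decreasing) auto
    ultimately have c3: "(99 / 100) ^ 3 \<le> (C L s) ^ (m + 1)"
      by linarith
    have sc: "(89 / 100)\<^sup>2 * (99 / 100) ^ 3 \<le> (S L s)\<^sup>2 * (C L s) ^ (m + 1)"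
      by (rule mult_mono[OF s2 c3]) auto
    have kt: "3 * (1 / 2) \<le> k * - tanh (u L s)"
      using m_bounds u by (intro mult_mono) auto
    have "(3 * (1 / 2)) * ((89 / 100)\<^sup>2 * (99 / 100) ^ 3) \<le> (k * - tanh (u L s)) * ((S L s)\<^sup>2 * (C L s) ^ (m + 1))"
      by (rule mult_mono[OF kt sc order_trans[OF _ kt]]) simp_all
    then have "1 \<le> - (k * tanh (u L s) * (S L s)\<^sup>2 * (C L s) ^ (m + 1))"
      by (simp add: mult.assoc power2_eq_square power3_eq_cube)
    then show "\<exists>y. ((\<lambda>s. Q L s - s) has_real_derivative y) (at s) \<and> 0 \<le> y"
      by (intro exI conjI) (rule DERIV_diff[OF dQ DERIV_ident], simp)
  qed
  then show ?thesis by (simp add: Q_def init)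
qed

lemma Q_mono:
  assumes "s \<le> t" "\<And>r. s \<le> r \<Longrightarrow> r \<le> t \<Longrightarrow> u L r \<le> 0"
  shows "Q L s \<le> Q L t"
proof (rule DERIV_nonneg_imp_nondecreasing[OF assms(1)])
  fix r assume "s \<le> r" "r \<le> t"
  then have "tanh (u L r) \<le> 0" using assms(2) by simp
  then have "k * tanh (u L r) * (S L r)\<^sup>2 * (C L r) ^ (m + 1) \<le> 0"
    using C_pos[of L r] m_bounds by (intro mult_nonpos_nonneg mult_nonneg_nonpos) auto
  then show "\<exists>y. (Q L has_real_derivative y) (at r) \<and> 0 \<le> y"
    using dQ by (intro exI[of _ "- (k * tanh (u L r) * (S L r)\<^sup>2 * (C L r) ^ (m + 1))"]) auto
qed

lemma Q_lower:
  assumes "2 \<le> L" "1 / 20 \<le> t" "\<And>r. 0 \<le> r \<Longrightarrow> r \<le> t \<Longrightarrow> u L r \<le> 0"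
  shows "1 / 20 \<le> Q L t"
proof -
  have "1 / 20 \<le> Q L (1 / 20)" by (rule Q_start[OF assms(1)]) auto
  also have "\<dots> \<le> Q L t" by (rule Q_mono) (use assms in auto)
  finally show ?thesis .
qed

lemma bounds_of_Q:
  assumes "0 < q" "q \<le> Q L t"
  shows "q \<le> E L t" "q \<le> C L t" "q \<le> E L t * C L t"
proof -
  have "0 < E L t * (C L t) ^ m" using assms by (simp add: Q_def)
  then have E: "0 < E L t"
    using C_pos[of L t] by (simp add: zero_less_mult_iff)
  then show "q \<le> E L t" using Q_le(1)[of L t] assms by linarith
  show "q \<le> C L t" using Q_le(2,3)[of L t] assms by linarith
  have "E L t * (C L t) ^ m \<le> E L t * C L t"
    using E Q_le(3)[of L t] by (intro mult_left_mono) auto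
  then show "q \<le> E L t * C L t" using assms by (simp add: Q_def)
qed

text \<open>As long as \<open>u \<le> 0\<close>, the bound on \<open>Q\<close> gives
  \<open>u' = E * C \<ge> 1 / 20\<close> from time 1/20 on, so the equator is reached by time
  \<open>20 * (L + 1)\<close>. The first hit is the least element of a compact set, and it is not
  before \<open>L\<close> because the speed of \<open>u\<close> is at most 1.\<close>

lemma tau_exists:
  assumes L: "2 \<le> L"
  shows "\<exists>\<tau>\<ge>L. u L \<tau> = 0 \<and> (\<forall>s. 0 \<le> s \<longrightarrow> s < \<tau> \<longrightarrow> u L s < 0)"
proof -
  have "\<exists>T\<ge>0. 0 \<le> u L T"
  proof (rule ccontr)
    assume "\<not> ?thesis"
    then have neg: "u L r \<le> 0" if "0 \<le> r" for r using that by force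
    define T where "T = 20 * (L + 1)"
    have "u L (1 / 20) - (1 / 20) / 20 \<le> u L T - T / 20"
    proof (rule DERIV_nonneg_imp_nondecreasing[of "1 / 20" T "\<lambda>s. u L s - s / 20"])
      show "1 / 20 \<le> T" using L by (simp add: T_def)
      fix s :: real assume "1 / 20 \<le> s"
      then have "1 / 20 \<le> E L s * C L s"
        by (intro bounds_of_Q Q_lower L neg) auto
      then show "\<exists>y. ((\<lambda>s. u L s - s / 20) has_real_derivative y) (at s) \<and> 0 \<le> y"
        by (intro exI[of _ "E L s * C L s - 1 / 20"]) (auto intro!: derivative_eq_intros du)
    qed
    moreover have "- L - 1 / 20 \<le> u L (1 / 20)"
      using displacement(1)[of L "1 / 20" 0] unfolding init(1) by linarith
    moreover have "u L T \<le> 0" by (rule neg) (use L in \<open>simp add: T_def\<close>)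
    moreover have "T / 20 = L + 1" by (simp add: T_def)
    ultimately show False by linarith
  qed
  then obtain T where T: "0 \<le> T" "0 \<le> u L T" by blast
  define A where "A = {0..T} \<inter> {t. 0 \<le> u L t}"
  have "compact A"
    unfolding A_def by (intro compact_Int_closed compact_Icc closed_Collect_le continuous_on_const cont)
  moreover have "A \<noteq> {}" using T by (auto simp: A_def)
  ultimately obtain \<tau> where \<tau>: "\<tau> \<in> A" "\<And>t. t \<in> A \<Longrightarrow> \<tau> \<le> t"
    using continuous_attains_inf[of A "\<lambda>x. x"] by (auto intro: continuous_on_id)
  have neg: "u L s < 0" if "0 \<le> s" "s < \<tau>" for s
    using \<tau>(1) \<tau>(2)[of s] that by (force simp: A_def)
  have "0 \<le> \<tau>" "0 \<le> u L \<tau>" using \<tau>(1) by (auto simp: A_def)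
  obtain s where s: "0 \<le> s" "s \<le> \<tau>" "u L s = 0"
    using IVT'[of "u L" 0 0 \<tau>] \<open>0 \<le> \<tau>\<close> \<open>0 \<le> u L \<tau>\<close> L by (auto simp: init cont)
  then have "u L \<tau> = 0" using neg[of s] by (cases "s = \<tau>") auto
  moreover have "L \<le> \<tau>"
    using displacement(1)[of L \<tau> 0] \<open>u L \<tau> = 0\<close> \<open>0 \<le> \<tau>\<close> L by (simp add: init)
  ultimately show ?thesis using neg by blast
qed

definition "tau L = (SOME \<tau>. L \<le> \<tau> \<and> u L \<tau> = 0 \<and> (\<forall>s. 0 \<le> s \<longrightarrow> s < \<tau> \<longrightarrow> u L s < 0))"

lemma tau:
  assumes "2 \<le> L"
  shows "L \<le> tau L" "u L (tau L) = 0" "\<And>s. 0 \<le> s \<Longrightarrow> s < tau L \<Longrightarrow> u L s < 0"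
    "\<And>s. 0 \<le> s \<Longrightarrow> s \<le> tau L \<Longrightarrow> u L s \<le> 0"
proof -
  have *: "L \<le> tau L \<and> u L (tau L) = 0 \<and> (\<forall>s. 0 \<le> s \<longrightarrow> s < tau L \<longrightarrow> u L s < 0)"
    unfolding tau_def using someI_ex[OF tau_exists[OF assms]] by simp
  then show "L \<le> tau L" "u L (tau L) = 0" "\<And>s. 0 \<le> s \<Longrightarrow> s < tau L \<Longrightarrow> u L s < 0" by auto
  show "\<And>s. 0 \<le> s \<Longrightarrow> s \<le> tau L \<Longrightarrow> u L s \<le> 0"
    using * by (metis less_eq_real_def)
qed

lemma Q_lower_tau:
  assumes "2 \<le> L" "1 / 20 \<le> t" "t \<le> tau L"
  shows "1 / 20 \<le> Q L t"
  by (rule Q_lower) (use assms tau(4) in auto)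

lemma joint_cont_components:
  "continuous_on (UNIV \<times> {0..}) (\<lambda>p. u (fst p) (snd p))"
  "continuous_on (UNIV \<times> {0..}) (\<lambda>p. b (fst p) (snd p))"
  "continuous_on (UNIV \<times> {0..}) (\<lambda>p. h (fst p) (snd p))"
  using continuous_on_fst[OF joint_cont] continuous_on_fst[OF continuous_on_snd[OF joint_cont]]
    continuous_on_snd[OF continuous_on_snd[OF joint_cont]]
  by (simp_all add: case_prod_beta)

text \<open>From below: on a compact interval before \<open>tau L0\<close> the function
  \<open>u L0\<close> is bounded away from 0, and nearby solutions keep its sign. From above: the
  crossing is transversal, as \<open>E * C > 0\<close> there, so nearby solutions are also positive
  shortly afterwards.\<close>

lemma tau_cont: "continuous_on {2..} tau"
  unfolding continuous_on_def
proof
  fix L0 :: real assume "L0 \<in> {2..}"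
  then have L0: "2 \<le> L0" by simp
  have uc: "continuous_on UNIV (\<lambda>L. u L t)" if "0 \<le> t" for t
    using continuous_on_compose2[OF joint_cont_components(1), of UNIV "\<lambda>L. (L, t)"] that
    by (auto simp: continuous_on_Pair)
  show "(tau \<longlongrightarrow> tau L0) (at L0 within {2..})"
  proof (rule order_tendstoI)
    fix a assume a: "a < tau L0"
    define t where "t = max a 0"
    have t: "0 \<le> t" "t < tau L0" using a tau(1)[OF L0] L0 by (auto simp: t_def)
    obtain r where r: "r \<in> {0..t}" "\<And>s. s \<in> {0..t} \<Longrightarrow> u L0 s \<le> u L0 r"
      using continuous_attains_sup[of "{0..t}" "u L0"] t cont by auto
    define d where "d = - u L0 r * exp (- (Lip * t))"
    have "d > 0" using tau(3)[OF L0, of r] r t by (auto simp: d_def mult_neg_pos)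
    have "\<forall>\<^sub>F L in at L0 within {2..}. dist L L0 < d \<and> 2 \<le> L"
      using \<open>d > 0\<close> by (auto simp: eventually_at intro: exI[of _ d])
    then show "\<forall>\<^sub>F L in at L0 within {2..}. a < tau L"
    proof eventually_elim
      case (elim L)
      have "u L s < 0" if "0 \<le> s" "s \<le> t" for s
      proof -
        have "\<bar>u L s - u L0 s\<bar> \<le> exp (Lip * s) * \<bar>L - L0\<bar>"
          by (rule u_dependence[OF that(1)])
        also have "\<dots> \<le> exp (Lip * t) * \<bar>L - L0\<bar>"
          using that by (intro mult_right_mono) (auto simp: Lip_def)
        also have "\<dots> < exp (Lip * t) * d"
          using elim by (simp add: dist_real_def)
        also have "\<dots> = - u L0 r"
          by (simp add: d_def exp_minus)
        finally show ?thesis using r(2)[of s] that by simp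
      qed
      then have "t < tau L" using tau(1,2)[of L] elim by (metis less_irrefl not_less order_trans zero_le_numeral)
      then show ?case by (simp add: t_def)
    qed
  next
    fix a assume a: "tau L0 < a"
    have "1 / 20 \<le> E L0 (tau L0) * C L0 (tau L0)"
      using tau(1)[OF L0] L0 by (intro bounds_of_Q Q_lower_tau) auto
    then have "0 < E L0 (tau L0) * C L0 (tau L0)" by linarith
    from DERIV_pos_inc_right[OF du this]
    obtain d where d: "d > 0" "\<And>e. 0 < e \<Longrightarrow> e < d \<Longrightarrow> u L0 (tau L0) < u L0 (tau L0 + e)" by blast
    define e where "e = min (d / 2) ((a - tau L0) / 2)"
    have e: "0 < e" "e < d" "tau L0 + e < a" using d(1) a by (auto simp: e_def min_def field_simps)
    then have pos: "0 < u L0 (tau L0 + e)" using d(2)[of e] tau(2)[OF L0] by simp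
    have t0: "0 \<le> tau L0 + e" using tau(1)[OF L0] L0 e by simp
    have "((\<lambda>L. u L (tau L0 + e)) \<longlongrightarrow> u L0 (tau L0 + e)) (at L0 within {2..})"
      using uc[OF t0] unfolding continuous_on_def by (blast intro: tendsto_within_subset)
    from order_tendstoD(1)[OF this pos]
    have "\<forall>\<^sub>F L in at L0 within {2..}. 0 < u L (tau L0 + e) \<and> 2 \<le> L"
      by (auto simp: eventually_at)
    then show "\<forall>\<^sub>F L in at L0 within {2..}. tau L < a"
    proof eventually_elim
      case (elim L)
      then have "tau L < tau L0 + e" using tau(4)[of L "tau L0 + e"] t0 by force
      then show ?case using e by simp
    qed
  qed
qed

end

section \<open>Rotation of the profile curve\<close>

context profile_flow
begin

lemma W_nonzero: "W L t \<noteq> 0"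
  by (rule less_imp_neq[OF W_pos, symmetric])

lemma not_both_zero: "B L t = 0 \<Longrightarrow> S L t \<noteq> 0"
  using W_nonzero[of L t] by auto

text \<open>The angular velocity (B S' - S B') / W of the vector \<open>(B, S)\<close>. Its
  numerator is minus the form of \<open>rotation_form_bound\<close>, evaluated at
  \<open>B * E\<close> and \<open>S * C\<close>.\<close>

definition "rate L t = - (2 * real m * (B L t * E L t)\<^sup>2
    - k * (tanh (u L t) * ((B L t * E L t) * (S L t * C L t))) + 2 * (S L t * C L t)\<^sup>2) / W L t"

text \<open>The rotation of \<open>(B, S)\<close> since its initial position \<open>(0, 1)\<close>.
  Defining it as an integral avoids choosing a branch of the argument.\<close>

definition "ang L t = integral {0..t} (rate L) - integral {t..0} (rate L)"

lemma rate_joint_cont: "continuous_on (UNIV \<times> {0..}) (\<lambda>p. rate (fst p) (snd p))"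
  unfolding rate_def
  by (intro continuous_intros joint_cont_components) (auto simp: not_both_zero)

lemma ang_deriv: "(ang L has_real_derivative rate L t) (at t)"
proof -
  have "continuous_on UNIV (rate L)"
    unfolding rate_def
    by (intro continuous_intros cont) (auto simp: not_both_zero)
  from antiderivative_exists[OF this, of t] show ?thesis
    by (simp add: ang_def[abs_def] has_real_derivative_iff_has_vector_derivative)
qed

lemma ang_0: "ang L 0 = 0"
  by (simp add: ang_def)

lemma rate_le: "((B L t * E L t)\<^sup>2 + (S L t * C L t)\<^sup>2) / 5 / W L t \<le> - rate L t"
  unfolding rate_def minus_divide_left minus_minus
  by (rule divide_right_mono[OF rotation_form_bound[OF m abs_tanh_le_1]]) simp

lemma rate_nonpos: "rate L t \<le> 0"
proof -
  have "0 \<le> ((B L t * E L t)\<^sup>2 + (S L t * C L t)\<^sup>2) / 5 / W L t"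
    by (intro divide_nonneg_nonneg add_nonneg_nonneg zero_le_power2) simp
  then show ?thesis using rate_le[of L t] by linarith
qed

text \<open>Since \<open>E\<close> and \<open>C\<close> are at least 1/20, the form in
  \<open>(B * E, S * C)\<close> controls one in \<open>(B, S)\<close>; 2000 is 5 * 20^2.\<close>

lemma rate_uniform:
  assumes "1 / 20 \<le> Q L t"
  shows "rate L t \<le> - 1 / 2000"
proof -
  have "1 / 20 \<le> E L t" "1 / 20 \<le> C L t"
    using bounds_of_Q[OF _ assms] by simp_all
  then have "(1 / 20)\<^sup>2 \<le> (E L t)\<^sup>2" "(1 / 20)\<^sup>2 \<le> (C L t)\<^sup>2"
    by (intro power_mono; simp)+
  then have "(B L t)\<^sup>2 * (1 / 20)\<^sup>2 + (S L t)\<^sup>2 * (1 / 20)\<^sup>2 \<le> (B L t * E L t)\<^sup>2 + (S L t * C L t)\<^sup>2"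
    unfolding power_mult_distrib by (intro add_mono mult_left_mono) auto
  then have "W L t / 400 \<le> (B L t * E L t)\<^sup>2 + (S L t * C L t)\<^sup>2"
    by (simp add: power2_eq_square add_divide_distrib)
  moreover have "1 / 2000 \<le> x / 5 / w" if "w / 400 \<le> x" "0 < w" for w x :: real
    using that by (simp add: field_simps)
  ultimately have "1 / 2000 \<le> ((B L t * E L t)\<^sup>2 + (S L t * C L t)\<^sup>2) / 5 / W L t"
    using W_pos by blast
  then show ?thesis
    using rate_le[of L t] by linarith
qed

text \<open>The expression is the component of \<open>(B, S)\<close> orthogonal to the rotated
  direction \<open>(- sin ang, cos ang)\<close>. It solves f' = \<mu> f, with \<mu> the logarithmic
  radial growth rate, and vanishes at time 0.\<close>

lemma polar: "B L t * cos (ang L t) + S L t * sin (ang L t) = 0"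
proof -
  define \<mu> where "\<mu> t = (B L t * (2 * (S L t * (C L t)\<^sup>2)) + S L t *
      (E L t * (k * tanh (u L t) * S L t * C L t - 2 * real m * B L t * E L t))) / W L t" for t
  have alg: "p + s * ((b * q - s * p) / w) = b * ((b * p + s * q) / w)"
    "q - b * ((b * q - s * p) / w) = s * ((b * p + s * q) / w)"
    if "w = b\<^sup>2 + s\<^sup>2" "w \<noteq> 0" for b s p q w :: real
    using that by (simp_all add: field_simps power2_eq_square)
  let ?f = "\<lambda>t. B L t * cos (ang L t) + S L t * sin (ang L t)"
  have "(?f has_real_derivative \<mu> t * ?f t) (at t)" for t
  proof -
    let ?p = "2 * (S L t * (C L t)\<^sup>2)"
    let ?q = "E L t * (k * tanh (u L t) * S L t * C L t - 2 * real m * B L t * E L t)"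
    have rate: "rate L t = (B L t * ?q - S L t * ?p) / W L t"
      unfolding rate_def by (rule arg_cong[where f = "\<lambda>x. x / W L t"]) (simp add: algebra_simps power2_eq_square)
    have d: "(?f has_real_derivative cos (ang L t) * (?p + S L t * rate L t) + sin (ang L t) * (?q - B L t * rate L t)) (at t)"
      by (rule derivative_eq_intros dB dS ang_deriv refl)+ (simp add: algebra_simps)
    have eq: "?p + S L t * rate L t = B L t * \<mu> t" "?q - B L t * rate L t = S L t * \<mu> t"
      unfolding rate \<mu>_def by (rule alg(1)[OF refl W_nonzero], rule alg(2)[OF refl W_nonzero])
    show ?thesis
      by (rule DERIV_cong[OF d], unfold eq) (simp only: algebra_simps)
  qed
  note df = this
  have bound: "\<bar>\<mu> t * ?f t\<bar> \<le> 11 * \<bar>?f t\<bar>" for t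
  proof -
    have "\<bar>\<mu> t\<bar> \<le> 11"
      using radial_bound[of L t] W_pos[of L t] unfolding \<mu>_def abs_divide by (simp add: divide_le_eq)
    then show ?thesis unfolding abs_mult by (rule mult_right_mono) simp
  qed
  show ?thesis
    using zero_of_deriv_bound[OF df bound, of 0 t] by (simp add: init ang_0)
qed

lemma total_angle_le:
  assumes "2 \<le> L"
  shows "ang L (tau L) \<le> - (L - 1) / 2000"
proof -
  have t: "1 / 20 \<le> tau L" using tau(1)[OF assms] assms by linarith
  have "ang L (1 / 20) \<le> ang L 0"
    by (rule DERIV_nonpos_imp_nonincreasing[of 0 "1 / 20" "ang L"]) (simp, metis ang_deriv rate_nonpos)
  moreover have "ang L (tau L) + tau L / 2000 \<le> ang L (1 / 20) + (1 / 20) / 2000"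
  proof (rule DERIV_nonpos_imp_nonincreasing[OF t, of "\<lambda>s. ang L s + s / 2000"])
    fix s assume "1 / 20 \<le> s" "s \<le> tau L"
    then have "rate L s \<le> - 1 / 2000"
      by (intro rate_uniform Q_lower_tau assms)
    then show "\<exists>y. ((\<lambda>s. ang L s + s / 2000) has_real_derivative y) (at s) \<and> y \<le> 0"
      by (intro exI[of _ "rate L s + 1 / 2000"]) (auto intro!: derivative_eq_intros ang_deriv)
  qed
  ultimately show ?thesis using tau(1)[OF assms] ang_0[of L] by (simp add: field_simps)
qed

text \<open>Rescaling time to \<open>[0, 1]\<close> moves the variable endpoint \<open>tau L\<close>
  into the integrand, where joint continuity of \<open>rate\<close> applies.\<close>

lemma total_angle_cont: "continuous_on {2..} (\<lambda>L. ang L (tau L))"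
proof -
  have "continuous_on {2..} (\<lambda>L. integral (cbox 0 1) (\<lambda>\<sigma>. tau L * rate L (\<sigma> * tau L)))"
  proof (rule integral_continuous_on_param)
    have t: "continuous_on ({2..} \<times> cbox 0 (1::real)) (\<lambda>p. tau (fst p))"
      by (rule continuous_on_compose2[OF tau_cont]) (auto intro!: continuous_intros)
    have "continuous_on ({2..} \<times> cbox 0 1) (\<lambda>p. rate (fst p) (snd p * tau (fst p)))"
    proof -
      have sub: "(\<lambda>p. (fst p, snd p * tau (fst p))) ` ({2..} \<times> cbox 0 1) \<subseteq> UNIV \<times> {0..}"
        using tau(1) by (force intro!: mult_nonneg_nonneg)
      have "continuous_on ({2..} \<times> cbox 0 1) (\<lambda>p. (fst p, snd p * tau (fst p)))"
        by (intro continuous_intros t)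
      from continuous_on_compose2[OF rate_joint_cont this sub] show ?thesis by simp
    qed
    then show "continuous_on ({2..} \<times> cbox 0 1) (\<lambda>(L, \<sigma>). tau L * rate L (\<sigma> * tau L))"
      unfolding case_prod_beta by (intro continuous_intros t)
  qed
  moreover have "integral (cbox 0 1) (\<lambda>\<sigma>. tau L * rate L (\<sigma> * tau L)) = ang L (tau L)" for L
  proof -
    have "((\<lambda>\<sigma>. tau L * rate L (\<sigma> * tau L)) has_integral ang L (1 * tau L) - ang L (0 * tau L)) {0..1}"
    proof (rule fundamental_theorem_of_calculus)
      fix \<sigma> :: real
      have "((\<lambda>\<sigma>. ang L (\<sigma> * tau L)) has_real_derivative rate L (\<sigma> * tau L) * tau L) (at \<sigma>)"
        by (rule DERIV_chain2[OF ang_deriv]) (auto intro!: derivative_eq_intros)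
      then show "((\<lambda>\<sigma>. ang L (\<sigma> * tau L)) has_vector_derivative tau L * rate L (\<sigma> * tau L)) (at \<sigma> within {0..1})"
        by (simp add: has_real_derivative_iff_has_vector_derivative mult.commute has_vector_derivative_at_within)
    qed simp
    from integral_unique[OF this] show ?thesis by (simp only: ang_0 mult_1 mult_zero_left diff_zero cbox_interval)
  qed
  ultimately show ?thesis by simp
qed

text \<open>A zero of \<open>sin h\<close> fixes \<open>h\<close> only modulo \<open>pi\<close>. As
  \<open>cos h > 0\<close> from time 1/20 on, \<open>h\<close> stays in one interval between zeros
  of the cosine, and the drift bound 9/20 identifies it as the one around 0.\<close>

lemma h_tau_zero:
  assumes L: "2 \<le> L" and S: "S L (tau L) = 0"
  shows "h L (tau L) = 0"
proof -
  have t: "1 / 20 \<le> tau L" using tau(1)[OF L] L by linarith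
  have E: "E L s > 0" if "s \<in> {1 / 20..tau L}" for s
    using bounds_of_Q(1)[OF _ Q_lower_tau[OF L, of s]] that by simp
  have "\<bar>h L (1 / 20) - pi / 2\<bar> \<le> 9 * (1 / 20)"
    using displacement(3)[of L "1 / 20" 0] by (simp add: init)
  then have start: "\<bar>h L (1 / 20)\<bar> < pi / 2"
  proof -
    assume *: "\<bar>h L (1 / 20) - pi / 2\<bar> \<le> 9 * (1 / 20)"
    have "h L (1 / 20) < pi / 2"
    proof (rule ccontr)
      assume "\<not> ?thesis"
      then have "cos (h L (1 / 20)) \<le> cos (pi / 2)"
        using * pi_gt3 by (intro cos_monotone_0_pi_le) auto
      then show False using E[of "1 / 20"] t by simp
    qed
    moreover have "- (pi / 2) < h L (1 / 20)" using * pi_gt3 by linarith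
    ultimately show ?thesis by simp
  qed
  have "pi / 2 - h L s \<noteq> 0" "pi / 2 + h L s \<noteq> 0" if "s \<in> {1 / 20..tau L}" for s
  proof -
    show "pi / 2 - h L s \<noteq> 0"
    proof
      assume "pi / 2 - h L s = 0"
      then have "h L s = pi / 2" by simp
      then have "E L s = 0" by (simp only: cos_pi_half)
      then show False using E[OF that] by simp
    qed
    show "pi / 2 + h L s \<noteq> 0"
    proof
      assume "pi / 2 + h L s = 0"
      then have "h L s = - (pi / 2)" by simp
      then have "E L s = 0" by (simp only: cos_pi_half cos_minus)
      then show False using E[OF that] by simp
    qed
  qed
  note ne = this
  have "pi / 2 - h L (tau L) > 0"
    by (rule pos_of_never_zero[of "{1 / 20..tau L}" "\<lambda>s. pi / 2 - h L s" "1 / 20" "tau L"])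
      (use ne t start in \<open>auto intro!: continuous_intros cont simp: is_interval_cc\<close>)
  moreover have "pi / 2 + h L (tau L) > 0"
    by (rule pos_of_never_zero[of "{1 / 20..tau L}" "\<lambda>s. pi / 2 + h L s" "1 / 20" "tau L"])
      (use ne t start in \<open>auto intro!: continuous_intros cont simp: is_interval_cc\<close>)
  ultimately have "\<bar>h L (tau L)\<bar> < pi" by linarith
  then show ?thesis using sin_eq_0_pi S by auto
qed

lemma orthogonal_hits:
  assumes N: "2 \<le> N"
  shows "\<exists>L\<ge>N. h L (tau L) = 0"
proof -
  let ?A = "\<lambda>L. ang L (tau L)"
  obtain j :: nat where j: "- ?A N / pi \<le> real j" using real_arch_simple by blast
  \<comment> \<open>At the angles - pi/2 - j pi the direction \<open>(- sin ang, cos ang)\<close> is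
    horizontal, which forces \<open>S = 0\<close>. The index \<open>j\<close> puts the target below
    the angle reached for \<open>N\<close>.\<close>
  define y where "y = - (pi / 2) - real j * pi"
  have y: "y \<le> ?A N"
  proof -
    have "(- ?A N / pi) * pi \<le> real j * pi" using j by (rule mult_right_mono) simp
    then have "- ?A N \<le> real j * pi" by simp
    then show ?thesis using pi_gt_zero unfolding y_def by linarith
  qed
  \<comment> \<open>Large enough for the bound - (L - 1) / 2000 of \<open>total_angle_le\<close> to
    lie below \<open>y\<close>.\<close>
  define N' where "N' = N + 2000 * \<bar>y\<bar>"
  have "?A N' \<le> - (N' - 1) / 2000"
    using N by (intro total_angle_le) (simp add: N'_def)
  also have "\<dots> \<le> y" using N by (simp add: N'_def field_simps)
  finally have "?A N' \<le> y" .
  moreover have "continuous_on {N..N'} ?A"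
    by (rule continuous_on_subset[OF total_angle_cont]) (use N in auto)
  ultimately obtain L where L: "N \<le> L" "L \<le> N'" "?A L = y"
    using IVT2'[of ?A N' y N] y by (auto simp: N'_def)
  have "cos (?A L) = 0"
    by (simp add: L(3) y_def cos_diff)
  then have "sin (?A L) \<noteq> 0"
    by (metis sin_cos_squared_add add_0 power_zero_numeral zero_neq_one)
  then have "S L (tau L) = 0"
    using polar[of L "tau L"] \<open>cos (?A L) = 0\<close> by simp
  then show ?thesis using h_tau_zero[of L] L N by auto
qed

end

section \<open>Closed profile curves\<close>

lemma has_vector_derivative_Pair3:
  assumes "(f has_real_derivative f') (at t)" "(g has_real_derivative g') (at t)" "(h has_real_derivative h') (at t)"
  shows "((\<lambda>t. (f t, g t, h t)) has_vector_derivative (f', g', h')) (at t)"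
  using assms by (auto simp: has_real_derivative_iff_has_vector_derivative intro!: has_vector_derivative_Pair)

section \<open>Symmetries of the flow and convergence to the cone\<close>

context profile_flow
begin

text \<open>Time reversal together with (u, b, h) -> (-u, b, -h) preserves the equation, and an
  orthogonal hit of the equator is a fixed point of this map.\<close>

lemma reflection:
  assumes "u L \<tau> = 0" "h L \<tau> = 0"
  shows "u L (2 * \<tau> - t) = - u L t" "b L (2 * \<tau> - t) = b L t" "h L (2 * \<tau> - t) = - h L t"
proof -
  let ?y = "\<lambda>s. (- u L (2 * \<tau> - s), b L (2 * \<tau> - s), - h L (2 * \<tau> - s))"
  have r: "((\<lambda>s. g (2 * \<tau> - s)) has_real_derivative - g' (2 * \<tau> - s)) (at s)"
    if "\<And>t. (g has_real_derivative g' t) (at t)" for g g' :: "real \<Rightarrow> real" and s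
  proof -
    have "((\<lambda>s. 2 * \<tau> - s) has_real_derivative - 1) (at s)"
      by (auto intro!: derivative_eq_intros)
    from DERIV_chain2[OF that this] show ?thesis by simp
  qed
  have "(?y has_vector_derivative profile_field m (?y s)) (at s)" for s
    using has_vector_derivative_Pair3[OF DERIV_minus[OF r[OF du[of L], of s]] r[OF db[of L], of s] DERIV_minus[OF r[OF dh[of L], of s]]]
    by (simp add: profile_field_def algebra_simps)
  from ode_unique[OF profile_field_lipschitz flow[of L] this, of \<tau>, of "2 * \<tau> - t"] assms
  show "u L (2 * \<tau> - t) = - u L t" "b L (2 * \<tau> - t) = b L t" "h L (2 * \<tau> - t) = - h L t"
    by simp_all
qed

text \<open>By \<open>reflection\<close> the state at time \<open>2 * \<tau>\<close> is (L, 0, -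
  pi/2). This is the image of the initial state under the symmetry (u, b, h) -> (-u, -b, h - pi) of
  the field, so the whole orbit is carried to its translate. Applied twice, this yields the period
  \<open>4 * \<tau>\<close>.\<close>

lemma translation:
  assumes "u L \<tau> = 0" "h L \<tau> = 0"
  shows "u L (t + 2 * \<tau>) = - u L t" "b L (t + 2 * \<tau>) = - b L t" "h L (t + 2 * \<tau>) = h L t - pi"
proof -
  let ?y = "\<lambda>s. (- u L s, - b L s, h L s - pi)"
  let ?z = "\<lambda>s. (u L (s + 2 * \<tau>), b L (s + 2 * \<tau>), h L (s + 2 * \<tau>))"
  have r: "((\<lambda>s. g (s + 2 * \<tau>)) has_real_derivative g' (s + 2 * \<tau>)) (at s)"
    if "\<And>t. (g has_real_derivative g' t) (at t)" for g g' :: "real \<Rightarrow> real" and s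
  proof -
    have "((\<lambda>s. s + 2 * \<tau>) has_real_derivative 1) (at s)"
      by (auto intro!: derivative_eq_intros)
    from DERIV_chain2[OF that this] show ?thesis by simp
  qed
  have z: "(?z has_vector_derivative profile_field m (?z s)) (at s)" for s
    using has_vector_derivative_Pair3[OF r[OF du[of L], of s] r[OF db[of L], of s] r[OF dh[of L], of s]]
    by (simp add: profile_field_def algebra_simps)
  have "(?y has_vector_derivative profile_field m (?y s)) (at s)" for s
    using has_vector_derivative_Pair3[OF DERIV_minus[OF du[of L s]] DERIV_minus[OF db[of L s]] DERIV_diff[OF dh[of L s] DERIV_const[of pi]]]
    by (simp add: profile_field_def algebra_simps)
  from ode_unique[OF profile_field_lipschitz z this, of 0 t]
  show "u L (t + 2 * \<tau>) = - u L t" "b L (t + 2 * \<tau>) = - b L t" "h L (t + 2 * \<tau>) = h L t - pi"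
    using reflection[OF assms, of 0] by (simp_all add: init)
qed

text \<open>Translation by \<open>2 * \<tau>\<close> and reflection at \<open>\<tau>\<close> change
  only signs of \<open>u\<close> and \<open>b\<close>, so even estimates on the closed curve reduce
  to the arc up to the equator.\<close>

lemma fundamental_domain:
  assumes "u L \<tau> = 0" "h L \<tau> = 0" "0 < \<tau>"
  shows "\<exists>s. 0 \<le> s \<and> s \<le> \<tau> \<and> \<bar>u L s\<bar> = \<bar>u L t\<bar> \<and> \<bar>b L s\<bar> = \<bar>b L t\<bar>"
proof -
  have nat_shift: "\<bar>u L (r + real j * (2 * \<tau>))\<bar> = \<bar>u L r\<bar> \<and> \<bar>b L (r + real j * (2 * \<tau>))\<bar> = \<bar>b L r\<bar>" for j r
  proof (induction j)
    case (Suc j)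
    have *: "r + real (Suc j) * (2 * \<tau>) = (r + real j * (2 * \<tau>)) + 2 * \<tau>" by (simp add: algebra_simps)
    show ?case unfolding * translation[OF assms(1,2)] abs_minus_cancel by (rule Suc)
  qed simp
  define i where "i = \<lfloor>t / (2 * \<tau>)\<rfloor>"
  define r where "r = t - of_int i * (2 * \<tau>)"
  have "of_int i \<le> t / (2 * \<tau>)" "t / (2 * \<tau>) < of_int i + 1"
    unfolding i_def by linarith+
  then have r: "0 \<le> r" "r < 2 * \<tau>"
    using assms(3) by (simp_all add: r_def field_simps)
  have "\<bar>u L r\<bar> = \<bar>u L t\<bar> \<and> \<bar>b L r\<bar> = \<bar>b L t\<bar>"
  proof (cases "0 \<le> i")
    case True
    then show ?thesis using nat_shift[of r "nat i"] by (simp add: r_def)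
  next
    case False
    then show ?thesis using nat_shift[of t "nat (- i)"] by (simp add: r_def)
  qed
  moreover have "\<bar>u L (2 * \<tau> - r)\<bar> = \<bar>u L r\<bar> \<and> \<bar>b L (2 * \<tau> - r)\<bar> = \<bar>b L r\<bar>"
    using reflection[OF assms(1,2), of r] by simp
  ultimately show ?thesis
    using r by (cases "r \<le> \<tau>") (auto intro: exI[of _ r] exI[of _ "2 * \<tau> - r"])
qed

text \<open>The slope of \<open>Q\<close> controls only y = S C. Since (S B)' = k T x y - 2 m x^2 +
  2 y^2 with x = B E, subtracting a multiple of \<open>S * B\<close> supplies the missing x^2. Up to
  time \<open>L / 2\<close> one has \<open>u \<le> - 1\<close>, and the corrected function
  \<open>G\<close> has slope at least W / 64000; as it gains less than 2, \<open>W\<close> cannot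
  stay above \<open>\<nu>\<close> for long.\<close>

lemma energy_gain:
  assumes L: "2 \<le> L" and \<nu>: "\<And>s. 1 / 20 \<le> s \<Longrightarrow> s \<le> L / 2 \<Longrightarrow> \<nu> \<le> W L s"
  shows "\<nu> * (L / 2 - 1 / 20) \<le> 128000"
proof -
  \<comment> \<open>The weight 1/160 is small enough that the damping 3/40 = 12/160 of
    \<open>y^2\<close> exceeds the loss (25/8 + 2)/160 caused by the correction.\<close>
  define G where "G t = Q L t - S L t * B L t / 160" for t
  have "G (1 / 20) - \<nu> * (1 / 20) / 64000 \<le> G (L / 2) - \<nu> * (L / 2) / 64000"
  proof (rule DERIV_nonneg_imp_nondecreasing[of "1 / 20" "L / 2" "\<lambda>t. G t - \<nu> * t / 64000"])
    show "1 / 20 \<le> L / 2" using L by simp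
    fix t assume t: "1 / 20 \<le> t" "t \<le> L / 2"
    define T where "T = tanh (u L t)"
    define x where "x = B L t * E L t"
    define y where "y = S L t * C L t"
    have "u L t \<le> - 1"
      using displacement(1)[of L t 0] t L by (simp add: init)
    then have T: "T \<le> - 1 / 2"
      using tanh_ge_half[of "- u L t"] by (simp add: T_def)
    have "\<bar>T\<bar> \<le> 1" unfolding T_def by (rule abs_tanh_le_1)
    have q: "1 / 20 \<le> Q L t"
      using tau(1)[OF L] t L by (intro Q_lower_tau) auto
    have EC: "1 / 20 \<le> E L t" "1 / 20 \<le> C L t"
      using bounds_of_Q[OF _ q] by simp_all
    have dG: "(G has_real_derivative - (k * T * (S L t)\<^sup>2 * (C L t) ^ (m + 1))
        - (k * (T * (x * y)) - 2 * real m * x\<^sup>2 + 2 * y\<^sup>2) / 160) (at t)"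
      unfolding G_def T_def x_def y_def
      by (rule derivative_eq_intros dQ dB dS refl | simp)+ (simp add: algebra_simps power2_eq_square)
    have "k * (\<bar>T\<bar> * (\<bar>x\<bar> * \<bar>y\<bar>)) \<le> k * (1 * (\<bar>x\<bar> * \<bar>y\<bar>))"
      using \<open>\<bar>T\<bar> \<le> 1\<close> m_bounds by (intro mult_left_mono mult_right_mono) auto
    moreover have "k * (T * (x * y)) \<le> k * (\<bar>T\<bar> * (\<bar>x\<bar> * \<bar>y\<bar>))"
      using m_bounds abs_ge_self[of "T * (x * y)"] by (intro mult_left_mono) (auto simp: abs_mult)
    ultimately have cross: "k * (T * (x * y)) \<le> k * (\<bar>x\<bar> * \<bar>y\<bar>)"
      by simp
    \<comment> \<open>The optimal coefficient of \<open>y^2\<close> is k^2 / (4 m), which is 25/8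
      for \<open>m = 2\<close> and 9/4 for \<open>m = 1\<close>; the larger one covers both.\<close>
    have amgm: "k * (\<bar>x\<bar> * \<bar>y\<bar>) \<le> real m * x\<^sup>2 + 25 / 8 * y\<^sup>2"
    proof -
      have "0 \<le> (2 * \<bar>x\<bar> - 3 * \<bar>y\<bar>)\<^sup>2" "0 \<le> (4 * \<bar>x\<bar> - 5 * \<bar>y\<bar>)\<^sup>2" by simp_all
      then have *: "12 * (\<bar>x\<bar> * \<bar>y\<bar>) \<le> 4 * x\<^sup>2 + 9 * y\<^sup>2" "40 * (\<bar>x\<bar> * \<bar>y\<bar>) \<le> 16 * x\<^sup>2 + 25 * y\<^sup>2"
        by (simp_all add: power2_diff power_mult_distrib)
      have 1: "3 * p \<le> a + 25 / 8 * c" if "12 * p \<le> 4 * a + 9 * c" "0 \<le> c" for p a c :: real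
        using that by argo
      have 2: "5 * p \<le> 2 * a + 25 / 8 * c" if "40 * p \<le> 16 * a + 25 * c" for p a c :: real
        using that by argo
      show ?thesis
        using m
      proof
        assume "m = 1"
        then show ?thesis using 1[OF *(1)] by simp
      next
        assume "m = 2"
        then show ?thesis using 2[OF *(2)] by simp
      qed
    qed
    have damp: "3 / 40 * y\<^sup>2 \<le> - (k * T * (S L t)\<^sup>2 * (C L t) ^ (m + 1))"
    proof -
      have "(C L t) ^ (m + 1) = (C L t)\<^sup>2 * (C L t) ^ (m - 1)"
        using m by (auto simp: power2_eq_square)
      then have eq: "- (k * T * (S L t)\<^sup>2 * (C L t) ^ (m + 1)) = (k * (- T) * (C L t) ^ (m - 1)) * y\<^sup>2"
        by (simp add: y_def power_mult_distrib)
      have "1 / 20 \<le> (C L t) ^ (m - 1)"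
        using m EC by auto
      moreover have "3 * (1 / 2) \<le> k * (- T)"
        using m_bounds T by (intro mult_mono) auto
      ultimately have "3 * (1 / 2) * (1 / 20) \<le> k * (- T) * (C L t) ^ (m - 1)"
        using m_bounds T by (intro mult_mono) auto
      then have "3 / 40 \<le> k * (- T) * (C L t) ^ (m - 1)" by simp
      then show ?thesis unfolding eq by (rule mult_right_mono) simp
    qed
    have xy: "W L t / 400 \<le> x\<^sup>2 + y\<^sup>2"
    proof -
      have "(1 / 20)\<^sup>2 \<le> (E L t)\<^sup>2" "(1 / 20)\<^sup>2 \<le> (C L t)\<^sup>2"
        using EC by (intro power_mono; simp)+
      then have "(B L t)\<^sup>2 * (1 / 20)\<^sup>2 + (S L t)\<^sup>2 * (1 / 20)\<^sup>2 \<le> x\<^sup>2 + y\<^sup>2"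
        unfolding x_def y_def power_mult_distrib by (intro add_mono mult_left_mono) auto
      then show ?thesis by (simp add: power2_eq_square add_divide_distrib)
    qed
    have mx: "x\<^sup>2 \<le> real m * x\<^sup>2" using m_bounds mult_right_mono[of 1 "real m" "x\<^sup>2"] by simp
    have fin: "v / 64000 \<le> D - (c - 2 * a + 2 * Y) / 160"
      if "3 / 40 * Y \<le> D" "c \<le> k'" "k' \<le> a + 25 / 8 * Y" "X \<le> a" "w / 400 \<le> X + Y" "v \<le> w" "0 \<le> Y"
      for v w D c a k' X Y :: real
      using that by argo
    have "\<nu> / 64000 \<le> - (k * T * (S L t)\<^sup>2 * (C L t) ^ (m + 1))
        - (k * (T * (x * y)) - 2 * (real m * x\<^sup>2) + 2 * y\<^sup>2) / 160"
      by (rule fin[OF damp cross amgm mx xy \<nu>[OF t]]) simp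
    moreover have "((\<lambda>t. G t - \<nu> * t / 64000) has_real_derivative
        - (k * T * (S L t)\<^sup>2 * (C L t) ^ (m + 1))
        - (k * (T * (x * y)) - 2 * real m * x\<^sup>2 + 2 * y\<^sup>2) / 160 - \<nu> / 64000) (at t)"
      by (rule DERIV_diff[OF dG]) (auto intro!: derivative_eq_intros)
    ultimately show "\<exists>d. ((\<lambda>t. G t - \<nu> * t / 64000) has_real_derivative d) (at t) \<and> 0 \<le> d"
      by (intro exI conjI) (assumption, simp add: mult.assoc)
  qed
  moreover have "G (L / 2) \<le> 1 + 1 / 160"
  proof -
    have "Q L (L / 2) \<le> 1"
      using Q_le(2,3)[of L "L / 2"] cos_le_one[of "2 * b L (L / 2)"] by linarith
    moreover have "\<bar>S L (L / 2) * B L (L / 2)\<bar> \<le> 1"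
      unfolding abs_mult using mult_mono[of "\<bar>S L (L / 2)\<bar>" 1 "\<bar>B L (L / 2)\<bar>" 1] by simp
    ultimately show ?thesis unfolding G_def by linarith
  qed
  moreover have "- 1 / 160 \<le> G (1 / 20)"
  proof -
    have "0 \<le> Q L (1 / 20)" using Q_start[OF L, of "1 / 20"] by simp
    moreover have "\<bar>S L (1 / 20) * B L (1 / 20)\<bar> \<le> 1"
      unfolding abs_mult using mult_mono[of "\<bar>S L (1 / 20)\<bar>" 1 "\<bar>B L (1 / 20)\<bar>" 1] by simp
    ultimately show ?thesis unfolding G_def by linarith
  qed
  ultimately show ?thesis by (simp add: right_diff_distrib)
qed

text \<open>A small \<open>W\<close> puts \<open>Q\<close> above (1 - \<nu>)^2, close to its maximum
  1, because \<open>C\<^sup>2 \<le> C ^ m\<close> and \<open>E\<^sup>2 \<le> E\<close> at that time.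
  Monotonicity preserves this until the equator, and \<open>Q \<le> C\<close> then limits
  \<open>B\<close>.\<close>

lemma sin_small_after:
  assumes L: "2 \<le> L" and s: "1 / 20 \<le> s" "s \<le> t" "t \<le> tau L"
    and W: "W L s \<le> \<nu>" and \<nu>: "0 \<le> \<nu>" "\<nu> \<le> 1 / 4"
  shows "(B L t)\<^sup>2 \<le> 4 * \<nu>"
proof -
  have EC: "0 < E L s" "0 < C L s"
    using bounds_of_Q[OF _ Q_lower_tau[OF L s(1)]] s by simp_all
  have "1 - \<nu> \<le> (E L s)\<^sup>2" "1 - \<nu> \<le> (C L s)\<^sup>2"
    using W zero_le_power2[of "S L s"] zero_le_power2[of "B L s"]
    unfolding cos_squared_eq by linarith+
  moreover have "(E L s)\<^sup>2 \<le> E L s"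
    using EC by (simp add: power2_eq_square mult_left_le)
  ultimately have "1 - \<nu> \<le> E L s" "1 - \<nu> \<le> (C L s) ^ m"
    using Q_le(4)[of L s] by linarith+
  then have "(1 - \<nu>) * (1 - \<nu>) \<le> Q L s"
    unfolding Q_def using EC \<nu> by (intro mult_mono) auto
  also have "Q L s \<le> Q L t"
    by (rule Q_mono) (use s tau(4)[OF L] in auto)
  also have "\<dots> \<le> C L t"
    using Q_le(2,3)[of L t] by linarith
  finally have "(1 - \<nu>) * (1 - \<nu>) \<le> C L t" .
  moreover have "(1 - \<nu>) * (1 - \<nu>) = 1 - 2 * \<nu> + \<nu> * \<nu>" by (simp add: algebra_simps)
  ultimately have "1 - 2 * \<nu> \<le> C L t"
    using zero_le_square[of \<nu>] by linarith
  then have "(1 - 2 * \<nu>)\<^sup>2 \<le> (C L t)\<^sup>2"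
    using \<nu> by (intro power_mono) auto
  moreover have "(1 - 2 * \<nu>)\<^sup>2 = 1 - 4 * \<nu> + 4 * (\<nu> * \<nu>)" by (simp add: power2_eq_square algebra_simps)
  ultimately show ?thesis
    using zero_le_square[of \<nu>] unfolding sin_squared_eq by linarith
qed

text \<open>Two regimes: after the time provided by \<open>energy_gain\<close>,
  \<open>sin (2 * b)\<close> is small; before it, \<open>t \<le> L / 2\<close>, the curve is still
  close to the pole with \<open>\<bar>u\<bar> \<ge> L / 2\<close>, and \<open>sech u\<close> is
  small.\<close>

lemma decay:
  assumes "0 < \<epsilon>"
  shows "\<exists>L0\<ge>2. \<forall>L\<ge>L0. \<forall>t. 0 \<le> t \<longrightarrow> t \<le> tau L \<longrightarrow> (1 / cosh (u L t))\<^sup>2 * \<bar>B L t\<bar> \<le> \<epsilon>"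
proof -
  define \<nu> where "\<nu> = min (1 / 4) (\<epsilon>\<^sup>2 / 4)"
  have \<nu>: "0 < \<nu>" "\<nu> \<le> 1 / 4" "4 * \<nu> \<le> \<epsilon>\<^sup>2" using assms by (auto simp: \<nu>_def)
  define L0 where "L0 = 4 + 4 / \<epsilon> + 2 * (128000 / \<nu>)"
  show ?thesis
  proof (intro exI conjI allI impI)
    show "2 \<le> L0" using assms \<nu> by (simp add: L0_def add_increasing2)
    fix L t assume L: "L0 \<le> L" and t: "0 \<le> t" "t \<le> tau L"
    have L2: "2 \<le> L" using L \<open>2 \<le> L0\<close> by simp
    have "\<exists>s. 1 / 20 \<le> s \<and> s \<le> L / 2 \<and> W L s < \<nu>"
    proof (rule ccontr)
      assume "\<not> ?thesis"
      then have "\<nu> * (L / 2 - 1 / 20) \<le> 128000"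
        by (intro energy_gain L2) force
      then have "L / 2 - 1 / 20 \<le> 128000 / \<nu>" using \<nu> by (simp add: field_simps)
      moreover have "0 < 4 / \<epsilon>" using assms by simp
      ultimately show False using L unfolding L0_def by linarith
    qed
    then obtain s where s: "1 / 20 \<le> s" "s \<le> L / 2" "W L s < \<nu>" by blast
    have sech: "0 < 1 / cosh (u L t)" "1 / cosh (u L t) \<le> 1"
      using cosh_real_ge_1[of "u L t"] by (auto simp: divide_le_eq)
    then have "1 / cosh (u L t) * (1 / cosh (u L t)) \<le> 1 / cosh (u L t) * 1"
      by (intro mult_left_mono) auto
    then have sech2: "(1 / cosh (u L t))\<^sup>2 \<le> 1 / cosh (u L t)"
      by (simp only: power2_eq_square mult_1_right)
    show "(1 / cosh (u L t))\<^sup>2 * \<bar>B L t\<bar> \<le> \<epsilon>"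
    proof (cases "s \<le> t")
      case True
      have "(B L t)\<^sup>2 \<le> \<epsilon>\<^sup>2"
        using sin_small_after[OF L2 s(1) True t(2), of \<nu>] s(3) \<nu> by simp
      then have "\<bar>B L t\<bar> \<le> \<epsilon>"
        using abs_le_square_iff[of "B L t" \<epsilon>] assms by simp
      moreover have "(1 / cosh (u L t))\<^sup>2 * \<bar>B L t\<bar> \<le> 1 * \<bar>B L t\<bar>"
        using sech sech2 by (intro mult_right_mono) linarith+
      ultimately show ?thesis by simp
    next
      case False
      then have "L / 2 \<le> \<bar>u L t\<bar>"
        using displacement(1)[of L t 0] t s by (simp add: init)
      moreover have "cosh (u L t) = (exp \<bar>u L t\<bar> + exp (- \<bar>u L t\<bar>)) / 2"
        by (metis cosh_field_def cosh_real_abs)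
      ultimately have "L / 2 / 2 \<le> cosh (u L t)"
        using exp_ge_add_one_self[of "\<bar>u L t\<bar>"] exp_gt_zero[of "- \<bar>u L t\<bar>"] by argo
      moreover have "4 / \<epsilon> \<le> L"
      proof -
        have "0 < 128000 / \<nu>" using \<nu> by simp
        then show ?thesis using L unfolding L0_def by linarith
      qed
      ultimately have "1 / \<epsilon> \<le> cosh (u L t)" by simp
      then have "1 / cosh (u L t) \<le> \<epsilon>"
        using assms cosh_real_pos[of "u L t"] by (simp add: field_simps)
      moreover have "(1 / cosh (u L t))\<^sup>2 * \<bar>B L t\<bar> \<le> (1 / cosh (u L t)) * 1"
        using sech2 by (intro mult_mono) auto
      ultimately show ?thesis by simp
    qed
  qed
qed

end

lemma profile_flow_exists:
  assumes "m = 1 \<or> m = 2"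
  shows "\<exists>u b h. profile_flow m u b h"
proof -
  have "\<forall>L. \<exists>x. x 0 = (- L, 0, pi / 2) \<and> (\<forall>t. (x has_vector_derivative profile_field m (x t)) (at t))"
    using ode_exists[OF profile_field_lipschitz profile_field_bounded] by blast
  then obtain x where x: "\<And>L. x L 0 = (- L, 0, pi / 2)"
    "\<And>L t. (x L has_vector_derivative profile_field m (x L t)) (at t)"
    by metis
  have "profile_flow m (\<lambda>L t. fst (x L t)) (\<lambda>L t. fst (snd (x L t))) (\<lambda>L t. snd (snd (x L t)))"
    by unfold_locales (use assms x in auto)
  then show ?thesis by blast
qed

text \<open>All that the geometric part uses of the flow. \<open>h\<close> may drop by
  \<open>2 * pi\<close> over a period, as it enters only through sine and cosine.
  \<open>equator\<close> and \<open>off_equator\<close> provide the points at which quadratic forms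
  are tested later.\<close>

locale closed_profile =
  fixes m :: nat and u b h :: "real \<Rightarrow> real" and T :: real
  assumes du: "(u has_real_derivative cos (h t) * cos (2 * b t)) (at t)"
    and db: "(b has_real_derivative sin (h t) * cos (2 * b t)) (at t)"
    and dh: "(h has_real_derivative (2 * real m + 1) * tanh (u t) * sin (h t) * cos (2 * b t)
          - 2 * real m * sin (2 * b t) * cos (h t)) (at t)"
    and b_bounds: "- (pi / 4) < b t" "b t < pi / 4"
    and T_pos: "0 < T"
    and periodic: "u (t + T) = u t" "b (t + T) = b t" "h (t + T) = h t - 2 * pi"
    and equator: "\<exists>s t. u s = 0 \<and> u t = 0 \<and> b s = - b t \<and> b t \<noteq> 0"
    and off_equator: "\<exists>t. u t \<noteq> 0"

lemma closed_profiles: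
  assumes m: "m = 1 \<or> m = 2" and \<epsilon>: "0 < \<epsilon>"
  shows "\<exists>u b h T. closed_profile m u b h T \<and> (\<forall>t. (1 / cosh (u t))\<^sup>2 * \<bar>sin (2 * b t)\<bar> \<le> \<epsilon>)"
proof -
  obtain u b h where "profile_flow m u b h" using profile_flow_exists[OF m] by blast
  then interpret profile_flow m u b h .
  obtain L0 where L0: "2 \<le> L0"
    "\<And>L t. L0 \<le> L \<Longrightarrow> 0 \<le> t \<Longrightarrow> t \<le> tau L \<Longrightarrow> (1 / cosh (u L t))\<^sup>2 * \<bar>sin (2 * b L t)\<bar> \<le> \<epsilon>"
    using decay[OF \<epsilon>] by blast
  obtain L where L: "L0 \<le> L" "h L (tau L) = 0" using orthogonal_hits[OF L0(1)] by blast
  have L2: "2 \<le> L" using L L0 by simp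
  note tr = translation[OF tau(2)[OF L2] L(2)]
  have pos: "0 < tau L" using tau(1)[OF L2] L2 by simp
  \<comment> \<open>At the orthogonal hit \<open>S = 0\<close>, so \<open>W \<noteq> 0\<close>
    forces the hit to lie off the cone. Its translate by half a period is then a second equator
    point, with the opposite \<open>b\<close>.\<close>
  have "sin (2 * b L (tau L)) \<noteq> 0" using W_nonzero[of L "tau L"] L(2) by auto
  then have bne: "b L (tau L) \<noteq> 0" by auto
  have "closed_profile m (u L) (b L) (h L) (4 * tau L)"
  proof
    have "t + 4 * tau L = (t + 2 * tau L) + 2 * tau L" for t by simp
    then show "u L (t + 4 * tau L) = u L t" "b L (t + 4 * tau L) = b L t" "h L (t + 4 * tau L) = h L t - 2 * pi" for t
      by (simp_all only: tr)
    show "\<exists>s t. u L s = 0 \<and> u L t = 0 \<and> b L s = - b L t \<and> b L t \<noteq> 0"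
      using tr[of "tau L"] tau(2)[OF L2] bne by (intro exI[of _ "tau L + 2 * tau L"] exI[of _ "tau L"]) simp
    show "\<exists>t. u L t \<noteq> 0" using init(1)[of L] L2 by (intro exI[of _ 0]) simp
  qed (use du db dh b_bounds pos in auto)
  moreover have "(1 / cosh (u L t))\<^sup>2 * \<bar>sin (2 * b L t)\<bar> \<le> \<epsilon>" for t
  proof -
    obtain s where s: "0 \<le> s" "s \<le> tau L" "\<bar>u L s\<bar> = \<bar>u L t\<bar>" "\<bar>b L s\<bar> = \<bar>b L t\<bar>"
      using fundamental_domain[OF tau(2)[OF L2] L(2) pos] by blast
    have "cosh (u L s) = cosh (u L t)" using s(3) by (metis cosh_real_abs)
    moreover have "\<bar>sin (2 * b L s)\<bar> = \<bar>sin (2 * b L t)\<bar>"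
      using s(4) by (auto simp: abs_eq_iff)
    ultimately show ?thesis using L0(2)[OF L(1) s(1,2)] by metis
  qed
  ultimately show ?thesis by blast
qed

section \<open>Differentials on the product of spheres\<close>

lemma smooth_on_Pair:
  fixes f :: "'a::real_normed_vector \<Rightarrow> 'b::real_normed_vector" and g :: "'a \<Rightarrow> 'c::real_normed_vector"
  assumes U: "open U" and f: "smooth_on f U" and g: "smooth_on g U"
  shows "smooth_on (\<lambda>x. (f x, g x)) U"
proof -
  have "smooth_on (\<lambda>x. (f x, 0 :: 'c)) U"
    by (rule smooth_on_linear[OF bounded_linear_Pair[OF bounded_linear_ident bounded_linear_zero] U f])
  moreover have "smooth_on (\<lambda>x. (0 :: 'b, g x)) U"
    by (rule smooth_on_linear[OF bounded_linear_Pair[OF bounded_linear_zero bounded_linear_ident] U g])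
  ultimately show ?thesis
    using smooth_on_add[OF U] by fastforce
qed

lemma inner_eq_zero_of_sphere_curve:
  fixes c :: "real \<Rightarrow> 'a::real_inner"
  assumes c: "(c has_vector_derivative v) (at 0)" and "0 < \<epsilon>"
    and norm: "\<And>t. t \<in> {-\<epsilon><..<\<epsilon>} \<Longrightarrow> norm (c t) = 1"
  shows "c 0 \<bullet> v = 0"
proof -
  have d: "((\<lambda>t. c t \<bullet> c t) has_vector_derivative c 0 \<bullet> v + v \<bullet> c 0) (at 0)"
    by (rule bounded_bilinear.has_vector_derivative[OF bounded_bilinear_inner c c])
  have "((\<lambda>t. c t \<bullet> c t) has_vector_derivative 0) (at 0)"
  proof (rule has_vector_derivative_transform_within_open[of "\<lambda>t. 1" _ _ "{-\<epsilon><..<\<epsilon>}"])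
    show "1 = c t \<bullet> c t" if "t \<in> {-\<epsilon><..<\<epsilon>}" for t
      using norm[OF that] by (simp add: norm_eq_1)
  qed (use \<open>0 < \<epsilon>\<close> in auto)
  from vector_derivative_unique_at[OF d this] show ?thesis
    by (simp add: inner_commute)
qed

lemma great_circle:
  fixes x a :: "'a::euclidean_space"
  assumes "norm x = 1" "x \<bullet> a = 0"
  obtains c where "smooth_on c UNIV" "\<And>t. norm (c t) = 1" "c 0 = x" "(c has_vector_derivative a) (at (0::real))"
proof
  \<comment> \<open>For \<open>a = 0\<close> also \<open>r = 0\<close>, and the formula degenerates
    to the constant curve \<open>x\<close>.\<close>
  define r where "r = norm a"
  let ?c = "\<lambda>t. cos (r * t) *\<^sub>R x + sin (r * t) *\<^sub>R (a /\<^sub>R r)"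
  have "smooth_on (\<lambda>t. r * t) (UNIV :: real set)"
    by (intro smooth_on_mult smooth_on_const smooth_on_ident) auto
  from smooth_on_compose_real[OF open_UNIV smooth_on_sin_cos(1)[OF open_UNIV] this subset_UNIV]
    smooth_on_compose_real[OF open_UNIV smooth_on_sin_cos(2)[OF open_UNIV] this subset_UNIV]
  have "smooth_on (\<lambda>t. cos (r * t)) UNIV" "smooth_on (\<lambda>t. sin (r * t)) UNIV"
    by simp_all
  then show "smooth_on ?c UNIV"
    by (intro smooth_on_add smooth_on_scaleR smooth_on_const) auto
  show "norm (?c t) = 1" for t
  proof (cases "r = 0")
    case True
    then show ?thesis using assms(1) by simp
  next
    case False
    have "x \<bullet> x = 1" using assms(1) by (simp add: norm_eq_1)
    moreover have "(a /\<^sub>R r) \<bullet> (a /\<^sub>R r) = 1"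
      using False unfolding norm_eq_1[symmetric] by (simp add: r_def)
    moreover have "x \<bullet> (a /\<^sub>R r) = 0" using assms(2) by simp
    moreover have "(C *\<^sub>R x + S *\<^sub>R e) \<bullet> (C *\<^sub>R x + S *\<^sub>R e) = S\<^sup>2 + C\<^sup>2"
      if "x \<bullet> x = 1" "e \<bullet> e = 1" "x \<bullet> e = 0" for C S e
      using that by (simp add: inner_add_left inner_add_right inner_commute[of e x] power2_eq_square)
    ultimately have "(C *\<^sub>R x + S *\<^sub>R (a /\<^sub>R r)) \<bullet> (C *\<^sub>R x + S *\<^sub>R (a /\<^sub>R r)) = S\<^sup>2 + C\<^sup>2" for C S
      by blast
    then show ?thesis by (simp only: norm_eq_1 sin_cos_squared_add)
  qed
  show "?c 0 = x" by simp
  have "(?c has_vector_derivative (- (sin (r * 0) * r)) *\<^sub>R x + (cos (r * 0) * r) *\<^sub>R (a /\<^sub>R r)) (at 0)"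
    by (auto intro!: derivative_eq_intros simp: has_real_derivative_iff_has_vector_derivative[symmetric])
  then show "(?c has_vector_derivative a) (at 0)"
    by (cases "r = 0") (auto simp: r_def)
qed

text \<open>A curve of unit vectors has velocity orthogonal to its position; conversely a triple of
  great circles realises every triple of orthogonal vectors.\<close>

lemma tangent_space_sphere_product:
  fixes x y :: "real^'n" and w :: "real^2"
  assumes p: "(x, y, w) \<in> sphere_product"
  shows "tangent_space sphere_product (x, y, w) = {(a, b, c). x \<bullet> a = 0 \<and> y \<bullet> b = 0 \<and> w \<bullet> c = 0}"
proof (intro equalityI subsetI)
  fix v assume "v \<in> tangent_space sphere_product (x, y, w)"
  then obtain c \<epsilon> where \<epsilon>: "0 < \<epsilon>" and M: "c ` {-\<epsilon><..<\<epsilon>} \<subseteq> sphere_product" and c0: "c 0 = (x, y, w)"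
    and c: "(c has_vector_derivative v) (at (0::real))"
    by (auto simp: tangent_space_def)
  obtain a b d where v: "v = (a, b, d)" by (cases v)
  have M: "norm (fst (c t)) = 1" "norm (fst (snd (c t))) = 1" "norm (snd (snd (c t))) = 1"
    if "t \<in> {-\<epsilon><..<\<epsilon>}" for t
    using M that unfolding sphere_product_def by (force simp: mem_Times_iff)+
  have c': "((\<lambda>t. fst (c t)) has_vector_derivative a) (at 0)"
    "((\<lambda>t. fst (snd (c t))) has_vector_derivative b) (at 0)"
    "((\<lambda>t. snd (snd (c t))) has_vector_derivative d) (at 0)"
    using bounded_linear.has_vector_derivative[OF bounded_linear_fst c]
      bounded_linear.has_vector_derivative[OF bounded_linear_fst bounded_linear.has_vector_derivative[OF bounded_linear_snd c]]
      bounded_linear.has_vector_derivative[OF bounded_linear_snd bounded_linear.has_vector_derivative[OF bounded_linear_snd c]]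
    by (simp_all add: v)
  show "v \<in> {(a, b, c). x \<bullet> a = 0 \<and> y \<bullet> b = 0 \<and> w \<bullet> c = 0}"
    using inner_eq_zero_of_sphere_curve[OF c'(1) \<epsilon> M(1)] inner_eq_zero_of_sphere_curve[OF c'(2) \<epsilon> M(2)]
      inner_eq_zero_of_sphere_curve[OF c'(3) \<epsilon> M(3)]
    by (simp add: v c0)
next
  fix v :: "(real^'n) \<times> (real^'n) \<times> (real^2)"
  assume "v \<in> {(a, b, c). x \<bullet> a = 0 \<and> y \<bullet> b = 0 \<and> w \<bullet> c = 0}"
  then obtain a b d where v: "v = (a, b, d)" "x \<bullet> a = 0" "y \<bullet> b = 0" "w \<bullet> d = 0" by auto
  have n: "norm x = 1" "norm y = 1" "norm w = 1" using p by (auto simp: sphere_product_def)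
  obtain c1 where c1: "smooth_on c1 UNIV" "\<And>t. norm (c1 t) = 1" "c1 0 = x" "(c1 has_vector_derivative a) (at (0::real))"
    using great_circle[OF n(1) v(2)] by blast
  obtain c2 where c2: "smooth_on c2 UNIV" "\<And>t. norm (c2 t) = 1" "c2 0 = y" "(c2 has_vector_derivative b) (at (0::real))"
    using great_circle[OF n(2) v(3)] by blast
  obtain c3 where c3: "smooth_on c3 UNIV" "\<And>t. norm (c3 t) = 1" "c3 0 = w" "(c3 has_vector_derivative d) (at (0::real))"
    using great_circle[OF n(3) v(4)] by blast
  have sm: "smooth_on (\<lambda>t. (c1 t, c2 t, c3 t)) UNIV"
    by (intro smooth_on_Pair c1 c2 c3) auto
  have "Ck_on k f U \<Longrightarrow> V \<subseteq> U \<Longrightarrow> Ck_on k f V" for k and f :: "real \<Rightarrow> (real^'n) \<times> (real^'n) \<times> (real^2)" and U V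
    by (induction k arbitrary: f) (auto intro: continuous_on_subset)
  then have "smooth_on (\<lambda>t. (c1 t, c2 t, c3 t)) {-1<..<1}"
    using sm unfolding smooth_on_def by blast
  moreover have "((\<lambda>t. (c1 t, c2 t, c3 t)) has_vector_derivative v) (at 0)"
    unfolding v(1) by (intro has_vector_derivative_Pair c1 c2 c3)
  ultimately show "v \<in> tangent_space sphere_product (x, y, w)"
    unfolding tangent_space_def sphere_product_def
    by (intro CollectI exI[of _ "\<lambda>t. (c1 t, c2 t, c3 t)"] exI[of _ 1]) (use c1 c2 c3 in auto)
qed

text \<open>Composition with a curve in \<open>M\<close> turns any derivative within
  \<open>M\<close> into an ordinary derivative on the line, which is unique. So the value on a
  tangent vector can be read off from any local extension \<open>g\<close>.\<close>

lemma differential_eq: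
  assumes q: "q \<in> M" and V: "open V" "q \<in> V"
    and g: "(g has_derivative g') (at q)" and eq: "\<And>x. x \<in> M \<inter> V \<Longrightarrow> g x = F x"
  shows "(F has_derivative differential M F q) (at q within M)"
    and "v \<in> tangent_space M q \<Longrightarrow> differential M F q v = g' v"
proof -
  have F: "(F has_derivative g') (at q within M)"
  proof -
    obtain d where d: "0 < d" "\<And>x. dist x q < d \<Longrightarrow> x \<in> V"
      using V by (auto simp: open_dist)
    show ?thesis
      by (rule has_derivative_transform_within[OF has_derivative_at_withinI[OF g] d(1) q])
         (use eq d(2) in auto)
  qed
  then show D: "(F has_derivative differential M F q) (at q within M)"
    unfolding differential_def using frechet_derivative_works differentiable_def by blast
  assume "v \<in> tangent_space M q"
  then obtain c \<epsilon> where \<epsilon>: "0 < \<epsilon>" and M: "c ` {-\<epsilon><..<\<epsilon>} \<subseteq> M" and c0: "c 0 = q"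
    and c: "(c has_vector_derivative v) (at (0::real))"
    by (auto simp: tangent_space_def)
  have comp: "((\<lambda>t. F (c t)) has_derivative (\<lambda>t. G (t *\<^sub>R v))) (at 0)"
    if "(F has_derivative G) (at q within M)" for G
  proof -
    have "((\<lambda>t. F (c t)) has_derivative (\<lambda>t. G (t *\<^sub>R v))) (at 0 within {-\<epsilon><..<\<epsilon>})"
    proof (rule has_derivative_in_compose[where f = c and f' = "\<lambda>t. t *\<^sub>R v" and g = F and g' = G])
      show "(c has_derivative (\<lambda>t. t *\<^sub>R v)) (at 0 within {-\<epsilon><..<\<epsilon>})"
        using c unfolding has_vector_derivative_def by (rule has_derivative_at_withinI)
      show "(F has_derivative G) (at (c 0) within c ` {-\<epsilon><..<\<epsilon>})"
        unfolding c0 by (rule has_derivative_subset[OF that M])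
    qed
    then show ?thesis
      using at_within_open[of 0 "{-\<epsilon><..<\<epsilon>}"] \<epsilon> by simp
  qed
  have "(\<lambda>t. differential M F q (t *\<^sub>R v)) = (\<lambda>t. g' (t *\<^sub>R v))"
    by (rule has_derivative_unique[OF comp[OF D] comp[OF F]])
  from fun_cong[OF this, of 1] show "differential M F q v = g' v" by simp
qed

section \<open>Orthonormal bases and the Parseval identity\<close>

lemma parseval_span:
  fixes B :: "'a::euclidean_space set"
  assumes "finite B" and on: "\<And>u v. u \<in> B \<Longrightarrow> v \<in> B \<Longrightarrow> u \<bullet> v = (if u = v then 1 else 0)"
    and x: "x \<in> span B"
  shows "(\<Sum>b\<in>B. (b \<bullet> x)\<^sup>2) = x \<bullet> x"
proof -
  define p where "p = (\<Sum>b\<in>B. (b \<bullet> x) *\<^sub>R b)"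
  have p: "p \<in> span B" unfolding p_def by (intro span_sum span_scale span_base)
  have perp: "(x - p) \<bullet> c = 0" if "c \<in> B" for c
  proof -
    have "c \<bullet> p = (\<Sum>b\<in>B. if c = b then b \<bullet> x else 0)"
      unfolding p_def inner_sum_right using that on by (intro sum.cong) auto
    also have "\<dots> = c \<bullet> x" using that \<open>finite B\<close> by simp
    finally have "c \<bullet> (x - p) = 0" by (simp add: inner_diff_right)
    then show ?thesis by (simp only: inner_commute)
  qed
  have "orthogonal (x - p) (x - p)"
    by (rule orthogonal_to_span[OF span_diff[OF x p]]) (use perp in \<open>simp add: orthogonal_def\<close>)
  then have "x = p" by (simp add: orthogonal_def)
  then have "x \<bullet> x = x \<bullet> p" by (rule arg_cong)
  also have "\<dots> = (\<Sum>b\<in>B. (b \<bullet> x)\<^sup>2)"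
    unfolding p_def inner_sum_right by (simp add: power2_eq_square inner_commute)
  finally show ?thesis by simp
qed

lemma finite_orthonormal:
  fixes B :: "'a::euclidean_space set"
  assumes on: "\<And>u v. u \<in> B \<Longrightarrow> v \<in> B \<Longrightarrow> u \<bullet> v = (if u = v then 1 else 0)"
  shows "finite B"
proof -
  have "0 \<notin> B" using on[of 0 0] by auto
  moreover have "pairwise orthogonal B" using on by (auto simp: pairwise_def orthogonal_def)
  ultimately have "independent B" by (rule pairwise_orthogonal_independent[rotated])
  then show ?thesis by (rule independent_imp_finite)
qed

lemma orthonormal_basis_exists:
  fixes S :: "'a::euclidean_space set"
  assumes "subspace S"
  obtains B where "finite B" "B \<subseteq> S" "span B = S" "card B = dim S"
    "\<And>u v. u \<in> B \<Longrightarrow> v \<in> B \<Longrightarrow> u \<bullet> v = (if u = v then 1 else 0)"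
proof -
  obtain B where B: "B \<subseteq> S" "pairwise orthogonal B" "\<And>x. x \<in> B \<Longrightarrow> norm x = 1"
    "independent B" "card B = dim S" "span B = S"
    using orthonormal_basis_subspace[OF assms] by blast
  then show ?thesis
    by (intro that[of B]) (auto simp: independent_imp_finite pairwise_def orthogonal_def norm_eq_1)
qed

text \<open>An arbitrary argument of \<open>w\<close>, not continuous on the circle. The ambiguity
  by multiples of \<open>2 * pi\<close> disappears after composition with periodic
  functions.\<close>

definition angle :: "real^2 \<Rightarrow> real"
  where "angle w = (SOME a. w $ 1 = cos a \<and> w $ 2 = sin a)"

text \<open>A smooth branch on the half plane around \<open>w0\<close>: for unit vectors the
  quotient is the tangent of the angle from \<open>w0\<close> to \<open>w\<close>.\<close>

definition angle_near :: "real^2 \<Rightarrow> real^2 \<Rightarrow> real"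
  where "angle_near w0 w = angle w0 + arctan ((w0 $ 1 * w $ 2 - w0 $ 2 * w $ 1) / (w0 \<bullet> w))"

abbreviation turn :: "real^2 \<Rightarrow> real^2 \<Rightarrow> real"
  where "turn w c \<equiv> w $ 1 * c $ 2 - w $ 2 * c $ 1"

lemma inner_real2: "v \<bullet> w = v $ 1 * w $ 1 + v $ 2 * w $ 2" for v w :: "real^2"
  by (simp add: inner_vec_def sum_2)

lemma angle:
  assumes "norm w = 1"
  shows "cos (angle w) = w $ 1" "sin (angle w) = w $ 2"
proof -
  have "(w $ 1)\<^sup>2 + (w $ 2)\<^sup>2 = 1"
    using assms by (simp add: norm_eq_1 inner_real2 power2_eq_square)
  from sincos_total_2pi[OF this] have "\<exists>a. w $ 1 = cos a \<and> w $ 2 = sin a" by metis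
  from someI_ex[OF this] show "cos (angle w) = w $ 1" "sin (angle w) = w $ 2"
    by (simp_all add: angle_def)
qed

lemma angle_near:
  assumes w0: "norm w0 = 1" and w: "norm w = 1" and pos: "0 < w0 \<bullet> w"
  shows "cos (angle_near w0 w) = w $ 1" "sin (angle_near w0 w) = w $ 2"
proof -
  define D where "D = w0 \<bullet> w"
  define N where "N = turn w0 w"
  have 1: "(w0 $ 1)\<^sup>2 + (w0 $ 2)\<^sup>2 = 1" "(w $ 1)\<^sup>2 + (w $ 2)\<^sup>2 = 1"
    using w0 w by (simp_all add: norm_eq_1 inner_real2 power2_eq_square)
  have "D\<^sup>2 + N\<^sup>2 = ((w0 $ 1)\<^sup>2 + (w0 $ 2)\<^sup>2) * ((w $ 1)\<^sup>2 + (w $ 2)\<^sup>2)"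
    by (simp add: D_def N_def inner_real2 power2_eq_square algebra_simps)
  then have DN: "D\<^sup>2 + N\<^sup>2 = 1" by (simp add: 1)
  have D: "0 < D" using pos by (simp add: D_def)
  have "1 + (N / D)\<^sup>2 = (1 / D)\<^sup>2"
    using D DN by (simp add: field_simps)
  then have s: "sqrt (1 + (N / D)\<^sup>2) = 1 / D"
    using D by simp
  have cs: "cos (arctan (N / D)) = D" "sin (arctan (N / D)) = N"
    using D by (simp_all add: cos_arctan sin_arctan s)
  have "D * w0 $ 1 - N * w0 $ 2 = ((w0 $ 1)\<^sup>2 + (w0 $ 2)\<^sup>2) * w $ 1"
    "D * w0 $ 2 + N * w0 $ 1 = ((w0 $ 1)\<^sup>2 + (w0 $ 2)\<^sup>2) * w $ 2"
    by (simp_all add: D_def N_def inner_real2 power2_eq_square algebra_simps)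
  then have "D * w0 $ 1 - N * w0 $ 2 = w $ 1" "D * w0 $ 2 + N * w0 $ 1 = w $ 2"
    by (simp_all add: 1)
  then show "cos (angle_near w0 w) = w $ 1" "sin (angle_near w0 w) = w $ 2"
    unfolding angle_near_def D_def[symmetric] N_def[symmetric]
    by (simp_all add: cos_add sin_add cs angle[OF w0] mult.commute)
qed

lemma angle_near_self: "angle_near w w = angle w"
  by (simp add: angle_near_def mult.commute)

lemma angle_near_differ:
  assumes "norm w0 = 1" "norm w = 1" "0 < w0 \<bullet> w"
  shows "\<exists>i::int. angle w = angle_near w0 w + 2 * pi * of_int i"
  using angle[OF assms(2)] angle_near[OF assms] sin_cos_eq_iff[of "angle w" "angle_near w0 w"] by auto

lemma open_turn_domain: "open {p :: 'a::real_normed_vector \<times> 'b::real_normed_vector \<times> (real^2). 0 < w0 \<bullet> snd (snd p)}"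
  by (intro open_Collect_less continuous_intros)

lemma smooth_angle_near:
  "smooth_on (\<lambda>p :: 'a::real_normed_vector \<times> 'b::real_normed_vector \<times> (real^2). angle_near w0 (snd (snd p)))
    {p. 0 < w0 \<bullet> snd (snd p)}"
proof -
  let ?U = "{p :: 'a \<times> 'b \<times> (real^2). 0 < w0 \<bullet> snd (snd p)}"
  note U = open_turn_domain[of w0]
  have nth: "smooth_on (\<lambda>p :: 'a \<times> 'b \<times> (real^2). snd (snd p) $ i) ?U" for i
    by (rule smooth_on_linear[OF _ U smooth_on_ident[OF U]])
      (intro bounded_linear_compose[OF bounded_linear_vec_nth] bounded_linear_compose[OF bounded_linear_snd] bounded_linear_snd)
  have inner: "smooth_on (\<lambda>p :: 'a \<times> 'b \<times> (real^2). w0 \<bullet> snd (snd p)) ?U"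
    by (rule smooth_on_linear[OF _ U smooth_on_ident[OF U]])
      (intro bounded_linear_compose[OF bounded_linear_inner_right] bounded_linear_compose[OF bounded_linear_snd] bounded_linear_snd)
  have "smooth_on (\<lambda>p :: 'a \<times> 'b \<times> (real^2). turn w0 (snd (snd p)) / (w0 \<bullet> snd (snd p))) ?U"
    by (intro smooth_on_divide smooth_on_diff smooth_on_mult smooth_on_const U nth inner) auto
  then have "smooth_on (\<lambda>p :: 'a \<times> 'b \<times> (real^2). arctan (turn w0 (snd (snd p)) / (w0 \<bullet> snd (snd p)))) ?U"
    by (rule smooth_on_compose_real[OF U smooth_on_arctan[OF open_UNIV]]) auto
  then show ?thesis
    unfolding angle_near_def by (intro smooth_on_add smooth_on_const U)
qed

lemma angle_near_derivative:
  fixes x :: "'a::real_normed_vector" and y :: "'b::real_normed_vector"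
  assumes "norm w = 1"
  shows "((\<lambda>p. angle_near w (snd (snd p)))
    has_derivative (\<lambda>v. turn w (snd (snd v)))) (at (x, y, w))"
proof -
  have ww: "w \<bullet> w = 1" using assms by (simp add: norm_eq_1)
  have lin: "((\<lambda>p. l (snd (snd p))) has_derivative (\<lambda>v. l (snd (snd v)))) (at (x, y, w))"
    if "bounded_linear l" for l :: "real^2 \<Rightarrow> real"
    by (intro bounded_linear_imp_has_derivative bounded_linear_compose[OF that]
        bounded_linear_compose[OF bounded_linear_snd] bounded_linear_snd)
  have N: "((\<lambda>p. turn w (snd (snd p))) has_derivative (\<lambda>v. turn w (snd (snd v)))) (at (x, y, w))"
    by (rule lin) (intro bounded_linear_sub bounded_linear_const_mult bounded_linear_vec_nth)
  have D: "((\<lambda>p. w \<bullet> snd (snd p)) has_derivative (\<lambda>v. w \<bullet> snd (snd v))) (at (x, y, w))"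
    by (rule lin[OF bounded_linear_inner_right])
  have "((\<lambda>p. turn w (snd (snd p)) / (w \<bullet> snd (snd p))) has_derivative (\<lambda>v. turn w (snd (snd v)))) (at (x, y, w))"
    by (rule has_derivative_eq_rhs[OF has_derivative_divide'[OF N D]]) (auto simp: ww mult.commute)
  moreover have "(arctan has_derivative (\<lambda>r. r)) (at (turn w w / (w \<bullet> w)))"
    using has_derivative_eq_rhs[OF DERIV_arctan[of 0, unfolded has_field_derivative_def], of "\<lambda>r. r"]
    by (simp add: mult.commute fun_eq_iff)
  ultimately have "((\<lambda>p. arctan (turn w (snd (snd p)) / (w \<bullet> snd (snd p)))) has_derivative (\<lambda>v. turn w (snd (snd v)))) (at (x, y, w))"
    using has_derivative_compose[of "\<lambda>p. turn w (snd (snd p)) / (w \<bullet> snd (snd p))" _ "(x, y, w)" UNIV arctan "\<lambda>r. r"]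
    by simp
  from has_derivative_add[OF has_derivative_const[of "angle w"] this] show ?thesis
    unfolding angle_near_def by simp
qed

lemma periodic_int:
  fixes g :: "real \<Rightarrow> 'a"
  assumes "\<And>t. g (t + T) = g t"
  shows "g (t + of_int i * T) = g t"
proof -
  have nat: "g (t + real j * T) = g t" for j t
  proof (induction j)
    case (Suc j)
    have *: "t + real (Suc j) * T = (t + real j * T) + T" by (simp add: algebra_simps)
    show ?case unfolding * assms by (rule Suc)
  qed simp
  show ?thesis
    using nat[of t "nat i"] nat[of "t + of_int i * T" "nat (- i)"] by (cases "0 \<le> i") auto
qed

section \<open>Lifting a periodic curve to the product of spheres\<close>

locale rotation_frame =
  fixes J :: "(real^'n) \<times> (real^'n) \<times> real \<Rightarrow> 'b::euclidean_space" and T :: real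
  assumes J: "linear J" and J_inner: "J p \<bullet> J q = p \<bullet> q" and T: "0 < T"
begin

lemma J_bounded: "bounded_linear J"
  using J by (simp add: linear_conv_bounded_linear)

text \<open>Scales the angle so that one turn of the circle factor runs through one period.\<close>

definition "\<kappa> = T / (2 * pi)"

definition lift :: "(real \<Rightarrow> real) \<Rightarrow> (real \<Rightarrow> real) \<Rightarrow> (real \<Rightarrow> real) \<Rightarrow> (real^'n) \<times> (real^'n) \<times> (real^2) \<Rightarrow> 'b"
  where "lift g1 g2 g3 = (\<lambda>(x, y, w).
    J (g1 (\<kappa> * angle w) *\<^sub>R x, g2 (\<kappa> * angle w) *\<^sub>R y, g3 (\<kappa> * angle w)))"

definition lift_near :: "real^2 \<Rightarrow> (real \<Rightarrow> real) \<Rightarrow> (real \<Rightarrow> real) \<Rightarrow> (real \<Rightarrow> real) \<Rightarrow> (real^'n) \<times> (real^'n) \<times> (real^2) \<Rightarrow> 'b"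
  where "lift_near w0 g1 g2 g3 = (\<lambda>p. let s = \<kappa> * angle_near w0 (snd (snd p)) in
    J (g1 s *\<^sub>R fst p, g2 s *\<^sub>R fst (snd p), g3 s))"

text \<open>The two choices of angle differ by a multiple of \<open>2 * pi\<close>, which
  \<open>\<kappa>\<close> turns into a multiple of \<open>T\<close>. Locally the lift is therefore
  given by a smooth formula.\<close>

lemma lift_near_eq:
  assumes per: "\<And>t. g1 (t + T) = g1 t" "\<And>t. g2 (t + T) = g2 t" "\<And>t. g3 (t + T) = g3 t"
    and w0: "norm w0 = 1" and p: "p \<in> sphere_product \<inter> {p. 0 < w0 \<bullet> snd (snd p)}"
  shows "lift_near w0 g1 g2 g3 p = lift g1 g2 g3 p"
proof -
  obtain x y w where p': "p = (x, y, w)" by (cases p)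
  have w: "norm w = 1" "0 < w0 \<bullet> w" using p by (auto simp: p' sphere_product_def)
  obtain i :: int where i: "angle w = angle_near w0 w + 2 * pi * of_int i"
    using angle_near_differ[OF w0 w] by blast
  have "\<kappa> * angle w = \<kappa> * angle_near w0 w + of_int i * T"
    by (simp add: i \<kappa>_def field_simps)
  then show ?thesis
    using periodic_int[of g1, OF per(1)] periodic_int[of g2, OF per(2)] periodic_int[of g3, OF per(3)]
    by (simp add: p' lift_near_def lift_def Let_def)
qed

lemma lift_near_smooth:
  assumes "smooth_on g1 UNIV" "smooth_on g2 UNIV" "smooth_on g3 UNIV"
  shows "smooth_on (lift_near w0 g1 g2 g3) {p. 0 < w0 \<bullet> snd (snd p)}"
proof -
  let ?U = "{p :: (real^'n) \<times> (real^'n) \<times> (real^2). 0 < w0 \<bullet> snd (snd p)}"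
  note U = open_turn_domain[of w0]
  have s: "smooth_on (\<lambda>p. \<kappa> * angle_near w0 (snd (snd p))) ?U"
    by (intro smooth_on_mult smooth_on_const smooth_angle_near U)
  have g: "smooth_on (\<lambda>p. g (\<kappa> * angle_near w0 (snd (snd p)))) ?U" if "smooth_on g UNIV" for g :: "real \<Rightarrow> real"
    by (rule smooth_on_compose_real[OF U that s]) simp
  have "smooth_on (\<lambda>p :: (real^'n) \<times> (real^'n) \<times> (real^2). fst p) ?U"
    "smooth_on (\<lambda>p :: (real^'n) \<times> (real^'n) \<times> (real^2). fst (snd p)) ?U"
    by (rule smooth_on_linear[OF _ U smooth_on_ident[OF U]],
        intro bounded_linear_fst bounded_linear_compose[OF bounded_linear_fst] bounded_linear_snd)+
  then show ?thesis
    unfolding lift_near_def Let_def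
    by (intro smooth_on_linear[OF J_bounded] smooth_on_Pair smooth_on_scaleR g assms U)
qed

lemma lift_smooth:
  assumes "smooth_on g1 UNIV" "smooth_on g2 UNIV" "smooth_on g3 UNIV"
    and per: "\<And>t. g1 (t + T) = g1 t" "\<And>t. g2 (t + T) = g2 t" "\<And>t. g3 (t + T) = g3 t"
  shows "smooth_map_on sphere_product (lift g1 g2 g3)"
  unfolding smooth_map_on_def
proof
  fix p :: "(real^'n) \<times> (real^'n) \<times> (real^2)" assume p: "p \<in> sphere_product"
  define w where "w = snd (snd p)"
  have w: "norm w = 1" using p by (auto simp: sphere_product_def w_def)
  then have "0 < w \<bullet> w" by (simp add: norm_eq_1)
  then show "\<exists>U g. open U \<and> p \<in> U \<and> smooth_on g U \<and> (\<forall>x\<in>sphere_product \<inter> U. g x = lift g1 g2 g3 x)"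
    using lift_near_eq[of g1 g2 g3 w, OF per w] lift_near_smooth[OF assms(1-3)] open_turn_domain[of w]
    by (intro exI[of _ "{p. 0 < w \<bullet> snd (snd p)}"] exI[of _ "lift_near w g1 g2 g3"]) (auto simp: w_def)
qed

lemma lift_differential:
  assumes d: "\<And>t. (g1 has_real_derivative g1' t) (at t)" "\<And>t. (g2 has_real_derivative g2' t) (at t)"
      "\<And>t. (g3 has_real_derivative g3' t) (at t)"
    and per: "\<And>t. g1 (t + T) = g1 t" "\<And>t. g2 (t + T) = g2 t" "\<And>t. g3 (t + T) = g3 t"
    and p: "(x, y, w) \<in> sphere_product"
  defines "s \<equiv> \<kappa> * angle w"
  shows "linear (differential sphere_product (lift g1 g2 g3) (x, y, w))"
    and "(a, b, c) \<in> tangent_space sphere_product (x, y, w) \<Longrightarrow>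
      differential sphere_product (lift g1 g2 g3) (x, y, w) (a, b, c) =
        J (g1 s *\<^sub>R a + (\<kappa> * turn w c * g1' s) *\<^sub>R x, g2 s *\<^sub>R b + (\<kappa> * turn w c * g2' s) *\<^sub>R y, \<kappa> * turn w c * g3' s)"
proof -
  have w: "norm w = 1" using p by (auto simp: sphere_product_def)
  then have ww: "0 < w \<bullet> w" by (simp add: norm_eq_1)
  let ?P = "(x, y, w)"
  have an: "((\<lambda>p :: (real^'n) \<times> (real^'n) \<times> (real^2). \<kappa> * angle_near w (snd (snd p))) has_derivative (\<lambda>v. \<kappa> * turn w (snd (snd v)))) (at ?P)"
    by (rule has_derivative_mult_right[OF angle_near_derivative[OF w]])
  have g: "((\<lambda>p. g (\<kappa> * angle_near w (snd (snd p)))) has_derivative (\<lambda>v. \<kappa> * turn w (snd (snd v)) * g' s)) (at ?P)"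
    if "\<And>t. (g has_real_derivative g' t) (at t)" for g g'
  proof -
    have "(g has_derivative (\<lambda>r. r * g' s)) (at (\<kappa> * angle_near w (snd (snd ?P))))"
      using has_derivative_eq_rhs[OF that[of s, unfolded has_field_derivative_def], of "\<lambda>r. r * g' s"]
      by (simp add: angle_near_self s_def mult.commute fun_eq_iff)
    from has_derivative_compose[OF an this] show ?thesis .
  qed
  have "((\<lambda>p. J (g1 (\<kappa> * angle_near w (snd (snd p))) *\<^sub>R fst p, g2 (\<kappa> * angle_near w (snd (snd p))) *\<^sub>R fst (snd p), g3 (\<kappa> * angle_near w (snd (snd p)))))
     has_derivative (\<lambda>v. J (g1 (\<kappa> * angle_near w (snd (snd ?P))) *\<^sub>R fst v + (\<kappa> * turn w (snd (snd v)) * g1' s) *\<^sub>R fst ?P,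
        g2 (\<kappa> * angle_near w (snd (snd ?P))) *\<^sub>R fst (snd v) + (\<kappa> * turn w (snd (snd v)) * g2' s) *\<^sub>R fst (snd ?P),
        \<kappa> * turn w (snd (snd v)) * g3' s))) (at ?P)"
    by (intro bounded_linear.has_derivative[OF J_bounded] has_derivative_Pair has_derivative_scaleR g d
        bounded_linear.has_derivative[OF bounded_linear_fst] bounded_linear.has_derivative[OF bounded_linear_snd] has_derivative_ident)
  then have D: "(lift_near w g1 g2 g3 has_derivative
      (\<lambda>v. J (g1 s *\<^sub>R fst v + (\<kappa> * turn w (snd (snd v)) * g1' s) *\<^sub>R x,
        g2 s *\<^sub>R fst (snd v) + (\<kappa> * turn w (snd (snd v)) * g2' s) *\<^sub>R y,
        \<kappa> * turn w (snd (snd v)) * g3' s))) (at ?P)"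
    by (simp only: lift_near_def Let_def s_def fst_conv snd_conv angle_near_self)
  note * = differential_eq[OF p open_turn_domain[of w] _ D lift_near_eq[of g1 g2 g3 w, OF per w]]
  have P: "?P \<in> {p. 0 < w \<bullet> snd (snd p)}" using ww by simp
  show "linear (differential sphere_product (lift g1 g2 g3) (x, y, w))"
    using *(1)[OF P] by (blast intro: has_derivative_linear)
  show "(a, b, c) \<in> tangent_space sphere_product (x, y, w) \<Longrightarrow>
      differential sphere_product (lift g1 g2 g3) (x, y, w) (a, b, c) =
        J (g1 s *\<^sub>R a + (\<kappa> * turn w c * g1' s) *\<^sub>R x, g2 s *\<^sub>R b + (\<kappa> * turn w c * g2' s) *\<^sub>R y, \<kappa> * turn w c * g3' s)"
    using *(2)[OF P] by simp
qed

end

section \<open>Rotational minimal immersions\<close>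

text \<open>\<open>c\<close> is a curve in the unit two-sphere and \<open>n\<close> its unit normal
  there. Up to sign, \<open>minimal\<close> adds the principal curvatures: \<open>n1 / c1\<close>
  and \<open>n2 / c2\<close> on spheres of dimension \<open>CARD('n) - 1\<close>, and the curvature
  along the curve itself.\<close>

locale rotational_immersion = rotation_frame J T
  for J :: "(real^'n) \<times> (real^'n) \<times> real \<Rightarrow> 'b::euclidean_space" and T :: real +
  fixes c1 c2 c3 c1' c2' c3' n1 n2 n3 n1' n2' n3' :: "real \<Rightarrow> real"
  assumes c_smooth: "smooth_on c1 UNIV" "smooth_on c2 UNIV" "smooth_on c3 UNIV"
    and n_smooth: "smooth_on n1 UNIV" "smooth_on n2 UNIV" "smooth_on n3 UNIV"
    and c_per: "c1 (t + T) = c1 t" "c2 (t + T) = c2 t" "c3 (t + T) = c3 t"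
    and n_per: "n1 (t + T) = n1 t" "n2 (t + T) = n2 t" "n3 (t + T) = n3 t"
    and dc: "(c1 has_real_derivative c1' t) (at t)" "(c2 has_real_derivative c2' t) (at t)"
      "(c3 has_real_derivative c3' t) (at t)"
    and dn: "(n1 has_real_derivative n1' t) (at t)" "(n2 has_real_derivative n2' t) (at t)"
      "(n3 has_real_derivative n3' t) (at t)"
    and c_unit: "(c1 t)\<^sup>2 + (c2 t)\<^sup>2 + (c3 t)\<^sup>2 = 1"
    and n_unit: "(n1 t)\<^sup>2 + (n2 t)\<^sup>2 + (n3 t)\<^sup>2 = 1"
    and c_n: "n1 t * c1 t + n2 t * c2 t + n3 t * c3 t = 0"
    and n_dc: "n1 t * c1' t + n2 t * c2' t + n3 t * c3' t = 0"
    and c_pos: "0 < c1 t" "0 < c2 t"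
    and regular: "0 < (c1' t)\<^sup>2 + (c2' t)\<^sup>2 + (c3' t)\<^sup>2"
    and minimal: "(real CARD('n) - 1) * (n1 t / c1 t + n2 t / c2 t)
      + (n1' t * c1' t + n2' t * c2' t + n3' t * c3' t) / ((c1' t)\<^sup>2 + (c2' t)\<^sup>2 + (c3' t)\<^sup>2) = 0"
begin

abbreviation "f \<equiv> lift c1 c2 c3"
abbreviation "\<nu> \<equiv> lift n1 n2 n3"
abbreviation "df \<equiv> differential sphere_product f"
abbreviation "dnu \<equiv> differential sphere_product \<nu>"
abbreviation "TM \<equiv> tangent_space (sphere_product :: ((real^'n) \<times> (real^'n) \<times> (real^2)) set)"

lemma J_zero_iff: "J p = 0 \<longleftrightarrow> p = 0"
  using J_inner[of p p] by (metis inner_eq_zero_iff)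

lemma kappa_pos: "0 < \<kappa>"
  using T by (simp add: \<kappa>_def)

context
  fixes x y :: "real^'n" and w :: "real^2" and s :: real
  assumes p: "(x, y, w) \<in> sphere_product"
  defines "s \<equiv> \<kappa> * angle w"
begin

lemma norms: "x \<bullet> x = 1" "y \<bullet> y = 1" "w \<bullet> w = 1"
  using p by (auto simp: sphere_product_def norm_eq_1)

lemma tangent_iff: "(a, b, c) \<in> TM (x, y, w) \<longleftrightarrow> x \<bullet> a = 0 \<and> y \<bullet> b = 0 \<and> w \<bullet> c = 0"
  using tangent_space_sphere_product[OF p] by auto

lemma subspace_tangent: "subspace (TM (x, y, w))"
  unfolding tangent_space_sphere_product[OF p]
  by (auto simp: subspace_def inner_add_right zero_prod_def)

lemma df_linear: "linear (df (x, y, w))"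
  by (rule lift_differential(1)[of c1 c1' c2 c2' c3 c3' x y w, OF dc c_per p])

lemma df_eq: "(a, b, c) \<in> TM (x, y, w) \<Longrightarrow> df (x, y, w) (a, b, c) =
    J (c1 s *\<^sub>R a + (\<kappa> * turn w c * c1' s) *\<^sub>R x, c2 s *\<^sub>R b + (\<kappa> * turn w c * c2' s) *\<^sub>R y, \<kappa> * turn w c * c3' s)"
  unfolding s_def by (rule lift_differential(2)[of c1 c1' c2 c2' c3 c3' x y w a b c, OF dc c_per p])

lemma dnu_eq: "(a, b, c) \<in> TM (x, y, w) \<Longrightarrow> dnu (x, y, w) (a, b, c) =
    J (n1 s *\<^sub>R a + (\<kappa> * turn w c * n1' s) *\<^sub>R x, n2 s *\<^sub>R b + (\<kappa> * turn w c * n2' s) *\<^sub>R y, \<kappa> * turn w c * n3' s)"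
  unfolding s_def by (rule lift_differential(2)[of n1 n1' n2 n2' n3 n3' x y w a b c, OF dn n_per p])

lemma f_eq: "f (x, y, w) = J (c1 s *\<^sub>R x, c2 s *\<^sub>R y, c3 s)"
  by (simp add: lift_def s_def)

lemma nu_eq: "\<nu> (x, y, w) = J (n1 s *\<^sub>R x, n2 s *\<^sub>R y, n3 s)"
  by (simp add: lift_def s_def)

lemma f_unit: "norm (f (x, y, w)) = 1"
  using c_unit[of s] norms by (simp add: norm_eq_1 f_eq J_inner power2_eq_square)

lemma nu_unit: "norm (\<nu> (x, y, w)) = 1" and nu_f: "\<nu> (x, y, w) \<bullet> f (x, y, w) = 0"
  using n_unit[of s] c_n[of s] norms by (simp_all add: norm_eq_1 nu_eq f_eq J_inner power2_eq_square mult_ac add_ac)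

lemma nu_df: "v \<in> TM (x, y, w) \<Longrightarrow> \<nu> (x, y, w) \<bullet> df (x, y, w) v = 0"
proof -
  assume v: "v \<in> TM (x, y, w)"
  obtain a b c where v': "v = (a, b, c)" by (cases v)
  have t: "x \<bullet> a = 0" "y \<bullet> b = 0" using v tangent_iff by (auto simp: v')
  have "\<nu> (x, y, w) \<bullet> df (x, y, w) v = \<kappa> * turn w c * (n1 s * c1' s + n2 s * c2' s + n3 s * c3' s)"
    using v norms t by (simp add: v' df_eq nu_eq J_inner inner_add_right algebra_simps)
  then show ?thesis by (simp add: n_dc)
qed

lemma turn_zero:
  assumes "turn w c = 0" "w \<bullet> c = 0" shows "c = 0"
proof -
  have "(w \<bullet> w) * (c \<bullet> c) = (w \<bullet> c)\<^sup>2 + (turn w c)\<^sup>2"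
    by (simp add: inner_real2 power2_eq_square algebra_simps)
  then show ?thesis using assms norms by simp
qed

lemma df_inj: "inj_on (df (x, y, w)) (TM (x, y, w))"
proof (rule inj_onI)
  fix v v' assume v: "v \<in> TM (x, y, w)" "v' \<in> TM (x, y, w)" and eq: "df (x, y, w) v = df (x, y, w) v'"
  have d: "v - v' \<in> TM (x, y, w)" using subspace_diff[OF subspace_tangent] v by blast
  have z: "df (x, y, w) (v - v') = 0" using linear_diff[OF df_linear] eq by simp
  obtain a b c where v': "v - v' = (a, b, c)" by (cases "v - v'")
  have t: "x \<bullet> a = 0" "y \<bullet> b = 0" "w \<bullet> c = 0" using d tangent_iff by (auto simp: v')
  have "(c1 s *\<^sub>R a + (\<kappa> * turn w c * c1' s) *\<^sub>R x, c2 s *\<^sub>R b + (\<kappa> * turn w c * c2' s) *\<^sub>R y, \<kappa> * turn w c * c3' s) = 0"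
    using z d by (simp only: v' df_eq J_zero_iff)
  then have e: "c1 s *\<^sub>R a + (\<kappa> * turn w c * c1' s) *\<^sub>R x = 0" "c2 s *\<^sub>R b + (\<kappa> * turn w c * c2' s) *\<^sub>R y = 0"
      "\<kappa> * turn w c * c3' s = 0"
    by (simp_all add: zero_prod_def)
  \<comment> \<open>Pairing with \<open>x\<close> and \<open>y\<close> removes the sphere
    components. What is left is the profile velocity times \<open>turn w c\<close>, so
    \<open>regular\<close> forces \<open>turn w c = 0\<close>.\<close>
  from e(1,2) have "x \<bullet> (c1 s *\<^sub>R a + (\<kappa> * turn w c * c1' s) *\<^sub>R x) = 0" "y \<bullet> (c2 s *\<^sub>R b + (\<kappa> * turn w c * c2' s) *\<^sub>R y) = 0"
    by simp_all
  then have "\<kappa> * turn w c * c1' s = 0" "\<kappa> * turn w c * c2' s = 0"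
    using t norms by (simp_all add: inner_add_right)
  then have "turn w c = 0"
    using e(3) regular[of s] kappa_pos by auto
  then have "c = 0" using turn_zero t(3) by blast
  moreover have "a = 0" "b = 0" using e(1,2) \<open>turn w c = 0\<close> c_pos[of s] by auto
  ultimately have "v - v' = 0" by (simp add: v' zero_prod_def)
  then show "v = v'" by simp
qed

text \<open>\<open>mean_curvature\<close> picks its basis by \<open>SOME\<close>, which says nothing
  unless such a basis exists. One is obtained by pulling back an orthonormal basis of the image of
  the tangent space along the injective differential.\<close>

lemma basis_exists: "\<exists>B. induced_orthonormal_basis sphere_product f (x, y, w) B"
proof -
  let ?D = "df (x, y, w)" and ?T = "TM (x, y, w)"
  have sub: "subspace (?D ` ?T)" by (rule linear_subspace_image[OF df_linear subspace_tangent])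
  obtain B' where B': "B' \<subseteq> ?D ` ?T" "span B' = ?D ` ?T"
    "\<And>u v. u \<in> B' \<Longrightarrow> v \<in> B' \<Longrightarrow> u \<bullet> v = (if u = v then 1 else 0)"
    using orthonormal_basis_exists[OF sub] by metis
  define B where "B = inv_into ?T ?D ` B'"
  have BT: "B \<subseteq> ?T" using B'(1) by (auto simp: B_def intro!: inv_into_into)
  have DB: "?D ` B = B'" using B'(1) by (force simp: B_def image_image f_inv_into_f)
  have "span B \<subseteq> ?T" using BT subspace_tangent by (rule span_minimal)
  moreover have "?T \<subseteq> span B"
  proof
    fix v assume v: "v \<in> ?T"
    have "?D v \<in> ?D ` span B"
      using v B'(2) by (simp add: linear_span_image[OF df_linear, symmetric] DB)
    then obtain v' where v': "v' \<in> span B" "?D v = ?D v'" by blast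
    then have "v' \<in> ?T" using \<open>span B \<subseteq> ?T\<close> by blast
    then have "v = v'" by (rule inj_onD[OF df_inj v'(2) v])
    then show "v \<in> span B" using v'(1) by simp
  qed
  moreover have "?D u \<bullet> ?D v = (if u = v then 1 else 0)" if "u \<in> B" "v \<in> B" for u v
  proof -
    have "?D u = ?D v \<longleftrightarrow> u = v" using df_inj that BT by (meson inj_on_eq_iff subsetD)
    then show ?thesis using B'(3)[of "?D u" "?D v"] DB that by auto
  qed
  ultimately have "induced_orthonormal_basis sphere_product f (x, y, w) B"
    using BT by (auto simp: induced_orthonormal_basis_def)
  then show ?thesis ..
qed

section \<open>The trace in an arbitrary induced orthonormal basis\<close>

context
  fixes B
  assumes B: "induced_orthonormal_basis sphere_product f (x, y, w) B"
begin

lemma B_tangent: "e \<in> B \<Longrightarrow> e \<in> TM (x, y, w)"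
  and B_span: "span B = TM (x, y, w)"
  and B_orth: "u \<in> B \<Longrightarrow> v \<in> B \<Longrightarrow> df (x, y, w) u \<bullet> df (x, y, w) v = (if u = v then 1 else 0)"
  using B by (auto simp: induced_orthonormal_basis_def)

lemma B_inj: "inj_on (df (x, y, w)) B"
  using df_inj B_tangent by (meson inj_on_subset subsetI)

lemma B_image_orth:
  "u \<in> df (x, y, w) ` B \<Longrightarrow> v \<in> df (x, y, w) ` B \<Longrightarrow> u \<bullet> v = (if u = v then 1 else 0)"
  using B_orth B_inj by (auto simp: inj_on_eq_iff)

lemma B_finite: "finite B"
  using finite_orthonormal[OF B_image_orth] finite_imageD[OF _ B_inj] by blast

lemma B_parseval:
  assumes "v \<in> TM (x, y, w)"
  shows "(\<Sum>e\<in>B. (df (x, y, w) e \<bullet> df (x, y, w) v)\<^sup>2) = df (x, y, w) v \<bullet> df (x, y, w) v"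
proof -
  have "df (x, y, w) v \<in> span (df (x, y, w) ` B)"
    using assms by (simp add: linear_span_image[OF df_linear] B_span)
  from parseval_span[OF finite_imageI[OF B_finite] B_image_orth this]
  show ?thesis by (simp add: sum.reindex[OF B_inj])
qed

lemma df_inner:
  assumes "(a, b, c) \<in> TM (x, y, w)" "(a', b', c') \<in> TM (x, y, w)"
  shows "df (x, y, w) (a, b, c) \<bullet> df (x, y, w) (a', b', c') =
    (c1 s)\<^sup>2 * (a \<bullet> a') + (c2 s)\<^sup>2 * (b \<bullet> b')
      + \<kappa>\<^sup>2 * turn w c * turn w c' * ((c1' s)\<^sup>2 + (c2' s)\<^sup>2 + (c3' s)\<^sup>2)"
proof -
  have t: "x \<bullet> a = 0" "y \<bullet> b = 0" "x \<bullet> a' = 0" "y \<bullet> b' = 0" "a \<bullet> x = 0" "b \<bullet> y = 0"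
    using assms tangent_iff by (auto simp: inner_commute)
  show ?thesis
    unfolding df_eq[OF assms(1)] df_eq[OF assms(2)]
    by (simp add: J_inner inner_add_right inner_add_left t norms) (simp add: algebra_simps power2_eq_square)
qed

text \<open>The selected basis \<open>B\<close> need not respect the product structure. Expanding
  \<open>pr e\<close> in an orthonormal basis \<open>K\<close> of the hyperplane orthogonal to
  \<open>z\<close> and swapping the sums, Parseval for \<open>B\<close> shows that each element of
  \<open>K\<close> contributes 1.\<close>

lemma trace_sphere:
  fixes z :: "real^'n" and emb :: "real^'n \<Rightarrow> _" and pr :: "_ \<Rightarrow> real^'n" and r :: real
  assumes emb: "\<And>a. z \<bullet> a = 0 \<Longrightarrow> emb a \<in> TM (x, y, w)"
    and pr: "\<And>e a. e \<in> B \<Longrightarrow> z \<bullet> a = 0 \<Longrightarrow> df (x, y, w) e \<bullet> df (x, y, w) (emb a) = r\<^sup>2 * (pr e \<bullet> a)"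
    and pr_emb: "\<And>a. z \<bullet> a = 0 \<Longrightarrow> df (x, y, w) (emb a) \<bullet> df (x, y, w) (emb a) = r\<^sup>2 * (a \<bullet> a)"
    and pr_perp: "\<And>e. e \<in> B \<Longrightarrow> z \<bullet> pr e = 0"
    and z: "z \<bullet> z = 1" and r: "0 < r"
  shows "(\<Sum>e\<in>B. r\<^sup>2 * (pr e \<bullet> pr e)) = real CARD('n) - 1"
proof -
  have "z \<noteq> 0" using z by auto
  obtain K where K: "finite K" "K \<subseteq> {a. z \<bullet> a = 0}" "span K = {a. z \<bullet> a = 0}" "card K = dim {a. z \<bullet> a = 0}"
    "\<And>u v. u \<in> K \<Longrightarrow> v \<in> K \<Longrightarrow> u \<bullet> v = (if u = v then 1 else 0)"
    by (rule orthonormal_basis_exists[OF subspace_hyperplane[of z]], rule that)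
  have card: "real (card K) = real CARD('n) - 1"
    using dim_hyperplane[OF \<open>z \<noteq> 0\<close>] K(4) by (simp add: of_nat_diff Suc_leI)
  have "(\<Sum>e\<in>B. r\<^sup>2 * (pr e \<bullet> pr e)) = (\<Sum>e\<in>B. \<Sum>a\<in>K. r\<^sup>2 * (pr e \<bullet> a)\<^sup>2)"
  proof (rule sum.cong[OF refl])
    fix e assume "e \<in> B"
    then have "pr e \<in> span K" using pr_perp K(3) by simp
    from parseval_span[OF K(1) K(5) this]
    have "pr e \<bullet> pr e = (\<Sum>a\<in>K. (pr e \<bullet> a)\<^sup>2)" by (simp add: inner_commute)
    then show "r\<^sup>2 * (pr e \<bullet> pr e) = (\<Sum>a\<in>K. r\<^sup>2 * (pr e \<bullet> a)\<^sup>2)"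
      by (simp add: sum_distrib_left)
  qed
  also have "\<dots> = (\<Sum>a\<in>K. \<Sum>e\<in>B. r\<^sup>2 * (pr e \<bullet> a)\<^sup>2)"
    by (rule sum.swap)
  also have "\<dots> = (\<Sum>a\<in>K. 1)"
  proof (rule sum.cong[OF refl])
    fix a assume a: "a \<in> K"
    have za: "z \<bullet> a = 0" using a K(2) by blast
    have "(\<Sum>e\<in>B. (r\<^sup>2 * (pr e \<bullet> a))\<^sup>2) = r\<^sup>2 * (a \<bullet> a)"
      using B_parseval[OF emb[OF za]] pr za pr_emb[OF za] by simp
    then have "r\<^sup>2 * (\<Sum>e\<in>B. r\<^sup>2 * (pr e \<bullet> a)\<^sup>2) = r\<^sup>2 * 1"
      using K(5)[OF a a] by (simp add: sum_distrib_left power_mult_distrib power2_eq_square mult_ac)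
    then show "(\<Sum>e\<in>B. r\<^sup>2 * (pr e \<bullet> a)\<^sup>2) = 1" using r by simp
  qed
  finally show ?thesis using card by simp
qed

lemma trace_first: "(\<Sum>(a, b, c)\<in>B. (c1 s)\<^sup>2 * (a \<bullet> a)) = real CARD('n) - 1"
proof -
  have "(\<Sum>e\<in>B. (c1 s)\<^sup>2 * (fst e \<bullet> fst e)) = real CARD('n) - 1"
  proof (rule trace_sphere[where z = x and emb = "\<lambda>a. (a, 0, 0)"])
    show emb: "(a, 0, 0) \<in> TM (x, y, w)" if "x \<bullet> a = 0" for a using that tangent_iff by simp
    show "df (x, y, w) e \<bullet> df (x, y, w) (a, 0, 0) = (c1 s)\<^sup>2 * (fst e \<bullet> a)" if "e \<in> B" "x \<bullet> a = 0" for e a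
      using df_inner[of "fst e" "fst (snd e)" "snd (snd e)", OF _ emb[OF that(2)]] B_tangent[OF that(1)] by simp
    show "df (x, y, w) (a, 0, 0) \<bullet> df (x, y, w) (a, 0, 0) = (c1 s)\<^sup>2 * (a \<bullet> a)" if "x \<bullet> a = 0" for a
      using df_inner[OF emb[OF that] emb[OF that]] by simp
    show "x \<bullet> fst e = 0" if "e \<in> B" for e
      using B_tangent[OF that] tangent_iff[of "fst e" "fst (snd e)" "snd (snd e)"] by simp
  qed (use norms c_pos in auto)
  then show ?thesis by (simp add: case_prod_beta)
qed

lemma trace_second: "(\<Sum>(a, b, c)\<in>B. (c2 s)\<^sup>2 * (b \<bullet> b)) = real CARD('n) - 1"
proof -
  have "(\<Sum>e\<in>B. (c2 s)\<^sup>2 * (fst (snd e) \<bullet> fst (snd e))) = real CARD('n) - 1"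
  proof (rule trace_sphere[where z = y and emb = "\<lambda>b. (0, b, 0)"])
    show emb: "(0, b, 0) \<in> TM (x, y, w)" if "y \<bullet> b = 0" for b using that tangent_iff by simp
    show "df (x, y, w) e \<bullet> df (x, y, w) (0, b, 0) = (c2 s)\<^sup>2 * (fst (snd e) \<bullet> b)" if "e \<in> B" "y \<bullet> b = 0" for e b
      using df_inner[of "fst e" "fst (snd e)" "snd (snd e)", OF _ emb[OF that(2)]] B_tangent[OF that(1)] by simp
    show "df (x, y, w) (0, b, 0) \<bullet> df (x, y, w) (0, b, 0) = (c2 s)\<^sup>2 * (b \<bullet> b)" if "y \<bullet> b = 0" for b
      using df_inner[OF emb[OF that] emb[OF that]] by simp
    show "y \<bullet> fst (snd e) = 0" if "e \<in> B" for e
      using B_tangent[OF that] tangent_iff[of "fst e" "fst (snd e)" "snd (snd e)"] by simp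
  qed (use norms c_pos in auto)
  then show ?thesis by (simp add: case_prod_beta)
qed

lemma trace_third: "(\<Sum>(a, b, c)\<in>B. \<kappa>\<^sup>2 * (turn w c)\<^sup>2) * ((c1' s)\<^sup>2 + (c2' s)\<^sup>2 + (c3' s)\<^sup>2) = 1"
proof -
  define N where "N = (c1' s)\<^sup>2 + (c2' s)\<^sup>2 + (c3' s)\<^sup>2"
  \<comment> \<open>\<open>w\<close> turned by a right angle: the tangent vector of the circle with
    \<open>turn w c = 1\<close>.\<close>
  define c :: "real^2" where "c = (\<chi> i. if i = 1 then - w $ 2 else w $ 1)"
  have c: "c $ 1 = - w $ 2" "c $ 2 = w $ 1" by (simp_all add: c_def)
  have tc: "turn w c = 1" using norms(3) by (simp add: c inner_real2)
  have emb: "(0, 0, c) \<in> TM (x, y, w)" by (simp add: tangent_iff inner_real2 c)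
  have "df (x, y, w) e \<bullet> df (x, y, w) (0, 0, c) = \<kappa>\<^sup>2 * turn w (snd (snd e)) * N" if "e \<in> B" for e
    using df_inner[of "fst e" "fst (snd e)" "snd (snd e)", OF _ emb] B_tangent[OF that] tc by (simp add: N_def)
  moreover have "df (x, y, w) (0, 0, c) \<bullet> df (x, y, w) (0, 0, c) = \<kappa>\<^sup>2 * N"
    using df_inner[OF emb emb] tc by (simp add: N_def)
  ultimately have "(\<Sum>e\<in>B. (\<kappa>\<^sup>2 * turn w (snd (snd e)) * N)\<^sup>2) = \<kappa>\<^sup>2 * N"
    using B_parseval[OF emb] by simp
  moreover have "(\<Sum>e\<in>B. (\<kappa>\<^sup>2 * turn w (snd (snd e)) * N)\<^sup>2) = \<kappa>\<^sup>2 * N * ((\<Sum>e\<in>B. \<kappa>\<^sup>2 * (turn w (snd (snd e)))\<^sup>2) * N)"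
    unfolding sum_distrib_left sum_distrib_right by (simp add: power2_eq_square mult_ac)
  moreover have "\<kappa>\<^sup>2 * N \<noteq> 0" using kappa_pos regular[of s] by (simp add: N_def)
  ultimately have "(\<Sum>e\<in>B. \<kappa>\<^sup>2 * (turn w (snd (snd e)))\<^sup>2) * N = 1"
    by simp
  then show ?thesis by (simp add: N_def case_prod_beta)
qed

text \<open>On each of the three blocks the second fundamental form is a multiple of the induced
  metric, so the three traces reduce the sum to \<open>minimal\<close>.\<close>

lemma trace_zero: "(\<Sum>e\<in>B. second_fundamental_form sphere_product f \<nu> (x, y, w) e e) = 0"
proof -
  define N where "N = (c1' s)\<^sup>2 + (c2' s)\<^sup>2 + (c3' s)\<^sup>2"
  define H where "H = n1' s * c1' s + n2' s * c2' s + n3' s * c3' s"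
  have N: "0 < N" using regular by (simp add: N_def)
  have h: "second_fundamental_form sphere_product f \<nu> (x, y, w) (a, b, c) (a, b, c) =
      - (n1 s / c1 s * ((c1 s)\<^sup>2 * (a \<bullet> a)) + n2 s / c2 s * ((c2 s)\<^sup>2 * (b \<bullet> b)) + H * (\<kappa>\<^sup>2 * (turn w c)\<^sup>2))"
    if "(a, b, c) \<in> B" for a b c
  proof -
    note T = B_tangent[OF that]
    have t: "x \<bullet> a = 0" "y \<bullet> b = 0" "a \<bullet> x = 0" "b \<bullet> y = 0"
      using T tangent_iff by (auto simp: inner_commute)
    have "n1 s / c1 s * ((c1 s)\<^sup>2 * (a \<bullet> a)) = n1 s * c1 s * (a \<bullet> a)"
      "n2 s / c2 s * ((c2 s)\<^sup>2 * (b \<bullet> b)) = n2 s * c2 s * (b \<bullet> b)"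
      using c_pos[of s] by (simp_all add: power2_eq_square)
    then show ?thesis
      unfolding second_fundamental_form_def df_eq[OF T] dnu_eq[OF T] H_def
      by (simp add: J_inner inner_add_right inner_add_left t norms) (simp add: algebra_simps power2_eq_square)
  qed
  have "(\<Sum>e\<in>B. second_fundamental_form sphere_product f \<nu> (x, y, w) e e) =
      (\<Sum>(a, b, c)\<in>B. - (n1 s / c1 s * ((c1 s)\<^sup>2 * (a \<bullet> a)) + n2 s / c2 s * ((c2 s)\<^sup>2 * (b \<bullet> b)) + H * (\<kappa>\<^sup>2 * (turn w c)\<^sup>2)))"
    by (rule sum.cong) (use h in auto)
  also have "\<dots> = - (n1 s / c1 s * (\<Sum>(a, b, c)\<in>B. (c1 s)\<^sup>2 * (a \<bullet> a)) + n2 s / c2 s * (\<Sum>(a, b, c)\<in>B. (c2 s)\<^sup>2 * (b \<bullet> b))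
      + H * (\<Sum>(a, b, c)\<in>B. \<kappa>\<^sup>2 * (turn w c)\<^sup>2))"
    unfolding case_prod_beta sum_distrib_left sum_negf sum.distrib ..
  also have "(\<Sum>(a, b, c)\<in>B. \<kappa>\<^sup>2 * (turn w c)\<^sup>2) = 1 / N"
    using trace_third N by (simp add: N_def[symmetric] eq_divide_eq)
  finally have "(\<Sum>e\<in>B. second_fundamental_form sphere_product f \<nu> (x, y, w) e e) =
      - ((real CARD('n) - 1) * (n1 s / c1 s + n2 s / c2 s) + H / N)"
    unfolding trace_first trace_second by (simp add: algebra_simps)
  then show ?thesis using minimal[of s] by (simp add: H_def N_def)
qed

end

lemma mean_curvature_zero: "mean_curvature sphere_product f \<nu> (x, y, w) = 0"
  unfolding mean_curvature_def using trace_zero[OF someI_ex[OF basis_exists]] .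

end

lemma minimal_immersion: "minimal_immersion_in_sphere sphere_product f"
  unfolding minimal_immersion_in_sphere_def smooth_immersion_def
proof (intro conjI ballI)
  show "smooth_map_on sphere_product f"
    by (rule lift_smooth[of c1 c2 c3, OF c_smooth c_per])
  show "inj_on (df p) (TM p)" if "p \<in> sphere_product" for p
    using df_inj that by (cases p) auto
  show "f ` sphere_product \<subseteq> sphere 0 1"
    using f_unit by auto
  have "unit_normal_field sphere_product f \<nu>"
    unfolding unit_normal_field_def
  proof (intro conjI ballI)
    show "smooth_map_on sphere_product \<nu>"
      by (rule lift_smooth[of n1 n2 n3, OF n_smooth n_per])
  qed (use nu_unit nu_f nu_df in auto)
  moreover have "mean_curvature sphere_product f \<nu> q = 0" if "q \<in> sphere_product" for q
    using mean_curvature_zero that by (cases q) auto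
  ultimately show "\<exists>U \<nu>. open U \<and> p \<in> U \<and> unit_normal_field (sphere_product \<inter> U) f \<nu> \<and>
       (\<forall>q\<in>sphere_product \<inter> U. mean_curvature (sphere_product \<inter> U) f \<nu> q = 0)" for p
    by (intro exI[of _ UNIV] exI[of _ \<nu>]) auto
qed

end

section \<open>The profile curve in the two-sphere and its normal\<close>

context closed_profile
begin

abbreviation "\<rho> t \<equiv> 1 / cosh (u t)"
abbreviation "z t \<equiv> tanh (u t)"
abbreviation "\<alpha> t \<equiv> b t + pi / 4"
abbreviation "C t \<equiv> cos (2 * b t)"

definition "c1 t = \<rho> t * cos (\<alpha> t)"
definition "c2 t = \<rho> t * sin (\<alpha> t)"
definition "c3 t = z t"
definition "n1 t = z t * sin (h t) * cos (\<alpha> t) - cos (h t) * sin (\<alpha> t)"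
definition "n2 t = z t * sin (h t) * sin (\<alpha> t) + cos (h t) * cos (\<alpha> t)"
definition "n3 t = - \<rho> t * sin (h t)"

text \<open>\<open>(\<tau>1, \<tau>2, \<tau>3)\<close> is the unit tangent of the profile curve in the two-sphere, with normal
  \<open>(n1, n2, n3)\<close>; the speed is \<open>\<rho> * C\<close>, and \<open>bend\<close> is the geodesic curvature times the speed.\<close>

definition "\<tau>1 t = - (z t * cos (h t) * cos (\<alpha> t) + sin (h t) * sin (\<alpha> t))"
definition "\<tau>2 t = - (z t * cos (h t) * sin (\<alpha> t) - sin (h t) * cos (\<alpha> t))"
definition "\<tau>3 t = \<rho> t * cos (h t)"
definition "bend t = 2 * real m * (z t * sin (h t) * C t - sin (2 * b t) * cos (h t))"

lemma sech_tanh: "\<rho> t * \<rho> t = 1 - z t * z t"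
proof -
  have "1 / c * (1 / c) = 1 - s / c * (s / c)" if "c * c = s * s + 1" "c \<noteq> 0" for s c :: real
  proof -
    have "1 - s / c * (s / c) = (c * c - s * s) / (c * c)"
      using \<open>c \<noteq> 0\<close> by (simp add: diff_divide_distrib)
    also have "c * c - s * s = 1" using that(1) by simp
    finally show ?thesis by simp
  qed
  then show ?thesis
    using cosh_square_eq[of "u t"] by (simp add: tanh_def power2_eq_square)
qed

lemma C_pos: "0 < C t"
  using b_bounds[of t] by (intro cos_gt_zero_pi) auto

lemma cos_sin_alpha_pos: "0 < cos (\<alpha> t)" "0 < sin (\<alpha> t)"
  using b_bounds[of t] by (auto intro!: cos_gt_zero_pi sin_gt_zero)

lemma alpha_double: "cos (\<alpha> t) * cos (\<alpha> t) - sin (\<alpha> t) * sin (\<alpha> t) = - sin (2 * b t)"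
  "2 * (sin (\<alpha> t) * cos (\<alpha> t)) = C t"
proof -
  have "2 * \<alpha> t = 2 * b t + pi / 2" by simp
  then have "cos (2 * \<alpha> t) = - sin (2 * b t)" "sin (2 * \<alpha> t) = C t"
    by (simp_all add: cos_add sin_add)
  then show "cos (\<alpha> t) * cos (\<alpha> t) - sin (\<alpha> t) * sin (\<alpha> t) = - sin (2 * b t)"
    "2 * (sin (\<alpha> t) * cos (\<alpha> t)) = C t"
    by (simp_all only: cos_double sin_double power2_eq_square mult.assoc)
qed

lemma dz: "((\<lambda>t. z t) has_real_derivative (1 - z t * z t) * (cos (h t) * C t)) (at t)"
  by (auto intro!: derivative_eq_intros du simp: power2_eq_square)

lemma drho: "((\<lambda>t. \<rho> t) has_real_derivative - (\<rho> t * z t * (cos (h t) * C t))) (at t)"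
  by (auto intro!: derivative_eq_intros du simp: tanh_def)

lemma dalpha: "((\<lambda>t. \<alpha> t) has_real_derivative sin (h t) * C t) (at t)"
  by (auto intro!: derivative_eq_intros db)

lemma dc1: "(c1 has_real_derivative \<rho> t * C t * \<tau>1 t) (at t)"
proof -
  have "(c1 has_real_derivative - (\<rho> t * z t * (cos (h t) * C t)) * cos (\<alpha> t) + - sin (\<alpha> t) * (sin (h t) * C t) * \<rho> t) (at t)"
    unfolding c1_def[abs_def] by (rule DERIV_mult[OF drho DERIV_fun_cos[OF dalpha]])
  moreover have "- (r * zz * (ch * c)) * ca + - sa * (sh * c) * r = r * c * - (zz * ch * ca + sh * sa)"
    for r zz ch c ca sa sh :: real
    by (simp add: algebra_simps)
  ultimately show ?thesis unfolding \<tau>1_def by (rule DERIV_cong)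
qed

lemma dc2: "(c2 has_real_derivative \<rho> t * C t * \<tau>2 t) (at t)"
proof -
  have "(c2 has_real_derivative - (\<rho> t * z t * (cos (h t) * C t)) * sin (\<alpha> t) + cos (\<alpha> t) * (sin (h t) * C t) * \<rho> t) (at t)"
    unfolding c2_def[abs_def] by (rule DERIV_mult[OF drho DERIV_fun_sin[OF dalpha]])
  moreover have "- (r * zz * (ch * c)) * sa + ca * (sh * c) * r = r * c * - (zz * ch * sa - sh * ca)"
    for r zz ch c ca sa sh :: real
    by (simp add: algebra_simps)
  ultimately show ?thesis unfolding \<tau>2_def by (rule DERIV_cong)
qed

lemma dc3: "(c3 has_real_derivative \<rho> t * C t * \<tau>3 t) (at t)"
  unfolding c3_def[abs_def]
  by (rule DERIV_cong[OF dz]) (simp only: \<tau>3_def sech_tanh[symmetric] mult_ac)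

definition "dh' t = (2 * real m + 1) * z t * sin (h t) * C t - 2 * real m * sin (2 * b t) * cos (h t)"

lemma dh': "(h has_real_derivative dh' t) (at t)"
  unfolding dh'_def by (rule dh)

text \<open>The last summand is the rate at which \<open>h\<close> would change along a great circle
  in the conformal chart; the remainder \<open>bend\<close> is the turning of the curve in the round
  metric.\<close>

lemma dh'_bend: "dh' t = bend t + z t * (sin (h t) * C t)"
  by (simp add: dh'_def bend_def algebra_simps)

text \<open>One coordinate of the Frenet equation n' = - bend \<tau>. With \<open>H\<close> standing
  for the derivative of \<open>h\<close> it is a polynomial identity in the trigonometric and
  hyperbolic values.\<close>

lemma dn1: "(n1 has_real_derivative - bend t * \<tau>1 t) (at t)"
proof -
  have alg: "(((1 - zz * zz) * (ch * c)) * sh + (ch * H) * zz) * ca + - sa * (sh * c) * (zz * sh)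
      - (- sh * H * sa + ca * (sh * c) * ch) = - (H - zz * (sh * c)) * - (zz * ch * ca + sh * sa)"
    for zz ch sh c H sa ca :: real
    by algebra
  have "(n1 has_real_derivative (((1 - z t * z t) * (cos (h t) * C t)) * sin (h t) + (cos (h t) * dh' t) * z t) * cos (\<alpha> t)
      + - sin (\<alpha> t) * (sin (h t) * C t) * (z t * sin (h t))
      - (- sin (h t) * dh' t * sin (\<alpha> t) + cos (\<alpha> t) * (sin (h t) * C t) * cos (h t))) (at t)"
    unfolding n1_def[abs_def]
    by (intro DERIV_diff DERIV_mult DERIV_fun_cos DERIV_fun_sin dz dalpha dh')
  then show ?thesis
    unfolding alg by (rule DERIV_cong) (simp add: \<tau>1_def dh'_bend)
qed

lemma dn2: "(n2 has_real_derivative - bend t * \<tau>2 t) (at t)"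
proof -
  have alg: "(((1 - zz * zz) * (ch * c)) * sh + (ch * H) * zz) * sa + ca * (sh * c) * (zz * sh)
      + (- sh * H * ca + - sa * (sh * c) * ch) = - (H - zz * (sh * c)) * - (zz * ch * sa - sh * ca)"
    for zz ch sh c H sa ca :: real
    by algebra
  have "(n2 has_real_derivative (((1 - z t * z t) * (cos (h t) * C t)) * sin (h t) + (cos (h t) * dh' t) * z t) * sin (\<alpha> t)
      + cos (\<alpha> t) * (sin (h t) * C t) * (z t * sin (h t))
      + (- sin (h t) * dh' t * cos (\<alpha> t) + - sin (\<alpha> t) * (sin (h t) * C t) * cos (h t))) (at t)"
    unfolding n2_def[abs_def]
    by (intro DERIV_add DERIV_mult DERIV_fun_cos DERIV_fun_sin dz dalpha dh')
  then show ?thesis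
    unfolding alg by (rule DERIV_cong) (simp add: \<tau>2_def dh'_bend)
qed

lemma dn3: "(n3 has_real_derivative - bend t * \<tau>3 t) (at t)"
proof -
  have "(n3 has_real_derivative - (- (\<rho> t * z t * (cos (h t) * C t))) * sin (h t) + cos (h t) * dh' t * - \<rho> t) (at t)"
    unfolding n3_def[abs_def]
    by (intro DERIV_mult DERIV_minus DERIV_fun_sin drho dh')
  then show ?thesis
    by (rule DERIV_cong) (simp add: \<tau>3_def dh'_bend algebra_simps)
qed

text \<open>Bootstrap: the right-hand sides are smooth functions of \<open>(u, b, h)\<close>, so the
  derivatives are as regular as the functions. The three components have to be treated
  together.\<close>

lemma profile_smooth: "smooth_on u UNIV" "smooth_on b UNIV" "smooth_on h UNIV"
proof -
  have U: "open (UNIV :: real set)" by simp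
  note mult = bounded_bilinear.Ck_on_prod[OF bounded_bilinear_mult U]
  have "Ck_on k u UNIV \<and> Ck_on k b UNIV \<and> Ck_on k h UNIV" for k
  proof (induction k)
    case 0
    show ?case
      by (auto intro!: DERIV_isCont continuous_at_imp_continuous_on du db dh)
  next
    case (Suc k)
    have trig: "Ck_on k (\<lambda>t. sin (g t)) UNIV" "Ck_on k (\<lambda>t. cos (g t)) UNIV" "Ck_on k (\<lambda>t. tanh (g t)) UNIV"
      if "Ck_on k g UNIV" for g :: "real \<Rightarrow> real"
      using Ck_on_compose_real[OF U smooth_onD[OF smooth_on_sin_cos(1)[OF U]] that]
        Ck_on_compose_real[OF U smooth_onD[OF smooth_on_sin_cos(2)[OF U]] that]
        Ck_on_compose_real[OF U smooth_onD[OF smooth_on_tanh_sech(1)[OF U]] that] by simp_all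
    have minus: "Ck_on k (\<lambda>t. f t - g t) UNIV" if "Ck_on k f UNIV" "Ck_on k g UNIV" for f g :: "real \<Rightarrow> real"
      using Ck_on_add[OF U that(1) bounded_linear.Ck_on_compose[OF bounded_linear_minus[OF bounded_linear_ident] U that(2)]]
      by simp
    have "Ck_on k (\<lambda>t. 2 * b t) UNIV"
      using Suc by (intro mult Ck_on_const U) auto
    note t = trig(1)[OF this] trig(2)[OF this]
    have "Ck_on k (\<lambda>t. cos (h t) * C t) UNIV" "Ck_on k (\<lambda>t. sin (h t) * C t) UNIV"
      "Ck_on k (\<lambda>t. (2 * real m + 1) * z t * sin (h t) * C t - 2 * real m * sin (2 * b t) * cos (h t)) UNIV"
      using Suc by (intro minus mult Ck_on_const U t trig; simp)+
    then show ?case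
      using Ck_on_Suc_real[OF U du[unfolded has_real_derivative_iff_has_vector_derivative]]
        Ck_on_Suc_real[OF U db[unfolded has_real_derivative_iff_has_vector_derivative]]
        Ck_on_Suc_real[OF U dh[unfolded has_real_derivative_iff_has_vector_derivative]] by blast
  qed
  then show "smooth_on u UNIV" "smooth_on b UNIV" "smooth_on h UNIV"
    by (simp_all add: smooth_on_def)
qed

lemma smooth_parts:
  "smooth_on (\<lambda>t. \<rho> t) UNIV" "smooth_on (\<lambda>t. z t) UNIV" "smooth_on (\<lambda>t. sin (h t)) UNIV" "smooth_on (\<lambda>t. cos (h t)) UNIV"
  "smooth_on (\<lambda>t. sin (\<alpha> t)) UNIV" "smooth_on (\<lambda>t. cos (\<alpha> t)) UNIV"
proof -
  have U: "open (UNIV :: real set)" by simp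
  have a: "smooth_on (\<lambda>t. \<alpha> t) UNIV"
    by (intro smooth_on_add smooth_on_const profile_smooth U)
  note comp = smooth_on_compose_real[OF U _ _ subset_UNIV]
  show "smooth_on (\<lambda>t. \<rho> t) UNIV" "smooth_on (\<lambda>t. z t) UNIV"
    by (rule comp[OF smooth_on_tanh_sech(2)[OF U] profile_smooth(1)] comp[OF smooth_on_tanh_sech(1)[OF U] profile_smooth(1)])+
  show "smooth_on (\<lambda>t. sin (h t)) UNIV" "smooth_on (\<lambda>t. cos (h t)) UNIV"
    by (rule comp[OF smooth_on_sin_cos(1)[OF U] profile_smooth(3)] comp[OF smooth_on_sin_cos(2)[OF U] profile_smooth(3)])+
  show "smooth_on (\<lambda>t. sin (\<alpha> t)) UNIV" "smooth_on (\<lambda>t. cos (\<alpha> t)) UNIV"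
    by (rule comp[OF smooth_on_sin_cos(1)[OF U] a] comp[OF smooth_on_sin_cos(2)[OF U] a])+
qed

lemma tangent_unit: "\<tau>1 t * \<tau>1 t + \<tau>2 t * \<tau>2 t + \<tau>3 t * \<tau>3 t = 1"
proof -
  have "\<tau>1 t * \<tau>1 t + \<tau>2 t * \<tau>2 t + \<tau>3 t * \<tau>3 t = 1"
    if "sa * sa + ca * ca = 1" "sh * sh + ch * ch = 1" "r * r = 1 - zz * zz"
      "\<tau>1 t = - (zz * ch * ca + sh * sa)" "\<tau>2 t = - (zz * ch * sa - sh * ca)" "\<tau>3 t = r * ch"
    for sa ca sh ch r zz
    using that by algebra
  from this[OF _ _ sech_tanh[of t] \<tau>1_def \<tau>2_def \<tau>3_def] show ?thesis
    by (simp add: sin_cos_squared_add[unfolded power2_eq_square])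
qed

lemma rotational_immersion:
  assumes J: "rotation_frame (J :: (real^'n) \<times> (real^'n) \<times> real \<Rightarrow> 'b::euclidean_space) T"
    and card: "CARD('n) = m + 1"
  shows "rotational_immersion J T c1 c2 c3 (\<lambda>t. \<rho> t * C t * \<tau>1 t) (\<lambda>t. \<rho> t * C t * \<tau>2 t) (\<lambda>t. \<rho> t * C t * \<tau>3 t)
    n1 n2 n3 (\<lambda>t. - bend t * \<tau>1 t) (\<lambda>t. - bend t * \<tau>2 t) (\<lambda>t. - bend t * \<tau>3 t)"
proof -
  interpret rotation_frame J T by (rule J)
  have U: "open (UNIV :: real set)" by simp
  have trig: "sin x * sin x + cos x * cos x = 1" for x :: real
    using sin_cos_squared_add[of x] by (simp add: power2_eq_square)
  have speed: "(\<rho> t * C t * \<tau>1 t)\<^sup>2 + (\<rho> t * C t * \<tau>2 t)\<^sup>2 + (\<rho> t * C t * \<tau>3 t)\<^sup>2 = (\<rho> t * C t)\<^sup>2" for t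
  proof -
    have "(x * p)\<^sup>2 + (x * q)\<^sup>2 + (x * r)\<^sup>2 = x\<^sup>2 * (p * p + q * q + r * r)" for x p q r :: real
      by (simp add: power2_eq_square algebra_simps)
    then show ?thesis by (simp only: tangent_unit mult_1_right)
  qed
  have pos: "0 < \<rho> t" "0 < \<rho> t * C t" for t
    using C_pos[of t] by simp_all
  show ?thesis
  proof
    show "smooth_on c1 UNIV" "smooth_on c2 UNIV" "smooth_on c3 UNIV" "smooth_on n1 UNIV" "smooth_on n2 UNIV" "smooth_on n3 UNIV"
      unfolding c1_def[abs_def] c2_def[abs_def] c3_def[abs_def] n1_def[abs_def] n2_def[abs_def] n3_def[abs_def]
      by (intro smooth_on_mult smooth_on_add smooth_on_diff smooth_on_minus smooth_parts U)+
    fix t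
    show "c1 (t + T) = c1 t" "c2 (t + T) = c2 t" "c3 (t + T) = c3 t"
      "n1 (t + T) = n1 t" "n2 (t + T) = n2 t" "n3 (t + T) = n3 t"
      by (simp_all add: c1_def c2_def c3_def n1_def n2_def n3_def periodic sin_diff cos_diff)
    show "(c1 has_real_derivative \<rho> t * C t * \<tau>1 t) (at t)" "(c2 has_real_derivative \<rho> t * C t * \<tau>2 t) (at t)"
      "(c3 has_real_derivative \<rho> t * C t * \<tau>3 t) (at t)"
      by (rule dc1 dc2 dc3)+
    show "(n1 has_real_derivative - bend t * \<tau>1 t) (at t)" "(n2 has_real_derivative - bend t * \<tau>2 t) (at t)"
      "(n3 has_real_derivative - bend t * \<tau>3 t) (at t)"
      by (rule dn1 dn2 dn3)+
    have alg: "(r * ca)\<^sup>2 + (r * sa)\<^sup>2 + zz\<^sup>2 = 1"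
      "(zz * sh * ca - ch * sa)\<^sup>2 + (zz * sh * sa + ch * ca)\<^sup>2 + (- r * sh)\<^sup>2 = 1"
      "(zz * sh * ca - ch * sa) * (r * ca) + (zz * sh * sa + ch * ca) * (r * sa) + (- r * sh) * zz = 0"
      "(zz * sh * ca - ch * sa) * (zz * ch * ca + sh * sa) + (zz * sh * sa + ch * ca) * (zz * ch * sa - sh * ca) + r * sh * (r * ch) = 0"
      if "sa * sa + ca * ca = 1" "sh * sh + ch * ch = 1" "r * r = 1 - zz * zz" for sa ca sh ch r zz :: real
      using that by algebra+
    note alg = alg[of "sin (\<alpha> t)" "cos (\<alpha> t)" "sin (h t)" "cos (h t)" "\<rho> t" "z t", OF trig trig sech_tanh]
    show "(c1 t)\<^sup>2 + (c2 t)\<^sup>2 + (c3 t)\<^sup>2 = 1" "(n1 t)\<^sup>2 + (n2 t)\<^sup>2 + (n3 t)\<^sup>2 = 1"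
      "n1 t * c1 t + n2 t * c2 t + n3 t * c3 t = 0"
      unfolding c1_def c2_def c3_def n1_def n2_def n3_def by (rule alg)+
    have ntau: "n1 t * \<tau>1 t + n2 t * \<tau>2 t + n3 t * \<tau>3 t = 0"
      using alg(4) unfolding n1_def n2_def n3_def \<tau>1_def \<tau>2_def \<tau>3_def by linarith
    have lin: "a * (x * p) + b' * (x * q) + c * (x * r) = x * (a * p + b' * q + c * r)"
      for a b' c x p q r :: real
      by (simp add: algebra_simps)
    show "n1 t * (\<rho> t * C t * \<tau>1 t) + n2 t * (\<rho> t * C t * \<tau>2 t) + n3 t * (\<rho> t * C t * \<tau>3 t) = 0"
      unfolding lin ntau by (rule mult_zero_right)
    show "0 < c1 t" "0 < c2 t"
      using pos(1)[of t] cos_sin_alpha_pos[of t] unfolding c1_def c2_def by (auto intro: mult_pos_pos simp del: cosh_real_pos)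
    show "0 < (\<rho> t * C t * \<tau>1 t)\<^sup>2 + (\<rho> t * C t * \<tau>2 t)\<^sup>2 + (\<rho> t * C t * \<tau>3 t)\<^sup>2"
      unfolding speed using pos(2) by (rule zero_less_power)
    \<comment> \<open>Over the common denominator the double angle formulas turn the two spherical
      curvatures into \<open>bend / (\<rho> * C)\<close>. The profile contributes
      \<open>- bend / (\<rho> * C)\<close>, so minimality is exactly the equation for
      \<open>h\<close>.\<close>
    have main: "M * ((zz * sh * ca - ch * sa) / (r * ca) + (zz * sh * sa + ch * ca) / (r * sa))
        = 2 * M * (zz * sh * cc - s2 * ch) / (r * cc)"
      if "2 * (sa * ca) = cc" "ca * ca - sa * sa = - s2" "0 < sa" "0 < ca" "0 < r" for sa ca cc s2 zz sh ch r M :: real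
    proof -
      have "cc \<noteq> 0" using that by auto
      have "(zz * sh * ca - ch * sa) / (r * ca) + (zz * sh * sa + ch * ca) / (r * sa)
          = ((zz * sh * ca - ch * sa) * sa + (zz * sh * sa + ch * ca) * ca) / (r * (sa * ca))"
        using that(3-5) by (simp add: field_simps)
      also have "(zz * sh * ca - ch * sa) * sa + (zz * sh * sa + ch * ca) * ca
          = zz * sh * (2 * (sa * ca)) + ch * (ca * ca - sa * sa)"
        by (simp add: algebra_simps)
      also have "\<dots> = zz * sh * cc - s2 * ch"
        by (simp only: that(1,2) mult_minus_right add_uminus_conv_diff mult.commute[of ch])
      also have "r * (sa * ca) = r * cc / 2" using that(1) by simp
      finally show ?thesis by (simp add: mult_ac)
    qed
    have "(real CARD('n) - 1) * (n1 t / c1 t + n2 t / c2 t) = bend t / (\<rho> t * C t)"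
      unfolding n1_def n2_def c1_def c2_def bend_def card
      using main[where M = "real m" and zz = "z t" and sh = "sin (h t)" and ch = "cos (h t)",
          OF alpha_double(2)[of t] alpha_double(1)[of t] cos_sin_alpha_pos(2)[of t] cos_sin_alpha_pos(1)[of t] pos(1)[of t]]
      by (simp add: mult.assoc)
    moreover have "a * p * (x * p) + a * q * (x * q) + a * r * (x * r) = a * x * (p * p + q * q + r * r)"
      for a x p q r :: real
      by (simp add: algebra_simps)
    then have "- bend t * \<tau>1 t * (\<rho> t * C t * \<tau>1 t) + - bend t * \<tau>2 t * (\<rho> t * C t * \<tau>2 t) + - bend t * \<tau>3 t * (\<rho> t * C t * \<tau>3 t)
        = - bend t * (\<rho> t * C t)"
      by (simp only: tangent_unit mult_1_right)
    moreover have "B / x + - B * x / x\<^sup>2 = 0" if "0 < x" for B x :: real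
      using that by (simp add: power2_eq_square)
    ultimately show "(real CARD('n) - 1) * (n1 t / c1 t + n2 t / c2 t)
      + (- bend t * \<tau>1 t * (\<rho> t * C t * \<tau>1 t) + - bend t * \<tau>2 t * (\<rho> t * C t * \<tau>2 t) + - bend t * \<tau>3 t * (\<rho> t * C t * \<tau>3 t))
        / ((\<rho> t * C t * \<tau>1 t)\<^sup>2 + (\<rho> t * C t * \<tau>2 t)\<^sup>2 + (\<rho> t * C t * \<tau>3 t)\<^sup>2) = 0"
      unfolding speed using pos(2)[of t] by metis
  qed
qed

end

section \<open>Isometry classes\<close>

context rotation_frame
begin

lemma lift_image:
  assumes per: "\<And>t. g1 (t + T) = g1 t" "\<And>t. g2 (t + T) = g2 t" "\<And>t. g3 (t + T) = g3 t"
  shows "lift g1 g2 g3 ` sphere_product = {J (g1 s *\<^sub>R x, g2 s *\<^sub>R y, g3 s) |s x y. norm x = 1 \<and> norm y = 1}"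
proof (intro equalityI subsetI)
  fix v assume "v \<in> lift g1 g2 g3 ` sphere_product"
  then obtain x y w where "v = lift g1 g2 g3 (x, y, w)" "norm x = 1" "norm y = 1"
    by (auto simp: sphere_product_def)
  then show "v \<in> {J (g1 s *\<^sub>R x, g2 s *\<^sub>R y, g3 s) |s x y. norm x = 1 \<and> norm y = 1}"
    unfolding lift_def prod.case by blast
next
  fix v assume "v \<in> {J (g1 s *\<^sub>R x, g2 s *\<^sub>R y, g3 s) |s x y. norm x = 1 \<and> norm y = 1}"
  then obtain s x y where v: "v = J (g1 s *\<^sub>R x, g2 s *\<^sub>R y, g3 s)" "norm x = 1" "norm y = 1" by blast
  have \<kappa>: "\<kappa> \<noteq> 0" "\<kappa> * (2 * pi) = T" using T by (simp_all add: \<kappa>_def)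
  define w :: "real^2" where "w = (\<chi> i. if i = 1 then cos (s / \<kappa>) else sin (s / \<kappa>))"
  have w: "w $ 1 = cos (s / \<kappa>)" "w $ 2 = sin (s / \<kappa>)" by (simp_all add: w_def)
  have "norm w = 1" by (simp add: norm_eq_1 inner_real2 w power2_eq_square[symmetric])
  then obtain i :: int where i: "angle w = s / \<kappa> + 2 * pi * of_int i"
    using angle[of w] sin_cos_eq_iff[of "angle w" "s / \<kappa>"] w by auto
  have "\<kappa> * angle w = s + of_int i * T"
  proof -
    have "\<kappa> * (2 * pi * of_int i) = of_int i * (\<kappa> * (2 * pi))" by simp
    also have "\<dots> = of_int i * T" by (simp only: \<kappa>(2))
    finally show ?thesis using \<kappa>(1) by (simp add: i distrib_left)
  qed
  then have "lift g1 g2 g3 (x, y, w) = v"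
    using periodic_int[of g1, OF per(1)] periodic_int[of g2, OF per(2)] periodic_int[of g3, OF per(3)]
    by (simp add: lift_def v(1))
  moreover have "(x, y, w) \<in> sphere_product" using v \<open>norm w = 1\<close> by (simp add: sphere_product_def)
  ultimately show "v \<in> lift g1 g2 g3 ` sphere_product" by blast
qed

end

section \<open>Quadratic forms controlled by their values on a hypersurface\<close>

definition ternary_form :: "real \<Rightarrow> real \<Rightarrow> real \<Rightarrow> real \<Rightarrow> real \<Rightarrow> real \<Rightarrow> real \<Rightarrow> real \<Rightarrow> real \<Rightarrow> real"
  where "ternary_form X Y Z XY XZ YZ a b c =
    a\<^sup>2 * X + b\<^sup>2 * Y + c\<^sup>2 * Z + 2 * a * b * XY + 2 * a * c * XZ + 2 * b * c * YZ"

text \<open>Six coefficients are recovered from a few values. Sign changes isolate the mixed ones.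
  The equator points with radii \<open>(r1, r2)\<close> and \<open>(r2, r1)\<close> give a system
  for \<open>X\<close> and \<open>Y\<close> with determinant r1^4 - r2^4 = r1^2 - r2^2. The point
  off the equator then gives \<open>Z\<close>. \<open>K\<close> depends on the points only, not on
  the form.\<close>

lemma quadratic_form_bound:
  fixes r1 r2 q1 q2 q3 :: real
  assumes r: "0 < r1" "0 < r2" "r1\<^sup>2 + r2\<^sup>2 = 1" "r1\<^sup>2 \<noteq> r2\<^sup>2"
    and q: "0 < q1" "0 < q2" "q3 \<noteq> 0" "q1\<^sup>2 + q2\<^sup>2 \<le> 1"
  shows "\<exists>K>0. \<forall>X Y Z XY XZ YZ \<delta>.
    (\<forall>\<sigma>\<in>{1, -1}. \<forall>\<tau>\<in>{1, -1}. \<bar>ternary_form X Y Z XY XZ YZ (\<sigma> * r1) (\<tau> * r2) 0\<bar> \<le> \<delta> \<and>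
      \<bar>ternary_form X Y Z XY XZ YZ (\<sigma> * r2) (\<tau> * r1) 0\<bar> \<le> \<delta> \<and> \<bar>ternary_form X Y Z XY XZ YZ (\<sigma> * q1) (\<tau> * q2) q3\<bar> \<le> \<delta>) \<longrightarrow>
    (\<forall>a b c. \<bar>a\<bar> \<le> 1 \<longrightarrow> \<bar>b\<bar> \<le> 1 \<longrightarrow> \<bar>c\<bar> \<le> 1 \<longrightarrow> \<bar>ternary_form X Y Z XY XZ YZ a b c\<bar> \<le> K * \<delta>)"
proof -
  define d where "d = \<bar>r1\<^sup>2 - r2\<^sup>2\<bar>"
  have d: "0 < d" using r by (simp add: d_def)
  \<comment> \<open>In order, the summands bound |X| + |Y|, |Z|, 2 |XY|, 2 |XZ| and 2 |YZ|, each
    relative to \<open>\<delta>\<close>.\<close>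
  define K where "K = 2 * (1 / d) + (1 + 1 / d) / q3\<^sup>2 + 1 / (r1 * r2) + 1 / (q1 * \<bar>q3\<bar>) + 1 / (q2 * \<bar>q3\<bar>)"
  show ?thesis
  proof (intro exI[of _ K] conjI allI impI)
    show "0 < K" unfolding K_def using d r q by (intro add_pos_pos divide_pos_pos mult_pos_pos) auto
    fix X Y Z XY XZ YZ \<delta> a b c :: real
    assume H: "\<forall>\<sigma>\<in>{1, -1}. \<forall>\<tau>\<in>{1, -1}. \<bar>ternary_form X Y Z XY XZ YZ (\<sigma> * r1) (\<tau> * r2) 0\<bar> \<le> \<delta> \<and>
      \<bar>ternary_form X Y Z XY XZ YZ (\<sigma> * r2) (\<tau> * r1) 0\<bar> \<le> \<delta> \<and> \<bar>ternary_form X Y Z XY XZ YZ (\<sigma> * q1) (\<tau> * q2) q3\<bar> \<le> \<delta>"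
      and abc: "\<bar>a\<bar> \<le> 1" "\<bar>b\<bar> \<le> 1" "\<bar>c\<bar> \<le> 1"
    have e: "\<bar>r1\<^sup>2 * X + r2\<^sup>2 * Y + 2 * (r1 * r2 * XY)\<bar> \<le> \<delta>" "\<bar>r1\<^sup>2 * X + r2\<^sup>2 * Y - 2 * (r1 * r2 * XY)\<bar> \<le> \<delta>"
      "\<bar>r2\<^sup>2 * X + r1\<^sup>2 * Y + 2 * (r1 * r2 * XY)\<bar> \<le> \<delta>" "\<bar>r2\<^sup>2 * X + r1\<^sup>2 * Y - 2 * (r1 * r2 * XY)\<bar> \<le> \<delta>"
      using H by (simp_all add: ternary_form_def mult_ac)
    have f: "\<bar>q1\<^sup>2 * X + q2\<^sup>2 * Y + q3\<^sup>2 * Z + 2 * (q1 * q2 * XY) + 2 * (q1 * q3 * XZ) + 2 * (q2 * q3 * YZ)\<bar> \<le> \<delta>"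
      "\<bar>q1\<^sup>2 * X + q2\<^sup>2 * Y + q3\<^sup>2 * Z - 2 * (q1 * q2 * XY) + 2 * (q1 * q3 * XZ) - 2 * (q2 * q3 * YZ)\<bar> \<le> \<delta>"
      "\<bar>q1\<^sup>2 * X + q2\<^sup>2 * Y + q3\<^sup>2 * Z - 2 * (q1 * q2 * XY) - 2 * (q1 * q3 * XZ) + 2 * (q2 * q3 * YZ)\<bar> \<le> \<delta>"
      "\<bar>q1\<^sup>2 * X + q2\<^sup>2 * Y + q3\<^sup>2 * Z + 2 * (q1 * q2 * XY) - 2 * (q1 * q3 * XZ) - 2 * (q2 * q3 * YZ)\<bar> \<le> \<delta>"
      using H by (simp_all add: ternary_form_def mult_ac)
    have \<delta>: "0 \<le> \<delta>" using e(1) by linarith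
    have S: "\<bar>r1\<^sup>2 * X + r2\<^sup>2 * Y\<bar> \<le> \<delta>" "\<bar>r2\<^sup>2 * X + r1\<^sup>2 * Y\<bar> \<le> \<delta>"
      using e by linarith+
    have XY: "\<bar>r1 * r2 * XY\<bar> \<le> \<delta> / 2" using e(1,2) by linarith
    have XZ: "\<bar>q1 * q3 * XZ\<bar> \<le> \<delta> / 2" and YZ: "\<bar>q2 * q3 * YZ\<bar> \<le> \<delta> / 2"
      and Zs: "\<bar>q1\<^sup>2 * X + q2\<^sup>2 * Y + q3\<^sup>2 * Z\<bar> \<le> \<delta>"
      using f by linarith+
    have comb: "\<bar>p * s - q * t\<bar> \<le> (p + q) * \<delta>" if "\<bar>s\<bar> \<le> \<delta>" "\<bar>t\<bar> \<le> \<delta>" "0 \<le> p" "0 \<le> q" for p q s t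
    proof -
      have "\<bar>p * s\<bar> \<le> p * \<delta>" "\<bar>q * t\<bar> \<le> q * \<delta>"
        unfolding abs_mult using that by (auto intro!: mult_mono)
      then show ?thesis using abs_triangle_ineq4[of "p * s" "q * t"] by (simp add: distrib_right)
    qed
    have factor: "r1\<^sup>2 * r1\<^sup>2 - r2\<^sup>2 * r2\<^sup>2 = r1\<^sup>2 - r2\<^sup>2"
    proof -
      have "r1\<^sup>2 * r1\<^sup>2 - r2\<^sup>2 * r2\<^sup>2 = (r1\<^sup>2 + r2\<^sup>2) * (r1\<^sup>2 - r2\<^sup>2)" by (simp add: algebra_simps)
      then show ?thesis by (simp add: r(3))
    qed
    have elim: "r1\<^sup>2 * (r1\<^sup>2 * X + r2\<^sup>2 * Y) - r2\<^sup>2 * (r2\<^sup>2 * X + r1\<^sup>2 * Y) = (r1\<^sup>2 * r1\<^sup>2 - r2\<^sup>2 * r2\<^sup>2) * X"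
      "r1\<^sup>2 * (r2\<^sup>2 * X + r1\<^sup>2 * Y) - r2\<^sup>2 * (r1\<^sup>2 * X + r2\<^sup>2 * Y) = (r1\<^sup>2 * r1\<^sup>2 - r2\<^sup>2 * r2\<^sup>2) * Y"
      by (simp_all add: algebra_simps)
    have "\<bar>(r1\<^sup>2 - r2\<^sup>2) * X\<bar> \<le> \<delta>"
      using comb[OF S zero_le_power2 zero_le_power2, of r1 r2] unfolding elim factor r(3) mult_1 .
    moreover have "\<bar>(r1\<^sup>2 - r2\<^sup>2) * Y\<bar> \<le> \<delta>"
      using comb[OF S(2,1) zero_le_power2 zero_le_power2, of r1 r2] unfolding elim factor r(3) mult_1 .
    ultimately have bX: "\<bar>X\<bar> \<le> \<delta> / d" and bY: "\<bar>Y\<bar> \<le> \<delta> / d"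
      using d by (simp_all add: abs_mult d_def pos_le_divide_eq mult.commute)
    have "\<bar>q1\<^sup>2 * X\<bar> \<le> q1\<^sup>2 * (\<delta> / d)" "\<bar>q2\<^sup>2 * Y\<bar> \<le> q2\<^sup>2 * (\<delta> / d)"
      using mult_left_mono[OF bX zero_le_power2[of q1]] mult_left_mono[OF bY zero_le_power2[of q2]]
      by (simp_all only: abs_mult abs_power2)
    moreover have "q1\<^sup>2 * (\<delta> / d) + q2\<^sup>2 * (\<delta> / d) \<le> 1 * (\<delta> / d)"
      unfolding distrib_right[symmetric] using q(4) \<delta> d by (intro mult_right_mono) auto
    ultimately have "\<bar>q3\<^sup>2 * Z\<bar> \<le> \<delta> + \<delta> / d" using Zs by linarith
    then have bZ: "\<bar>Z\<bar> \<le> (\<delta> + \<delta> / d) / q3\<^sup>2"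
      using q(3) by (simp add: abs_mult pos_le_divide_eq mult.commute)
    have div: "2 * \<bar>W\<bar> \<le> \<delta> / \<bar>p\<bar>" if "\<bar>p * W\<bar> \<le> \<delta> / 2" "p \<noteq> 0" for p W
      using that by (simp add: abs_mult pos_le_divide_eq mult_ac)
    have bXY: "2 * \<bar>XY\<bar> \<le> \<delta> / (r1 * r2)" and bXZ: "2 * \<bar>XZ\<bar> \<le> \<delta> / (q1 * \<bar>q3\<bar>)" and bYZ: "2 * \<bar>YZ\<bar> \<le> \<delta> / (q2 * \<bar>q3\<bar>)"
      using div[OF XY] div[OF XZ] div[OF YZ] r q by (simp_all add: abs_mult)
    have le1: "\<bar>p * q * W\<bar> \<le> \<bar>W\<bar>" if "\<bar>p\<bar> \<le> 1" "\<bar>q\<bar> \<le> 1" for p q W :: real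
    proof -
      have "\<bar>p\<bar> * \<bar>q\<bar> * \<bar>W\<bar> \<le> 1 * 1 * \<bar>W\<bar>" using that by (intro mult_mono) auto
      then show ?thesis by (simp add: abs_mult)
    qed
    have "ternary_form X Y Z XY XZ YZ a b c = a * a * X + b * b * Y + c * c * Z + 2 * (a * b * XY) + 2 * (a * c * XZ) + 2 * (b * c * YZ)"
      by (simp add: ternary_form_def power2_eq_square)
    then have "\<bar>ternary_form X Y Z XY XZ YZ a b c\<bar> \<le> \<bar>a * a * X\<bar> + \<bar>b * b * Y\<bar> + \<bar>c * c * Z\<bar>
        + \<bar>2 * (a * b * XY)\<bar> + \<bar>2 * (a * c * XZ)\<bar> + \<bar>2 * (b * c * YZ)\<bar>"
      by (simp only: order_trans[OF abs_triangle_ineq add_right_mono] order_refl)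
    also have "\<dots> \<le> \<bar>X\<bar> + \<bar>Y\<bar> + \<bar>Z\<bar> + 2 * \<bar>XY\<bar> + 2 * \<bar>XZ\<bar> + 2 * \<bar>YZ\<bar>"
      unfolding abs_mult[of 2] abs_numeral by (intro add_mono mult_left_mono le1 abc) simp_all
    also have "\<dots> \<le> \<delta> / d + \<delta> / d + (\<delta> + \<delta> / d) / q3\<^sup>2 + \<delta> / (r1 * r2) + \<delta> / (q1 * \<bar>q3\<bar>) + \<delta> / (q2 * \<bar>q3\<bar>)"
      by (intro add_mono bX bY bZ bXY bXZ bYZ)
    also have "\<dots> = K * \<delta>" by (simp add: K_def algebra_simps add_divide_distrib)
    finally show "\<bar>ternary_form X Y Z XY XZ YZ a b c\<bar> \<le> K * \<delta>" .
  qed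
qed

definition cone_form :: "'a::real_inner \<times> 'a \<times> real \<Rightarrow> real"
  where "cone_form p = fst p \<bullet> fst p - fst (snd p) \<bullet> fst (snd p)"

definition cone_polar :: "'a::real_inner \<times> 'a \<times> real \<Rightarrow> 'a \<times> 'a \<times> real \<Rightarrow> real"
  where "cone_polar p q = fst p \<bullet> fst q - fst (snd p) \<bullet> fst (snd q)"

text \<open>Restricting the pulled back cone form to the span of the directions \<open>x\<close>,
  \<open>y\<close> and the axis makes it a ternary form, to which
  \<open>quadratic_form_bound\<close> applies.\<close>

lemma cone_form_expand:
  assumes "linear F"
  shows "cone_form (F (a *\<^sub>R x, b *\<^sub>R y, c)) =
    ternary_form (cone_polar (F (x, 0, 0)) (F (x, 0, 0))) (cone_polar (F (0, y, 0)) (F (0, y, 0)))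
      (cone_polar (F (0, 0, 1)) (F (0, 0, 1))) (cone_polar (F (x, 0, 0)) (F (0, y, 0)))
      (cone_polar (F (x, 0, 0)) (F (0, 0, 1))) (cone_polar (F (0, y, 0)) (F (0, 0, 1))) a b c"
proof -
  have "(a *\<^sub>R x, b *\<^sub>R y, c) = a *\<^sub>R (x, 0, 0) + b *\<^sub>R (0, y, 0) + c *\<^sub>R (0, 0, 1)" by simp
  then have "F (a *\<^sub>R x, b *\<^sub>R y, c) = a *\<^sub>R F (x, 0, 0) + b *\<^sub>R F (0, y, 0) + c *\<^sub>R F (0, 0, 1)"
    by (simp only: linear_add[OF assms] linear_scale[OF assms])
  then show ?thesis
    by (simp add: ternary_form_def cone_form_def cone_polar_def inner_add_left inner_add_right inner_commute algebra_simps power2_eq_square)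
qed

lemma obtain_direction:
  fixes v :: "'a::euclidean_space"
  obtains a e where "v = a *\<^sub>R e" "norm e = 1" "\<bar>a\<bar> = norm v"
proof (cases "v = 0")
  case True
  obtain e :: 'a where "norm e = 1" using vector_choose_size[of 1] by auto
  then show ?thesis using that[of 0 e] True by simp
next
  case False
  then show ?thesis using that[of "norm v" "v /\<^sub>R norm v"] by simp
qed

context closed_profile
begin

lemma c_periodic: "c1 (t + T) = c1 t" "c2 (t + T) = c2 t" "c3 (t + T) = c3 t"
  by (simp_all add: c1_def c2_def c3_def periodic)

lemma c_pos: "0 < c1 t" "0 < c2 t"
  using cos_sin_alpha_pos[of t] unfolding c1_def c2_def by (auto intro: mult_pos_pos)

lemma c_diff_squares: "(c1 t)\<^sup>2 - (c2 t)\<^sup>2 = - ((\<rho> t)\<^sup>2 * sin (2 * b t))"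
proof -
  have "(r * p)\<^sup>2 - (r * q)\<^sup>2 = r\<^sup>2 * (p * p - q * q)" for r p q :: real
    by (simp add: power2_eq_square algebra_simps)
  then show ?thesis unfolding c1_def c2_def by (simp only: alpha_double mult_minus_right)
qed

lemma c_sum_squares: "(c1 t)\<^sup>2 + (c2 t)\<^sup>2 = 1 - (c3 t)\<^sup>2"
proof -
  have "(r * p)\<^sup>2 + (r * q)\<^sup>2 = r * r * (q\<^sup>2 + p\<^sup>2)" for r p q :: real
    by (simp add: power2_eq_square algebra_simps)
  then have "(c1 t)\<^sup>2 + (c2 t)\<^sup>2 = \<rho> t * \<rho> t * ((sin (\<alpha> t))\<^sup>2 + (cos (\<alpha> t))\<^sup>2)"
    unfolding c1_def c2_def .
  also have "\<dots> = 1 - z t * z t"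
    by (simp only: sin_cos_squared_add sech_tanh mult_1_right)
  finally show ?thesis by (simp add: c3_def power2_eq_square)
qed

lemma equator_points:
  obtains s t where "c3 s = 0" "c3 t = 0" "c1 s = c2 t" "c2 s = c1 t" "(c1 t)\<^sup>2 \<noteq> (c2 t)\<^sup>2"
proof -
  obtain s t where st: "u s = 0" "u t = 0" "b s = - b t" "b t \<noteq> 0" using equator by blast
  have "cos (\<alpha> s) = sin (\<alpha> t)" "sin (\<alpha> s) = cos (\<alpha> t)"
    by (simp_all only: st(3) cos_add sin_add cos_minus sin_minus cos_45 sin_45)
  moreover have "sin (2 * b t) \<noteq> 0"
  proof
    assume "sin (2 * b t) = 0"
    moreover have "- pi < 2 * b t" "2 * b t < pi" using b_bounds[of t] pi_gt_zero by linarith+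
    ultimately show False using sin_eq_0_pi[of "2 * b t"] st(4) by auto
  qed
  then have "(c1 t)\<^sup>2 \<noteq> (c2 t)\<^sup>2" using c_diff_squares[of t] by (auto simp: st(2))
  ultimately show ?thesis
    using that[of s t] by (simp add: c1_def c2_def c3_def st)
qed

text \<open>Every vector lies in a three-space spanned by some unit \<open>x\<close>,
  \<open>y\<close> and the axis, which the hypersurface meets in the profile curve up to signs; the
  signs are absorbed by replacing \<open>x\<close> or \<open>y\<close> with its negative. Thus a
  cone form that is small on the image is small on the whole unit sphere.\<close>

lemma cone_form_lower_bound:
  shows "\<exists>K>0. \<forall>(F :: (real^'n) \<times> (real^'n) \<times> real \<Rightarrow> (real^'n) \<times> (real^'n) \<times> real) \<delta>. linear F \<longrightarrow>
    (\<forall>s x y. norm x = 1 \<longrightarrow> norm y = 1 \<longrightarrow> \<bar>cone_form (F (c1 s *\<^sub>R x, c2 s *\<^sub>R y, c3 s))\<bar> \<le> \<delta>) \<longrightarrow>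
    (\<forall>p. norm p = 1 \<longrightarrow> \<bar>cone_form (F p)\<bar> \<le> K * \<delta>)"
proof -
  obtain s t where st: "c3 s = 0" "c3 t = 0" "c1 s = c2 t" "c2 s = c1 t" "(c1 t)\<^sup>2 \<noteq> (c2 t)\<^sup>2"
    by (rule equator_points)
  obtain r where "u r \<noteq> 0" using off_equator by blast
  then have r: "c3 r \<noteq> 0" by (simp add: c3_def)
  have eq: "(c1 t)\<^sup>2 + (c2 t)\<^sup>2 = 1" using c_sum_squares[of t] st(2) by simp
  have off: "(c1 r)\<^sup>2 + (c2 r)\<^sup>2 \<le> 1" using c_sum_squares[of r] by simp
  from quadratic_form_bound[OF c_pos[of t] eq st(5) c_pos[of r] r off]
  obtain K where K: "0 < K" "\<forall>X Y Z XY XZ YZ \<delta>.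
    (\<forall>\<sigma>\<in>{1, -1}. \<forall>\<tau>\<in>{1, -1}. \<bar>ternary_form X Y Z XY XZ YZ (\<sigma> * c1 t) (\<tau> * c2 t) 0\<bar> \<le> \<delta> \<and>
      \<bar>ternary_form X Y Z XY XZ YZ (\<sigma> * c2 t) (\<tau> * c1 t) 0\<bar> \<le> \<delta> \<and>
      \<bar>ternary_form X Y Z XY XZ YZ (\<sigma> * c1 r) (\<tau> * c2 r) (c3 r)\<bar> \<le> \<delta>) \<longrightarrow>
    (\<forall>a b c. \<bar>a\<bar> \<le> 1 \<longrightarrow> \<bar>b\<bar> \<le> 1 \<longrightarrow> \<bar>c\<bar> \<le> 1 \<longrightarrow> \<bar>ternary_form X Y Z XY XZ YZ a b c\<bar> \<le> K * \<delta>)"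
    by (elim exE conjE)
  show ?thesis
  proof (intro exI[of _ K] conjI allI impI)
    show "0 < K" by (rule K(1))
    fix F :: "(real^'n) \<times> (real^'n) \<times> real \<Rightarrow> (real^'n) \<times> (real^'n) \<times> real" and \<delta> :: real and p :: "(real^'n) \<times> (real^'n) \<times> real"
    assume F: "linear F"
      and H: "\<forall>s x y. norm x = 1 \<longrightarrow> norm y = 1 \<longrightarrow> \<bar>cone_form (F (c1 s *\<^sub>R x, c2 s *\<^sub>R y, c3 s))\<bar> \<le> \<delta>"
      and p: "norm p = 1"
    obtain v v' c where p': "p = (v, v', c)" by (cases p)
    obtain a x where x: "v = a *\<^sub>R x" "norm x = 1" "\<bar>a\<bar> = norm v" by (rule obtain_direction)
    obtain b y where y: "v' = b *\<^sub>R y" "norm y = 1" "\<bar>b\<bar> = norm v'" by (rule obtain_direction)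
    have abc: "\<bar>a\<bar> \<le> 1" "\<bar>b\<bar> \<le> 1" "\<bar>c\<bar> \<le> 1"
      using p norm_fst_le[of v "(v', c)"] norm_snd_le[of "(v', c)" v] norm_fst_le[of v' c] norm_snd_le[of c v']
      by (auto simp: p' x(3) y(3))
    have H': "\<bar>cone_form (F ((\<sigma> * c1 s) *\<^sub>R x, (\<tau> * c2 s) *\<^sub>R y, c3 s))\<bar> \<le> \<delta>"
      if "\<sigma> \<in> {1, -1}" "\<tau> \<in> {1, -1}" for s \<sigma> \<tau>
      using H[rule_format, of "\<sigma> *\<^sub>R x" "\<tau> *\<^sub>R y" s] x(2) y(2) that by (auto simp: mult.commute)
    let ?Q = "ternary_form (cone_polar (F (x, 0, 0)) (F (x, 0, 0))) (cone_polar (F (0, y, 0)) (F (0, y, 0)))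
      (cone_polar (F (0, 0, 1)) (F (0, 0, 1))) (cone_polar (F (x, 0, 0)) (F (0, y, 0)))
      (cone_polar (F (x, 0, 0)) (F (0, 0, 1))) (cone_polar (F (0, y, 0)) (F (0, 0, 1)))"
    have "\<bar>cone_form (F (a *\<^sub>R x, b *\<^sub>R y, c))\<bar> \<le> K * \<delta>"
      unfolding cone_form_expand[OF F]
    proof (rule K(2)[rule_format, OF _ abc], intro conjI)
      fix \<sigma> \<tau> :: real assume sg: "\<sigma> \<in> {1, -1}" "\<tau> \<in> {1, -1}"
      note H'[OF sg, unfolded cone_form_expand[OF F]]
      from this[of t] this[of s] this[of r]
      show "\<bar>?Q (\<sigma> * c1 t) (\<tau> * c2 t) 0\<bar> \<le> \<delta>" "\<bar>?Q (\<sigma> * c2 t) (\<tau> * c1 t) 0\<bar> \<le> \<delta>"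
        "\<bar>?Q (\<sigma> * c1 r) (\<tau> * c2 r) (c3 r)\<bar> \<le> \<delta>"
        by (simp_all only: st)
    qed
    then show "\<bar>cone_form (F p)\<bar> \<le> K * \<delta>" by (simp add: p' x(1) y(1))
  qed
qed

end

text \<open>Members are chosen one after another, each paired with a threshold that
  \<open>\<bar>q\<bar>\<close> reaches on all its orthogonal images. A new member has
  \<open>\<bar>q\<bar>\<close> at most half the current threshold, so it is not an orthogonal image
  of an earlier one.\<close>

lemma infinite_pairwise_non_isometric:
  fixes S :: "'f \<Rightarrow> 'b::euclidean_space set" and q :: "'b \<Rightarrow> real"
  assumes ex: "\<And>\<epsilon>. 0 < \<epsilon> \<Longrightarrow> \<exists>f \<mu>. P f \<and> (\<forall>v\<in>S f. \<bar>q v\<bar> \<le> \<epsilon>) \<and>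
    0 < \<mu> \<and> (\<forall>A. orthogonal_transformation A \<longrightarrow> (\<exists>v\<in>S f. \<mu> \<le> \<bar>q (A v)\<bar>))"
  shows "\<exists>\<F>. infinite \<F> \<and> (\<forall>f\<in>\<F>. P f) \<and> pairwise (\<lambda>f g. \<not> isometric_hypersurfaces (S f) (S g)) \<F>"
proof -
  define good where "good x \<longleftrightarrow> P (fst x) \<and> 0 < snd x \<and>
    (\<forall>A. orthogonal_transformation A \<longrightarrow> (\<exists>v\<in>S (fst x). snd x \<le> \<bar>q (A v)\<bar>))" for x :: "'f \<times> real"
  have step: "\<exists>y. good y \<and> snd y \<le> \<mu> \<and> (\<forall>v\<in>S (fst y). \<bar>q v\<bar> \<le> \<mu> / 2)" if "0 < \<mu>" for \<mu>
  proof -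
    from that have "0 < \<mu> / 2" by simp
    from ex[OF this] obtain f \<mu>' where f: "P f" "\<forall>v\<in>S f. \<bar>q v\<bar> \<le> \<mu> / 2" "0 < \<mu>'"
      "\<forall>A. orthogonal_transformation A \<longrightarrow> (\<exists>v\<in>S f. \<mu>' \<le> \<bar>q (A v)\<bar>)"
      by blast
    have "\<exists>v\<in>S f. min \<mu> \<mu>' \<le> \<bar>q (A v)\<bar>" if orth: "orthogonal_transformation A" for A
    proof -
      obtain v where "v \<in> S f" "\<mu>' \<le> \<bar>q (A v)\<bar>" using f(4) orth by blast
      then show ?thesis by (intro bexI[of _ v]) simp_all
    qed
    \<comment> \<open>The minimum keeps the thresholds nonincreasing, so a new member is separated
      from all earlier ones and not just from the last.\<close>
    then have "good (f, min \<mu> \<mu>')"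
      using f(1,3) that by (simp add: good_def)
    then show ?thesis using f by (intro exI[of _ "(f, min \<mu> \<mu>')"]) auto
  qed
  have "\<exists>x. \<forall>i. good (x i) \<and> (snd (x (Suc i)) \<le> snd (x i) \<and> (\<forall>v\<in>S (fst (x (Suc i))). \<bar>q v\<bar> \<le> snd (x i) / 2))"
  proof (rule dependent_nat_choice)
    show "\<exists>y. good y" using step[of 1] by auto
    fix x :: "'f \<times> real" assume "good x"
    then have "0 < snd x" by (simp add: good_def)
    from step[OF this] show "\<exists>y. good y \<and> (snd y \<le> snd x \<and> (\<forall>v\<in>S (fst y). \<bar>q v\<bar> \<le> snd x / 2))" .
  qed
  then obtain x :: "nat \<Rightarrow> 'f \<times> real" where good: "\<And>i. good (x i)"
    and next_small: "\<And>i. snd (x (Suc i)) \<le> snd (x i) \<and> (\<forall>v\<in>S (fst (x (Suc i))). \<bar>q v\<bar> \<le> snd (x i) / 2)"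
    by blast
  have anti: "snd (x j) \<le> snd (x i)" if "i \<le> j" for i j
    using that by (induction rule: dec_induct) (use next_small order_trans in blast)+
  have no_iso: "\<not> isometric_hypersurfaces (S (fst (x i))) (S (fst (x j)))" if ij: "i < j" for i j
  proof
    assume "isometric_hypersurfaces (S (fst (x i))) (S (fst (x j)))"
    then obtain A where A: "orthogonal_transformation A" "A ` S (fst (x i)) = S (fst (x j))"
      by (auto simp: isometric_hypersurfaces_def)
    obtain v where v: "v \<in> S (fst (x i))" "snd (x i) \<le> \<bar>q (A v)\<bar>"
      using good[of i] A(1) by (auto simp: good_def)
    obtain l where l: "j = Suc l" "i \<le> l" using ij by (cases j) auto
    have "A v \<in> S (fst (x (Suc l)))" using v(1) A(2) l(1) by blast
    then have "\<bar>q (A v)\<bar> \<le> snd (x l) / 2" using next_small[of l] by blast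
    also have "\<dots> \<le> snd (x i) / 2" using anti[OF l(2)] by simp
    finally show False using v(2) good[of i] by (simp add: good_def)
  qed
  have sym: "isometric_hypersurfaces Y X" if iso: "isometric_hypersurfaces X Y" for X Y :: "'b set"
  proof -
    obtain A where A: "orthogonal_transformation A" "A ` X = Y"
      using iso by (auto simp: isometric_hypersurfaces_def)
    have "inv A ` Y = X"
      using A(2) orthogonal_transformation_inj[OF A(1)] by (auto simp: image_image)
    then show ?thesis
      using orthogonal_transformation_inv[OF A(1)] by (auto simp: isometric_hypersurfaces_def)
  qed
  have ne: "\<not> isometric_hypersurfaces (S (fst (x i))) (S (fst (x j)))" if "i \<noteq> j" for i j
    using that no_iso[of i j] no_iso[of j i] sym by (cases "i < j") auto
  have refl: "isometric_hypersurfaces X X" for X :: "'b set"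
    unfolding isometric_hypersurfaces_def by (intro exI[of _ "\<lambda>v. v"]) (auto simp: orthogonal_transformation_def linear_iff)
  \<comment> \<open>Equal functions have equal, hence isometric, images; so distinct indices give
    distinct functions and the family is infinite.\<close>
  have "inj (\<lambda>i. fst (x i))"
    using ne refl by (metis injI)
  then have "infinite (range (\<lambda>i. fst (x i)))"
    by (rule range_inj_infinite)
  moreover have "pairwise (\<lambda>f g. \<not> isometric_hypersurfaces (S f) (S g)) (range (\<lambda>i. fst (x i)))"
    using ne by (auto simp: pairwise_def) metis
  ultimately show ?thesis
    using good by (intro exI[of _ "range (\<lambda>i. fst (x i))"]) (auto simp: good_def)
qed

theorem theorem1p2:
  fixes n :: nat
  assumes "n \<in> {2, 3}"
    and "CARD('n::finite) = n"
    and "CARD('m::finite) = 2 * n + 1"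
  shows "\<exists>\<F> :: ((real^'n) \<times> (real^'n) \<times> (real^2) \<Rightarrow> real^'m) set.
    infinite \<F> \<and>
    (\<forall>f\<in>\<F>. minimal_immersion_in_sphere sphere_product f) \<and>
    pairwise (\<lambda>f g. \<not> isometric_hypersurfaces (f ` sphere_product) (g ` sphere_product)) \<F>"
proof -
  \<comment> \<open>Equal dimensions give a linear isometry \<open>J\<close> onto
    \<open>real^'m\<close> with inverse \<open>G\<close>; the whole construction takes place in the
    product and is transported by \<open>J\<close>.\<close>
  have "DIM((real^'n) \<times> (real^'n) \<times> real) = DIM(real^'m)"
    using assms by simp
  then obtain J :: "(real^'n) \<times> (real^'n) \<times> real \<Rightarrow> real^'m" and G
    where J_lin: "linear J" and J_norm: "\<And>p. norm (J p) = norm p"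
      and G_lin: "linear G" and G_norm: "\<And>v. norm (G v) = norm v"
      and GJ: "\<And>p. G (J p) = p" and JG: "\<And>v. J (G v) = v"
    by (rule isomorphisms_UNIV_UNIV) blast
  have J_inner: "J p \<bullet> J q = p \<bullet> q" for p q
  proof -
    have "norm (J p + J q) = norm (p + q)" using J_norm[of "p + q"] by (simp add: linear_add[OF J_lin])
    then show ?thesis using J_norm[of p] J_norm[of q]
      by (simp add: dot_norm)
  qed
  define m where "m = n - 1"
  have m: "m = 1 \<or> m = 2" and card: "CARD('n) = m + 1" using assms by (auto simp: m_def)
  show ?thesis
  proof (rule infinite_pairwise_non_isometric[where q = "\<lambda>v. cone_form (G v)"])
    fix \<epsilon> :: real assume "0 < \<epsilon>"
    then obtain u b h T where prof: "closed_profile m u b h T"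
      and small: "\<And>t. (1 / cosh (u t))\<^sup>2 * \<bar>sin (2 * b t)\<bar> \<le> \<epsilon>"
      using closed_profiles[OF m] by blast
    interpret closed_profile m u b h T by (rule prof)
    have frame: "rotation_frame J T" by (intro rotation_frame.intro J_lin J_inner T_pos)
    interpret rotation_frame J T by (rule frame)
    let ?f = "lift c1 c2 c3"
    have min: "minimal_immersion_in_sphere sphere_product ?f"
      by (rule rotational_immersion.minimal_immersion[OF rotational_immersion[OF frame card]])
    have image: "?f ` sphere_product = {J (c1 s *\<^sub>R x, c2 s *\<^sub>R y, c3 s) |s x y. norm x = 1 \<and> norm y = 1}"
      by (rule lift_image[of c1 c2 c3, OF c_periodic])
    have flat: "\<bar>cone_form (G v)\<bar> \<le> \<epsilon>" if mem: "v \<in> ?f ` sphere_product" for v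
    proof -
      obtain s x y where v: "v = J (c1 s *\<^sub>R x, c2 s *\<^sub>R y, c3 s)" "norm x = 1" "norm y = 1"
        using mem unfolding image by blast
      have "cone_form (G v) = (c1 s)\<^sup>2 - (c2 s)\<^sup>2"
        using v(2,3) by (simp add: v(1) GJ cone_form_def norm_eq_1 power2_eq_square)
      then show ?thesis using small[of s] by (simp add: c_diff_squares abs_mult)
    qed
    obtain K where K: "0 < K" "\<And>(F :: (real^'n) \<times> (real^'n) \<times> real \<Rightarrow> (real^'n) \<times> (real^'n) \<times> real) \<delta> p. linear F \<Longrightarrow>
      (\<And>s x y. norm x = 1 \<Longrightarrow> norm y = 1 \<Longrightarrow> \<bar>cone_form (F (c1 s *\<^sub>R x, c2 s *\<^sub>R y, c3 s))\<bar> \<le> \<delta>) \<Longrightarrow>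
      norm p = 1 \<Longrightarrow> \<bar>cone_form (F p)\<bar> \<le> K * \<delta>"
      using cone_form_lower_bound[where 'n = 'n] by metis
    have lower: "\<exists>v\<in>?f ` sphere_product. 1 / (2 * K) \<le> \<bar>cone_form (G (A v))\<bar>"
      if A: "orthogonal_transformation A" for A
    proof (rule ccontr)
      assume "\<not> ?thesis"
      then have le: "\<bar>cone_form (G (A v))\<bar> \<le> 1 / (2 * K)" if "v \<in> ?f ` sphere_product" for v
        using that by force
      define F where "F p = G (A (J p))" for p
      have lin: "linear F"
        using linear_compose[OF J_lin linear_compose[OF orthogonal_transformation_linear[OF A] G_lin]]
        by (simp add: F_def[abs_def] o_def)
      obtain e :: "real^'n" where e: "norm e = 1" using vector_choose_size[of 1] by auto
      \<comment> \<open>The unit vector that \<open>F\<close> sends to \<open>(e, 0, 0)\<close>,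
        where the cone form is 1. The threshold \<open>1 / (2 * K)\<close> would force it to be at
        most 1/2.\<close>
      define p where "p = G (inv A (J (e, 0, 0)))"
      have "F p = (e, 0, 0)"
        by (simp add: F_def p_def JG GJ surj_f_inv_f[OF orthogonal_transformation_surj[OF A]])
      moreover have "norm p = 1"
        using orthogonal_transformation_norm[OF orthogonal_transformation_inv[OF A]] e
        by (simp add: p_def G_norm J_norm norm_Pair)
      moreover have "\<bar>cone_form (F p)\<bar> \<le> K * (1 / (2 * K))"
      proof (rule K(2)[OF lin _ \<open>norm p = 1\<close>])
        fix s and x y :: "real^'n" assume "norm x = 1" "norm y = 1"
        then have "J (c1 s *\<^sub>R x, c2 s *\<^sub>R y, c3 s) \<in> ?f ` sphere_product" unfolding image by blast
        then show "\<bar>cone_form (F (c1 s *\<^sub>R x, c2 s *\<^sub>R y, c3 s))\<bar> \<le> 1 / (2 * K)"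
          unfolding F_def by (rule le)
      qed
      ultimately show False using e K(1) by (simp add: cone_form_def norm_eq_1)
    qed
    show "\<exists>(f :: (real^'n) \<times> (real^'n) \<times> (real^2) \<Rightarrow> real^'m) \<mu>. minimal_immersion_in_sphere sphere_product f \<and> (\<forall>v\<in>f ` sphere_product. \<bar>cone_form (G v)\<bar> \<le> \<epsilon>) \<and>
      0 < \<mu> \<and> (\<forall>A. orthogonal_transformation A \<longrightarrow> (\<exists>v\<in>f ` sphere_product. \<mu> \<le> \<bar>cone_form (G (A v))\<bar>))"
      using min flat lower K(1) by (intro exI[of _ ?f] exI[of _ "1 / (2 * K)"] conjI) auto
  qed
qed

end
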